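(* Assume the standing setup below with $\beta_n\to\infty$ and $\beta_nn^{-\alpha}\to0$. Define $\mathcal Y(q)=\nabla_{\mathbb S^{d-1}}\log\rho(q)-\frac{d-1}{2}q$ and $\Sigma(q)=\frac{c_d}{\rho(q)}\mathbf P_q$ with $c_d=2^{-d}\pi^{-(d-1)/2}$. (1) If $\beta_n^{1+\alpha}n^{-\alpha}\to0$, then $\beta_n\mathcal Y_n(q)\to V\mathcal Y(q)$ in probability. (2) If $\beta_n^{1+\alpha}n^{-\alpha}\to\tau\in(0,\infty)$, then $\beta_n\mathcal Y_n(q)\to V\mathcal Y(q)+G_\tau$ in distribution, where $G_\tau\sim\mathcal N(0,\tau^{1/\alpha}V\Sigma(q)V^\top)$. (3) If $\beta_n^{1+\alpha}n^{-\alpha}\to\infty$, then $\sqrt{n\beta_n^{1-1/\alpha}}\,\mathcal Y_n(q)\to G_1$ in distribution, where $G_1\sim\mathcal N(0,V\Sigma(q)V^\top)$. In all three cases $\mathcal Y_n(q)\to0$ and $\mathrm{ATT}(n)\to Vq$ in probability.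
   Context: Standing setup: Fix an integer $d\ge 2$; let $\mathbb S^{d-1}\subset\mathbb R^d$ be the unit sphere with surface measure $\sigma$. Fix $q\in\mathbb S^{d-1}$. Let $x_1,x_2,\dots$ be i.i.d. random vectors on $\mathbb S^{d-1}$ with law $\rho(x)\,d\sigma(x)$, where $\rho$ is a $C^2$ probability density on $\mathbb S^{d-1}$ with $\rho(q)>0$. Let $(\beta_n)_{n\ge1}$ be positive reals and set $\alpha=2/(d-1)$. Define $T_i=1-\langle q,x_i\rangle$, $Z_n=\sum_{j=1}^n e^{-\beta_nT_j}$, $A_i=e^{-\beta_nT_i}/Z_n$. Let $V\in\mathbb R^{d\times d}$ be fixed, $\mathrm{ATT}(n)=V\sum_{j=1}^nA_jx_j$ and $\mathcal Y_n(q)=\mathrm{ATT}(n)-Vq=V\sum_{i=1}^nA_i(x_i-q)$. $\mathbf P_q=\mathrm{Id}-qq^\top$ is the orthogonal projection onto the tangent space $T_q\mathbb S^{d-1}$, and $\nabla_{\mathbb S^{d-1}}$ is the spherical (Riemannian) gradient, viewed as a vector in $T_q\mathbb S^{d-1}\subset\mathbb R^d$. *)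

theory Defs
  imports "HOL-Probability.Probability"
begin

(* Surface measure on the unit sphere S^{d-1} of R^d (as a measure on the Borel sets of R^d,
   concentrated on sphere 0 1): cone-measure construction
   sigma(A) = d * Lebesgue({t x | x in A, 0 < t <= 1}), i.e. d times the push-forward of Lebesgue
   measure on the punctured unit ball under radial projection x |-> x / |x|. *)
definition sphere_surface :: "(real ^ 'd) measure" where
  "sphere_surface =
     scale_measure (of_nat CARD('d))
       (distr (restrict_space lborel (ball 0 1 - {0})) borel (\<lambda>x. x /\<^sub>R norm x))"

definition C2_on :: "(real ^ 'd) set \<Rightarrow> (real ^ 'd \<Rightarrow> real) \<Rightarrow> bool" where
  "C2_on U f \<longleftrightarrow> (\<exists>Df D2f.
      (\<forall>x\<in>U. (f has_derivative blinfun_apply (Df x)) (at x)) \<and>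
      (\<forall>x\<in>U. (Df has_derivative blinfun_apply (D2f x)) (at x)) \<and>
      continuous_on U D2f)"

definition grad :: "(real ^ 'd \<Rightarrow> real) \<Rightarrow> real ^ 'd \<Rightarrow> real ^ 'd" where
  "grad f x = (THE D. GDERIV f x :> D)"

definition tang_proj :: "real ^ 'd \<Rightarrow> real ^ 'd ^ 'd" where
  "tang_proj q = mat 1 - (\<chi> i j. q $ i * q $ j)"

(* spherical (Riemannian) gradient of f at q: projection of the gradient of any
   smooth extension of f onto T_q S^{d-1} *)
definition sph_grad :: "(real ^ 'd \<Rightarrow> real) \<Rightarrow> real ^ 'd \<Rightarrow> real ^ 'd" where
  "sph_grad f q = tang_proj q *v grad f q"

definition Tq :: "real ^ 'd \<Rightarrow> (nat \<Rightarrow> 'a \<Rightarrow> real ^ 'd) \<Rightarrow> nat \<Rightarrow> 'a \<Rightarrow> real" where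
  "Tq q X i \<omega> = 1 - inner q (X i \<omega>)"

definition Zn :: "(nat \<Rightarrow> real) \<Rightarrow> real ^ 'd \<Rightarrow> (nat \<Rightarrow> 'a \<Rightarrow> real ^ 'd) \<Rightarrow> nat \<Rightarrow> 'a \<Rightarrow> real" where
  "Zn \<beta> q X n \<omega> = (\<Sum>j\<in>{1..n}. exp (- \<beta> n * Tq q X j \<omega>))"

definition Aw :: "(nat \<Rightarrow> real) \<Rightarrow> real ^ 'd \<Rightarrow> (nat \<Rightarrow> 'a \<Rightarrow> real ^ 'd) \<Rightarrow> nat \<Rightarrow> nat \<Rightarrow> 'a \<Rightarrow> real" where
  "Aw \<beta> q X n i \<omega> = exp (- \<beta> n * Tq q X i \<omega>) / Zn \<beta> q X n \<omega>"

definition ATT :: "real ^ 'd ^ 'd \<Rightarrow> (nat \<Rightarrow> real) \<Rightarrow> real ^ 'd \<Rightarrow> (nat \<Rightarrow> 'a \<Rightarrow> real ^ 'd) \<Rightarrow> nat \<Rightarrow> 'a \<Rightarrow> real ^ 'd" where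
  "ATT V \<beta> q X n \<omega> = V *v (\<Sum>j\<in>{1..n}. Aw \<beta> q X n j \<omega> *\<^sub>R X j \<omega>)"

definition Ycal_n :: "real ^ 'd ^ 'd \<Rightarrow> (nat \<Rightarrow> real) \<Rightarrow> real ^ 'd \<Rightarrow> (nat \<Rightarrow> 'a \<Rightarrow> real ^ 'd) \<Rightarrow> nat \<Rightarrow> 'a \<Rightarrow> real ^ 'd" where
  "Ycal_n V \<beta> q X n \<omega> = ATT V \<beta> q X n \<omega> - V *v q"

definition conv_in_prob :: "'a measure \<Rightarrow> (nat \<Rightarrow> 'a \<Rightarrow> 'b::metric_space) \<Rightarrow> 'b \<Rightarrow> bool" where
  "conv_in_prob M Y c \<longleftrightarrow>
     (\<forall>e>0. (\<lambda>n. measure M {\<omega>\<in>space M. dist (Y n \<omega>) c > e}) \<longlonglongrightarrow> 0)"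

definition conv_in_distr :: "'a measure \<Rightarrow> (nat \<Rightarrow> 'a \<Rightarrow> 'b::euclidean_space) \<Rightarrow> 'b measure \<Rightarrow> bool" where
  "conv_in_distr M Y \<mu> \<longleftrightarrow>
     (\<forall>f::'b \<Rightarrow> real. continuous_on UNIV f \<and> bounded (range f) \<longrightarrow>
        (\<lambda>n. integral\<^sup>L M (\<lambda>\<omega>. f (Y n \<omega>))) \<longlonglongrightarrow> integral\<^sup>L \<mu> f)"

(* (possibly degenerate) multivariate normal law N(m, C) on R^d, via its characteristic function *)
definition gaussian_law :: "real ^ 'd \<Rightarrow> real ^ 'd ^ 'd \<Rightarrow> (real ^ 'd) measure \<Rightarrow> bool" where
  "gaussian_law m C \<mu> \<longleftrightarrow> prob_space \<mu> \<and> sets \<mu> = sets borel \<and>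
     (\<forall>t. (CLINT x|\<mu>. cis (inner t x)) = cis (inner t m) * complex_of_real (exp (- inner t (C *v t) / 2)))"

end

(* Blow up the sphere around q at scale 1 / sqrt beta: for a point x of the sphere, beta (1 - <q, x>) tends
   to |v|^2 / 2 when sqrt beta (x - q) tends to the tangent vector v.  Dominated convergence therefore turns
   every moment of the weights exp (- beta (1 - <q, x>)) into a Gaussian moment on the tangent space, times
   beta^(-(d-1)/2).  The tangential part of the first moment vanishes to leading order by reflection in the
   axis q; its next order produces the gradient of the density, while the normal part -(1 - <q, x>) produces
   the drift -(d-1)/2 q.

   For a scaling s_n the projection <t, s_n Y_n> is a quotient A_n / R_n.  The denominator R_n = Z_n / E Z_n
   tends to 1 by Chebyshev, and A_n is a sum of i.i.d. bounded variables whose supremum tends to 0, so its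
   characteristic function is determined by the limits of n E h_n and n E h_n^2.  The three regimes, and the
   law of large numbers (s_n = 1), are instances of this one limit. *)

theory Submission
  imports Defs
begin

section \<open>Gaussian integrals on Euclidean space\<close>

text \<open>The surface measure is never parametrised by charts. Its cone definition turns a surface
  integral into a Lebesgue integral over the unit ball, where scaling the d - 1 directions
  orthogonal to \<open>q\<close> is linear with an explicit determinant; the slope
  \<open>y /\<^sub>R (q \<bullet> y) - q\<close> plays the tangent vector and the radial coordinate
  integrates out. Limits in law are tested on functions of d variables, so a multivariate Levy
  theorem is built by Gaussian smoothing; the same Gaussian yields rotation invariance and the limit
  laws.

  Let k = 1 / \<alpha> = (d - 1) / 2. The output error has drift of order 1 / \<beta> and variance
  of order \<beta>^(k - 1) / n. The ratio of variance to squared drift is \<beta>^(k + 1) / n, the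
  k-th power of the regime parameter; this explains the regimes and the power 1 / \<alpha> of
  \<tau>. The assumption \<beta> n^(- \<alpha>) -> 0 says that n \<beta>^(- k), the order of E Z_n,
  tends to infinity. Squaring the weights doubles \<beta>, which costs a factor 2^(- k) / 2 in the
  second moment; dividing by the Gaussian mass (2 pi)^k gives c_d.\<close>

lemma borel_measurable_cis [measurable]: "cis \<in> borel_measurable borel"
  by (intro borel_measurable_continuous_onI continuous_intros)

text \<open>Lebesgue measure is the image of a product of real lines (\<open>lborel_eq\<close>), so
  product integrands factor. The value type is general because complex factors occur in
  \<open>char_std_gauss\<close>.\<close>

lemma has_bochner_integral_lborel_prod:
  fixes g :: "'a::euclidean_space \<Rightarrow> real \<Rightarrow> 'c::{real_normed_field,banach,second_countable_topology}"
  assumes "\<And>b. b \<in> Basis \<Longrightarrow> integrable lborel (g b)"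
  shows "has_bochner_integral lborel (\<lambda>x. \<Prod>b\<in>Basis. g b (x \<bullet> b)) (\<Prod>b\<in>Basis. integral\<^sup>L lborel (g b))"
proof -
  interpret product_sigma_finite "\<lambda>_::'a. lborel :: real measure" ..
  have [measurable]: "b \<in> Basis \<Longrightarrow> g b \<in> borel_measurable borel" for b
    using borel_measurable_integrable[OF assms] by simp
  have eq: "(\<Prod>b\<in>Basis. g b ((\<Sum>b'\<in>Basis. f b' *\<^sub>R b') \<bullet> b)) = (\<Prod>b\<in>Basis. g b (f b))" for f :: "'a \<Rightarrow> real"
    by (intro prod.cong refl) (simp add: inner_sum_left inner_Basis if_distrib sum.delta cong: if_cong)
  show ?thesis
    unfolding has_bochner_integral_iff
  proof
    show "integrable lborel (\<lambda>x. \<Prod>b\<in>Basis. g b (x \<bullet> b))"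
      by (subst lborel_eq) (simp add: integrable_distr_eq eq assms product_integrable_prod)
    show "integral\<^sup>L lborel (\<lambda>x. \<Prod>b\<in>Basis. g b (x \<bullet> b)) = (\<Prod>b\<in>Basis. integral\<^sup>L lborel (g b))"
      by (subst lborel_eq) (simp add: integral_distr eq assms product_integral_prod)
  qed
qed

text \<open>The product over \<open>Basis\<close> lets the mass and the characteristic function
  factor; the form through the norm, in \<open>prod_std_normal_density\<close>, serves smoothing and
  rotation invariance.\<close>

definition std_gauss :: "'a::euclidean_space measure" where
  "std_gauss = density lborel (\<lambda>x. ennreal (\<Prod>b\<in>Basis. std_normal_density (x \<bullet> b)))"

lemma prod_std_normal_density:
  fixes x :: "'a::euclidean_space"
  shows "(\<Prod>b\<in>Basis. std_normal_density (x \<bullet> b)) = exp (- (norm x)\<^sup>2 / 2) / sqrt (2 * pi) ^ DIM('a)"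
proof -
  have "(norm x)\<^sup>2 = (\<Sum>b\<in>Basis. (x \<bullet> b)\<^sup>2)"
    by (simp add: norm_eq_sqrt_inner euclidean_inner[of x x] power2_eq_square sum_nonneg)
  then show ?thesis
    by (simp add: std_normal_density_def prod_dividef exp_sum[symmetric] sum_negf sum_divide_distrib
        power_divide)
qed

lemma sets_std_gauss [simp, measurable_cong]: "sets std_gauss = sets borel"
  by (simp add: std_gauss_def)

lemma space_std_gauss [simp]: "space std_gauss = UNIV"
  by (simp add: std_gauss_def)

lemma integral_std_gauss:
  fixes f :: "'a::euclidean_space \<Rightarrow> 'b::{banach, second_countable_topology}"
  assumes [measurable]: "f \<in> borel_measurable borel"
  shows "integral\<^sup>L std_gauss f
    = (\<integral>x. (exp (- (norm x)\<^sup>2 / 2) / sqrt (2 * pi) ^ DIM('a)) *\<^sub>R f x \<partial>lborel)"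
  unfolding std_gauss_def prod_std_normal_density
  by (subst integral_density) auto

lemma prob_space_std_gauss: "prob_space (std_gauss :: 'a::euclidean_space measure)"
proof
  have "has_bochner_integral lborel (\<lambda>x::'a. \<Prod>b\<in>Basis. std_normal_density (x \<bullet> b)) 1"
    using has_bochner_integral_lborel_prod[of "\<lambda>_::'a. std_normal_density"] by simp
  then show "emeasure (std_gauss :: 'a measure) (space std_gauss) = 1"
    by (simp add: std_gauss_def emeasure_density has_bochner_integral_iff nn_integral_eq_integral
        prod_nonneg del: prod_std_normal_density)
qed

text \<open>Each coordinate contributes a one-dimensional characteristic function. The formula
  drives the smoothing kernel, rotation invariance and the characteristic functions of the limit
  laws.\<close>

lemma char_std_gauss: "(CLINT x|std_gauss. cis (t \<bullet> x)) = complex_of_real (exp (- (norm t)\<^sup>2 / 2))"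
proof -
  let ?g = "\<lambda>b u. std_normal_density u *\<^sub>R cis ((t \<bullet> b) * u)"
  have int: "integrable lborel (?g b)" for b
    by (rule Bochner_Integration.integrable_bound[OF integrable_normal_density[of 1 0]]) auto
  have ch: "integral\<^sup>L lborel (?g b) = complex_of_real (exp (- (t \<bullet> b)\<^sup>2 / 2))" for b
    using fun_cong[OF char_std_normal_distribution, of "t \<bullet> b"]
    by (simp add: char_def integral_density cis_conv_exp)
  have cis_sum: "cis (\<Sum>b\<in>A. h b) = (\<Prod>b\<in>A. cis (h b))" if "finite A" for A :: "'a set" and h
    using that by (induction A) (auto simp: cis_mult[symmetric])
  have "(CLINT x|std_gauss. cis (t \<bullet> x))
      = (CLINT x|lborel. \<Prod>b\<in>Basis. ?g b (x \<bullet> b))"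
  proof -
    have "(\<Prod>b\<in>Basis. std_normal_density (x \<bullet> b)) *\<^sub>R cis (t \<bullet> x) = (\<Prod>b\<in>Basis. ?g b (x \<bullet> b))" for x
    proof -
      have "cis (t \<bullet> x) = (\<Prod>b\<in>Basis. cis ((t \<bullet> b) * (x \<bullet> b)))"
        by (subst euclidean_inner) (rule cis_sum, simp)
      then show ?thesis
        by (simp only: scaleR_conv_of_real prod.distrib of_real_prod)
    qed
    then show ?thesis
      unfolding std_gauss_def by (subst integral_density) (simp_all add: prod_nonneg)
  qed
  also have "\<dots> = (\<Prod>b\<in>Basis. complex_of_real (exp (- (t \<bullet> b)\<^sup>2 / 2)))"
    using has_bochner_integral_lborel_prod[of ?g] int by (simp add: ch has_bochner_integral_iff)
  also have "\<dots> = complex_of_real (exp (- (norm t)\<^sup>2 / 2))"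
  proof -
    have "(norm t)\<^sup>2 = (\<Sum>b\<in>Basis. (t \<bullet> b)\<^sup>2)"
      by (simp add: norm_eq_sqrt_inner euclidean_inner[of t t] power2_eq_square sum_nonneg)
    then show ?thesis
      by (simp add: exp_sum[symmetric] sum_negf sum_divide_distrib flip: of_real_prod)
  qed
  finally show ?thesis .
qed

text \<open>Provides the majorant for dominated convergence in \<open>laplace_sphere\<close>; the
  one-dimensional factor is an unnormalised normal density of variance
  \<open>1 / (2 * c)\<close>.\<close>

lemma integrable_exp_norm2:
  assumes "c > 0"
  shows "integrable lborel (\<lambda>x::'a::euclidean_space. exp (- c * (norm x)\<^sup>2))"
proof -
  have 1: "integrable lborel (\<lambda>u::real. exp (- c * u\<^sup>2))"
  proof -
    have "integrable lborel (\<lambda>u::real. sqrt (2 * pi * (1 / (2 * c))) * normal_density 0 (sqrt (1 / (2 * c))) u)"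
      using assms by (intro integrable_mult_right integrable_normal_density) auto
    also have "(\<lambda>u::real. sqrt (2 * pi * (1 / (2 * c))) * normal_density 0 (sqrt (1 / (2 * c))) u)
      = (\<lambda>u. exp (- c * u\<^sup>2))"
      using assms by (auto simp: normal_density_def field_simps)
    finally show ?thesis .
  qed
  have "(norm x)\<^sup>2 = (\<Sum>b\<in>Basis. (x \<bullet> b)\<^sup>2)" for x :: 'a
    by (simp add: norm_eq_sqrt_inner euclidean_inner[of x x] power2_eq_square sum_nonneg)
  then have "(\<lambda>x::'a. exp (- c * (norm x)\<^sup>2)) = (\<lambda>x. \<Prod>b\<in>Basis. exp (- c * (x \<bullet> b)\<^sup>2))"
    by (auto simp: exp_sum[symmetric] sum_distrib_left sum_negf)
  then show ?thesis
    using has_bochner_integral_lborel_prod[of "\<lambda>_::'a. \<lambda>u. exp (- c * u\<^sup>2)"] 1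
    by (simp add: has_bochner_integral_iff)
qed

section \<open>Levy's continuity theorem in Euclidean space\<close>

context
  fixes e :: real
  assumes e: "e > 0"
begin

text \<open>Substituting z = y + e w moves the dependence on \<open>y\<close> from \<open>f\<close>
  into a Gaussian kernel, which Fubini can then integrate against a measure in
  \<open>y\<close>.\<close>

lemma integral_std_gauss_shift:
  fixes f :: "'a::euclidean_space \<Rightarrow> real"
  assumes [measurable]: "f \<in> borel_measurable borel"
  shows "(\<integral>w. f (y + e *\<^sub>R w) \<partial>std_gauss)
    = (\<integral>z. f z * exp (- (norm (z - y))\<^sup>2 / (2 * e\<^sup>2)) \<partial>lborel) / (e * sqrt (2 * pi)) ^ DIM('a)"
proof -
  let ?h = "\<lambda>z. f z * exp (- (norm (z - y))\<^sup>2 / (2 * e\<^sup>2))"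
  have "integral\<^sup>L lborel ?h
      = integral\<^sup>L (density (distr lborel borel (\<lambda>x. y + e *\<^sub>R x)) (\<lambda>_. ennreal (\<bar>e\<bar> ^ DIM('a)))) ?h"
    using e by (subst lborel_affine[of e y]) auto
  also have "\<dots> = e ^ DIM('a) * (\<integral>x. f (y + e *\<^sub>R x) * exp (- (norm x)\<^sup>2 / 2) \<partial>lborel)"
    using e by (simp add: integral_density integral_distr power_mult_distrib)
  finally show ?thesis
    using e by (simp add: integral_std_gauss power_mult_distrib mult.commute)
qed

text \<open>The Gaussian kernel is itself a characteristic function, so smoothing a test function with it
  expresses its integral against \<^term>\<open>\<nu>\<close> through the characteristic function of \<^term>\<open>\<nu>\<close>.\<close>

lemma gauss_kernel_char:
  fixes \<nu> :: "'a::euclidean_space measure"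
  assumes "prob_space \<nu>" and [measurable_cong]: "sets \<nu> = sets borel"
  shows "complex_of_real (\<integral>y. exp (- (norm (z - y))\<^sup>2 / (2 * e\<^sup>2)) \<partial>\<nu>)
    = (CLINT u|std_gauss. cis (u \<bullet> z / e) * (CLINT y|\<nu>. cis ((- (1 / e) *\<^sub>R u) \<bullet> y)))"
proof -
  interpret N: prob_space \<nu> by fact
  interpret G: prob_space "std_gauss :: 'a measure" by (rule prob_space_std_gauss)
  interpret P: pair_prob_space \<nu> "std_gauss :: 'a measure" ..
  let ?f = "\<lambda>y u. cis (u \<bullet> (z - y) / e)"
  have eq: "complex_of_real (exp (- (norm (z - y))\<^sup>2 / (2 * e\<^sup>2))) = (CLINT u|std_gauss. ?f y u)" for y
    using char_std_gauss[of "(1 / e) *\<^sub>R (z - y)"] e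
    by (simp add: inner_commute power_divide mult.commute)
  have "complex_of_real (\<integral>y. exp (- (norm (z - y))\<^sup>2 / (2 * e\<^sup>2)) \<partial>\<nu>)
      = (CLINT y|\<nu>. CLINT u|std_gauss. ?f y u)"
    by (simp only: integral_complex_of_real[symmetric] eq)
  also have "\<dots> = (CLINT u|std_gauss. CLINT y|\<nu>. ?f y u)"
    by (rule P.Fubini_integral[symmetric], rule P.P.integrable_const_bound[where B=1]) auto
  also have "\<dots> = (CLINT u|std_gauss. cis (u \<bullet> z / e) * (CLINT y|\<nu>. cis ((- (1 / e) *\<^sub>R u) \<bullet> y)))"
  proof (intro Bochner_Integration.integral_cong refl)
    fix u :: 'a
    have "?f y u = cis (u \<bullet> z / e) * cis ((- (1 / e) *\<^sub>R u) \<bullet> y)" for y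
      by (simp add: cis_mult inner_diff_right diff_divide_distrib)
    then show "(CLINT y|\<nu>. ?f y u) = cis (u \<bullet> z / e) * (CLINT y|\<nu>. cis ((- (1 / e) *\<^sub>R u) \<bullet> y))"
      by simp
  qed
  finally show ?thesis .
qed

text \<open>Fubini leaves \<open>f\<close> integrated against the kernel integrals
  \<open>?K\<close>, and \<open>gauss_kernel_char\<close> writes these through the characteristic
  function. Dominated convergence is applied twice: in the frequency variable with majorant 1, then
  in \<open>z\<close> with majorant \<open>\<bar>f z\<bar>\<close>, which is where Lebesgue
  integrability of \<open>f\<close> enters.\<close>

lemma tendsto_smoothed_integral:
  fixes \<nu> :: "nat \<Rightarrow> 'a::euclidean_space measure" and f :: "'a \<Rightarrow> real"
  assumes p: "\<And>n. prob_space (\<nu> n)" "prob_space \<mu>"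
    and s: "\<And>n. sets (\<nu> n) = sets borel" "sets \<mu> = sets borel"
    and ch: "\<And>t. (\<lambda>n. CLINT x|\<nu> n. cis (t \<bullet> x)) \<longlonglongrightarrow> (CLINT x|\<mu>. cis (t \<bullet> x))"
    and f: "integrable lborel f"
  shows "(\<lambda>n. \<integral>y. (\<integral>w. f (y + e *\<^sub>R w) \<partial>std_gauss) \<partial>\<nu> n)
    \<longlonglongrightarrow> (\<integral>y. (\<integral>w. f (y + e *\<^sub>R w) \<partial>std_gauss) \<partial>\<mu>)"
proof -
  have [measurable]: "f \<in> borel_measurable borel"
    using borel_measurable_integrable[OF f] by simp
  interpret G: prob_space "std_gauss :: 'a measure" by (rule prob_space_std_gauss)
  let ?K = "\<lambda>\<nu> z. \<integral>y. exp (- (norm (z - y))\<^sup>2 / (2 * e\<^sup>2)) \<partial>\<nu>"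
  let ?c = "(e * sqrt (2 * pi)) ^ DIM('a)"
  have fub: "(\<integral>y. (\<integral>w. f (y + e *\<^sub>R w) \<partial>std_gauss) \<partial>\<nu>) = (\<integral>z. f z * ?K \<nu> z \<partial>lborel) / ?c"
    if \<nu>: "prob_space \<nu>" "sets \<nu> = sets borel" for \<nu>
  proof -
    interpret N: prob_space \<nu> by fact
    note [measurable_cong] = \<nu>(2)
    interpret P: pair_sigma_finite \<nu> "lborel :: 'a measure" ..
    have "integrable (\<nu> \<Otimes>\<^sub>M lborel) (\<lambda>(y, z). f z)"
      using f by (intro P.Fubini_integrable) auto
    then have I: "integrable (\<nu> \<Otimes>\<^sub>M lborel) (\<lambda>(y, z). f z * exp (- (norm (z - y))\<^sup>2 / (2 * e\<^sup>2)))"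
      by (rule Bochner_Integration.integrable_bound) (auto simp: abs_mult split_beta mult_left_le)
    show ?thesis
      unfolding integral_std_gauss_shift[OF \<open>f \<in> borel_measurable borel\<close>]
      using P.Fubini_integral[OF I] by simp
  qed
  have conv: "(\<lambda>n. ?K (\<nu> n) z) \<longlonglongrightarrow> ?K \<mu> z" for z
  proof -
    have "(\<lambda>n. CLINT u|std_gauss. cis (u \<bullet> z / e) * (CLINT y|\<nu> n. cis ((- (1 / e) *\<^sub>R u) \<bullet> y)))
      \<longlonglongrightarrow> (CLINT u|std_gauss. cis (u \<bullet> z / e) * (CLINT y|\<mu>. cis ((- (1 / e) *\<^sub>R u) \<bullet> y)))"
    proof (rule integral_dominated_convergence[where w="\<lambda>_. 1"])
      have le1: "norm (CLINT y|\<nu>. cis (t \<bullet> y)) \<le> 1" if "prob_space \<nu>" "sets \<nu> = sets borel" for \<nu> :: "'a measure" and t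
      proof -
        interpret N: prob_space \<nu> by fact
        have "norm (CLINT y|\<nu>. cis (t \<bullet> y)) \<le> (\<integral>y. norm (cis (t \<bullet> y)) \<partial>\<nu>)"
          by (rule integral_norm_bound)
        then show ?thesis by (simp add: N.prob_space)
      qed
      have meas: "(\<lambda>u. CLINT y|\<nu>. cis ((- (1 / e) *\<^sub>R u) \<bullet> y)) \<in> borel_measurable std_gauss"
        if \<nu>: "prob_space \<nu>" "sets \<nu> = sets borel" for \<nu> :: "'a measure"
      proof -
        interpret N: prob_space \<nu> by fact
        note [measurable_cong] = \<nu>(2)
        show ?thesis by measurable
      qed
      note [measurable] = meas[OF p(1) s(1)] meas[OF p(2) s(2)]
      show "(\<lambda>u. cis (u \<bullet> z / e) * (CLINT y|\<mu>. cis ((- (1 / e) *\<^sub>R u) \<bullet> y))) \<in> borel_measurable std_gauss"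
        by measurable
      show "(\<lambda>u. cis (u \<bullet> z / e) * (CLINT y|\<nu> n. cis ((- (1 / e) *\<^sub>R u) \<bullet> y))) \<in> borel_measurable std_gauss" for n
        by measurable
      show "AE u in std_gauss. norm (cis (u \<bullet> z / e) * (CLINT y|\<nu> n. cis ((- (1 / e) *\<^sub>R u) \<bullet> y))) \<le> 1" for n
        unfolding norm_mult norm_cis mult_1 by (intro AE_I2 le1 p s)
      show "AE u in std_gauss. (\<lambda>n. cis (u \<bullet> z / e) * (CLINT y|\<nu> n. cis ((- (1 / e) *\<^sub>R u) \<bullet> y)))
        \<longlonglongrightarrow> cis (u \<bullet> z / e) * (CLINT y|\<mu>. cis ((- (1 / e) *\<^sub>R u) \<bullet> y))"
        by (intro AE_I2 tendsto_mult tendsto_const ch)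
    qed simp
    then show ?thesis
      unfolding gauss_kernel_char[OF p(1) s(1), symmetric] gauss_kernel_char[OF p(2) s(2), symmetric]
      by (simp add: tendsto_of_real_iff)
  qed
  show ?thesis
    unfolding fub[OF p(1) s(1)] fub[OF p(2) s(2)]
  proof (intro tendsto_divide tendsto_const)
    have meas: "?K \<nu> \<in> borel_measurable borel"
      if \<nu>: "prob_space \<nu>" "sets \<nu> = sets borel" for \<nu> :: "'a measure"
    proof -
      interpret N: prob_space \<nu> by fact
      note [measurable_cong] = \<nu>(2)
      show ?thesis by measurable
    qed
    note [measurable] = meas[OF p(1) s(1)] meas[OF p(2) s(2)]
    have le1: "\<bar>?K \<nu> z\<bar> \<le> 1" if \<nu>: "prob_space \<nu>" "sets \<nu> = sets borel" for \<nu> :: "'a measure" and z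
    proof -
      interpret N: prob_space \<nu> by fact
      note [measurable_cong] = \<nu>(2)
      have "?K \<nu> z \<le> 1"
        by (intro N.integral_le_const N.integrable_const_bound[where B=1]) auto
      then show ?thesis by simp
    qed
    show "(\<lambda>n. \<integral>z. f z * ?K (\<nu> n) z \<partial>lborel) \<longlonglongrightarrow> (\<integral>z. f z * ?K \<mu> z \<partial>lborel)"
    proof (rule integral_dominated_convergence[where w="\<lambda>z. \<bar>f z\<bar>"])
      show "AE z in lborel. norm (f z * ?K (\<nu> n) z) \<le> \<bar>f z\<bar>" for n
        using le1[OF p(1) s(1)] by (simp add: abs_mult mult_left_le)
      show "AE z in lborel. (\<lambda>n. f z * ?K (\<nu> n) z) \<longlonglongrightarrow> f z * ?K \<mu> z"
        by (intro AE_I2 tendsto_mult tendsto_const conv)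
      show "(\<lambda>z. f z * ?K \<mu> z) \<in> borel_measurable lborel"
        by measurable
      show "(\<lambda>z. f z * ?K (\<nu> n) z) \<in> borel_measurable lborel" for n
        by measurable
    qed (use f in auto)
  qed (use e in auto)
qed

end


text \<open>Most of the Gaussian mass lies in a ball of some radius n; taking
  \<open>e = d / real n\<close> shrinks that ball to the modulus of continuity \<open>d\<close>, and
  the tail is controlled by \<open>2 * B\<close>. The estimate is uniform in \<open>y\<close>, so it
  holds under every probability measure at once.\<close>

lemma std_gauss_smoothing_approx:
  fixes f :: "'a::euclidean_space \<Rightarrow> real"
  assumes uc: "uniformly_continuous_on UNIV f" and B: "\<And>x. \<bar>f x\<bar> \<le> B" and \<delta>: "\<delta> > 0"
  obtains e where "e > 0" "\<And>y. \<bar>(\<integral>w. f (y + e *\<^sub>R w) \<partial>std_gauss) - f y\<bar> \<le> \<delta>"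
proof -
  interpret G: prob_space "std_gauss :: 'a measure" by (rule prob_space_std_gauss)
  have [measurable]: "f \<in> borel_measurable borel"
    using uniformly_continuous_imp_continuous[OF uc] by (rule borel_measurable_continuous_onI)
  have B0: "B \<ge> 0" using B[of 0] by simp
  obtain d where d: "d > 0" "\<And>x y. dist x y < d \<Longrightarrow> \<bar>f x - f y\<bar> < \<delta> / 2"
    using uc \<delta> unfolding uniformly_continuous_on_def dist_real_def by (metis UNIV_I half_gt_zero)
  have "(\<lambda>n. measure std_gauss (ball (0::'a) (real n))) \<longlonglongrightarrow> measure std_gauss (\<Union>n. ball (0::'a) (real n))"
    by (rule G.finite_Lim_measure_incseq) (auto simp: incseq_def)
  also have "(\<Union>n. ball (0::'a) (real n)) = UNIV"
    using reals_Archimedean2 by auto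
  finally have lim: "(\<lambda>n. measure std_gauss (ball (0::'a) (real n))) \<longlonglongrightarrow> 1"
    using G.prob_space by simp
  \<comment> \<open>The tail contributes \<open>2 * B\<close> times this tolerance, at most
    \<open>\<delta> / 2\<close>; the \<open>+ 1\<close> avoids division by zero when
    \<open>B = 0\<close>.\<close>
  have "\<forall>\<^sub>F n in sequentially. measure std_gauss (ball (0::'a) (real n)) > 1 - \<delta> / (4 * (B + 1))"
    using \<delta> B0 by (intro order_tendstoD(1)[OF lim]) auto
  then obtain n where n: "n > 0" "measure std_gauss (ball (0::'a) (real n)) > 1 - \<delta> / (4 * (B + 1))"
    using eventually_conj[OF eventually_gt_at_top[of 0]] eventually_happens' sequentially_bot by blast
  have compl: "measure std_gauss (- ball (0::'a) (real n)) < \<delta> / (4 * (B + 1))"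
    using n G.prob_compl[of "ball 0 (real n)"] by (simp add: Compl_eq_Diff_UNIV)
  define e where "e = d / real n"
  have e: "e > 0" using d n by (simp add: e_def)
  have "\<bar>(\<integral>w. f (y + e *\<^sub>R w) \<partial>std_gauss) - f y\<bar> \<le> \<delta>" for y
  proof -
    have I: "integrable std_gauss (\<lambda>w. f (y + e *\<^sub>R w))"
      by (rule G.integrable_const_bound[where B=B]) (auto simp: B)
    have ind: "integrable std_gauss (indicator (- ball (0::'a) (real n)) :: 'a \<Rightarrow> real)"
      by (intro integrable_real_indicator) (auto simp: G.emeasure_eq_measure)
    then have J: "integrable std_gauss (\<lambda>w. \<delta> / 2 + 2 * B * indicator (- ball (0::'a) (real n)) w)"
      by simp
    have pw: "\<bar>f (y + e *\<^sub>R w) - f y\<bar> \<le> \<delta> / 2 + 2 * B * indicator (- ball (0::'a) (real n)) w" for w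
    proof (cases "norm w < real n")
      case True
      then have "e * norm w < d"
        using d n by (simp add: e_def field_simps)
      then have "\<bar>f (y + e *\<^sub>R w) - f y\<bar> < \<delta> / 2"
        using e by (intro d(2)) (simp add: dist_norm)
      with True show ?thesis by simp
    next
      case False
      have "\<bar>f (y + e *\<^sub>R w) - f y\<bar> \<le> 2 * B"
        using B[of "y + e *\<^sub>R w"] B[of y] by linarith
      with False \<delta> show ?thesis by simp
    qed
    have "(\<integral>w. f (y + e *\<^sub>R w) \<partial>std_gauss) - f y = (\<integral>w. f (y + e *\<^sub>R w) - f y \<partial>std_gauss)"
      using I by (simp add: G.prob_space[simplified])
    also have "\<bar>\<dots>\<bar> \<le> (\<integral>w. \<bar>f (y + e *\<^sub>R w) - f y\<bar> \<partial>std_gauss)"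
      by (rule integral_abs_bound)
    also have "\<dots> \<le> (\<integral>w. \<delta> / 2 + 2 * B * indicator (- ball (0::'a) (real n)) w \<partial>std_gauss)"
      by (intro integral_mono) (use I J pw in auto)
    also have "\<dots> = \<delta> / 2 + 2 * B * measure std_gauss (- ball (0::'a) (real n))"
      using ind by (simp add: G.prob_space[simplified])
    also have "\<dots> \<le> \<delta> / 2 + 2 * B * (\<delta> / (4 * (B + 1)))"
      using compl B0 by (intro add_mono mult_left_mono) auto
    also have "\<dots> \<le> \<delta>"
      using B0 \<delta> by (simp add: field_simps)
    finally show ?thesis .
  qed
  with e show ?thesis by (rule that)
qed

lemma (in prob_space) abs_integral_diff_le:
  assumes [measurable]: "f \<in> borel_measurable M" "g \<in> borel_measurable M"
    and "\<And>x. \<bar>f x\<bar> \<le> B" "\<And>x. \<bar>g x - f x\<bar> \<le> (\<delta>::real)"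
  shows "\<bar>integral\<^sup>L M g - integral\<^sup>L M f\<bar> \<le> \<delta>"
proof -
  have f: "integrable M f"
    by (rule integrable_const_bound[where B=B]) (auto simp: assms)
  have "\<bar>g x\<bar> \<le> B + \<delta>" for x
    using assms(3,4)[of x] by linarith
  then have g: "integrable M g"
    by (intro integrable_const_bound[where B="B + \<delta>"]) auto
  have "\<bar>integral\<^sup>L M g - integral\<^sup>L M f\<bar> = \<bar>\<integral>x. g x - f x \<partial>M\<bar>"
    using f g by simp
  also have "\<dots> \<le> (\<integral>x. \<bar>g x - f x\<bar> \<partial>M)"
    by (rule integral_abs_bound)
  also have "\<dots> \<le> \<delta>"
    using f g by (intro integral_le_const) (auto simp: assms)
  finally show ?thesis .
qed

text \<open>Compact support supplies both ingredients: Lebesgue integrability for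
  \<open>tendsto_smoothed_integral\<close> and uniform continuity for the smoothing error. That
  error is the same for all measures, so a triangle inequality through the smoothed function
  concludes.\<close>

lemma levy_continuity_compact_support:
  fixes \<nu> :: "nat \<Rightarrow> 'a::euclidean_space measure" and f :: "'a \<Rightarrow> real"
  assumes p: "\<And>n. prob_space (\<nu> n)" "prob_space \<mu>"
    and s: "\<And>n. sets (\<nu> n) = sets borel" "sets \<mu> = sets borel"
    and ch: "\<And>t. (\<lambda>n. CLINT x|\<nu> n. cis (t \<bullet> x)) \<longlonglongrightarrow> (CLINT x|\<mu>. cis (t \<bullet> x))"
    and f: "continuous_on UNIV f" and supp: "\<And>x. norm x > K \<Longrightarrow> f x = 0"
  shows "(\<lambda>n. integral\<^sup>L (\<nu> n) f) \<longlonglongrightarrow> integral\<^sup>L \<mu> f"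
proof -
  have fm [measurable]: "f \<in> borel_measurable borel"
    using f by (rule borel_measurable_continuous_onI)
  have "compact (f ` cball 0 K)"
    using f by (intro compact_continuous_image) (auto intro: continuous_on_subset)
  then obtain B where B: "\<forall>x\<in>cball 0 K. \<bar>f x\<bar> \<le> B"
    by (metis bounded_iff compact_imp_bounded imageI real_norm_def)
  have bd: "\<bar>f x\<bar> \<le> max B 0" for x
    using B supp[of x] by (cases "norm x \<le> K") force+
  have int: "integrable lborel f"
  proof -
    have "integrable lborel (\<lambda>x. indicator (cball 0 K) x *\<^sub>R f x)"
      using f by (intro borel_integrable_compact) (auto intro: continuous_on_subset)
    also have "(\<lambda>x. indicator (cball 0 K) x *\<^sub>R f x) = f"
      using supp by (auto simp: indicator_def fun_eq_iff)
    finally show ?thesis .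
  qed
  have uc: "uniformly_continuous_on UNIV f"
  proof -
    \<comment> \<open>One unit of margin: a point within distance 1 of \<open>cball 0 K\<close> is
      still in the larger ball, and if neither point is in \<open>cball 0 K\<close> both values are
      0.\<close>
    have u: "uniformly_continuous_on (cball 0 (K + 1)) f"
      using f by (intro compact_uniformly_continuous) (auto intro: continuous_on_subset)
    show ?thesis
      unfolding uniformly_continuous_on_def
    proof (intro allI impI)
      fix \<epsilon> :: real assume "\<epsilon> > 0"
      then obtain d where d: "d > 0"
        "\<And>x y. x \<in> cball 0 (K + 1) \<Longrightarrow> y \<in> cball 0 (K + 1) \<Longrightarrow> dist y x < d \<Longrightarrow> dist (f y) (f x) < \<epsilon>"
        using u unfolding uniformly_continuous_on_def by metis
      have "dist (f y) (f x) < \<epsilon>" if "dist y x < min d 1" for x y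
      proof (cases "norm x \<le> K \<or> norm y \<le> K")
        case True
        then have "norm x \<le> K + 1" "norm y \<le> K + 1"
          using that norm_triangle_ineq2[of x y] norm_triangle_ineq2[of y x]
          by (auto simp: dist_norm norm_minus_commute)
        with that show ?thesis by (intro d(2)) auto
      next
        case False
        with supp \<open>\<epsilon> > 0\<close> show ?thesis by simp
      qed
      with d(1) show "\<exists>d>0. \<forall>x\<in>UNIV. \<forall>x'\<in>UNIV. dist x' x < d \<longrightarrow> dist (f x') (f x) < \<epsilon>"
        by (intro exI[of _ "min d 1"]) auto
    qed
  qed
  show ?thesis
  proof (rule LIMSEQ_I)
    fix r :: real assume r: "r > 0"
    obtain e where e: "e > 0" "\<And>y. \<bar>(\<integral>w. f (y + e *\<^sub>R w) \<partial>std_gauss) - f y\<bar> \<le> r / 4"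
      using std_gauss_smoothing_approx[OF uc bd, of "r / 4"] r by auto
    let ?F = "\<lambda>y. \<integral>w. f (y + e *\<^sub>R w) \<partial>std_gauss"
    have cl: "\<bar>integral\<^sup>L \<nu> ?F - integral\<^sup>L \<nu> f\<bar> \<le> r / 4"
      if \<nu>: "prob_space \<nu>" "sets \<nu> = sets borel" for \<nu> :: "'a measure"
    proof -
      interpret N: prob_space \<nu> by fact
      interpret G: prob_space "std_gauss :: 'a measure" by (rule prob_space_std_gauss)
      note [measurable_cong] = \<nu>(2)
      show ?thesis
        by (rule N.abs_integral_diff_le[OF _ _ bd e(2)]) measurable
    qed
    obtain N where N: "\<And>n. n \<ge> N \<Longrightarrow> \<bar>integral\<^sup>L (\<nu> n) ?F - integral\<^sup>L \<mu> ?F\<bar> < r / 4"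
      using LIMSEQ_D[OF tendsto_smoothed_integral[OF e(1) p s ch int], of "r / 4"] r by auto
    have "\<bar>integral\<^sup>L (\<nu> n) f - integral\<^sup>L \<mu> f\<bar> < r" if "n \<ge> N" for n
      using N[OF that] cl[OF p(1) s(1), of n] cl[OF p(2) s(2)] r by linarith
    then show "\<exists>N. \<forall>n\<ge>N. norm (integral\<^sup>L (\<nu> n) f - integral\<^sup>L \<mu> f) < r"
      by auto
  qed
qed

text \<open>Tightness comes from the limit: a cutoff \<open>h K\<close> has
  \<open>\<mu>\<close>-integral close to 1, and by the compactly supported case its integrals under
  \<open>\<nu> n\<close> are eventually close to 1 too. Multiplying \<open>f\<close> by the cutoff
  then costs little under all these measures.\<close>

theorem levy_continuity_euclidean:
  fixes \<nu> :: "nat \<Rightarrow> 'a::euclidean_space measure" and f :: "'a \<Rightarrow> real"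
  assumes p: "\<And>n. prob_space (\<nu> n)" "prob_space \<mu>"
    and s: "\<And>n. sets (\<nu> n) = sets borel" "sets \<mu> = sets borel"
    and ch: "\<And>t. (\<lambda>n. CLINT x|\<nu> n. cis (t \<bullet> x)) \<longlonglongrightarrow> (CLINT x|\<mu>. cis (t \<bullet> x))"
    and f: "continuous_on UNIV f" and bdd: "bounded (range f)"
  shows "(\<lambda>n. integral\<^sup>L (\<nu> n) f) \<longlonglongrightarrow> integral\<^sup>L \<mu> f"
proof -
  have fm [measurable]: "f \<in> borel_measurable borel"
    using f by (rule borel_measurable_continuous_onI)
  obtain B where B: "\<And>x. \<bar>f x\<bar> \<le> B" "B > 0"
    using bdd unfolding bounded_pos by auto
  define h :: "real \<Rightarrow> 'a \<Rightarrow> real" where "h K x = max 0 (min 1 (K + 1 - norm x))" for K x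
  have h01: "0 \<le> h K x" "h K x \<le> 1" for K x
    by (auto simp: h_def)
  have hc: "continuous_on UNIV (h K)" for K
    unfolding h_def by (intro continuous_intros)
  then have [measurable]: "h K \<in> borel_measurable borel" for K
    by (rule borel_measurable_continuous_onI)
  have h0: "norm x > K + 1 \<Longrightarrow> h K x = 0" for K x
    by (auto simp: h_def)
  interpret m: prob_space \<mu> by fact
  note [measurable_cong] = s(2)
  have lim: "(\<lambda>k. integral\<^sup>L \<mu> (h (real k))) \<longlonglongrightarrow> (\<integral>x. 1 \<partial>\<mu>)"
  proof (rule integral_dominated_convergence[where w="\<lambda>_. 1"])
    have "(\<lambda>k. h (real k) x) \<longlonglongrightarrow> 1" for x
    proof (rule tendsto_eventually)
      have "\<forall>\<^sub>F k in sequentially. norm x \<le> real k"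
        using eventually_ge_at_top[of "nat \<lceil>norm x\<rceil>"] by eventually_elim linarith
      then show "\<forall>\<^sub>F k in sequentially. h (real k) x = 1"
        by eventually_elim (auto simp: h_def)
    qed
    then show "AE x in \<mu>. (\<lambda>k. h (real k) x) \<longlonglongrightarrow> 1" by simp
  qed (use h01 in auto)
  show ?thesis
  proof (rule LIMSEQ_I)
    fix r :: real assume r: "r > 0"
    have "\<forall>\<^sub>F k in sequentially. integral\<^sup>L \<mu> (h (real k)) > 1 - r / (4 * B)"
      using lim r B m.prob_space by (intro order_tendstoD(1)) auto
    \<comment> \<open>With this threshold each of the two cutoff errors is at most
      \<open>r / 4\<close>, as is eventually the difference for the cut-off function.\<close>
    then obtain k where k: "integral\<^sup>L \<mu> (h (real k)) > 1 - r / (4 * B)"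
      using eventually_happens' sequentially_bot by blast
    let ?h = "h (real k)"
    have fh: "\<bar>integral\<^sup>L \<nu> f - (\<integral>x. f x * ?h x \<partial>\<nu>)\<bar> \<le> B * (1 - integral\<^sup>L \<nu> ?h)"
      if \<nu>: "prob_space \<nu>" "sets \<nu> = sets borel" for \<nu> :: "'a measure"
    proof -
      interpret N: prob_space \<nu> by fact
      note [measurable_cong] = \<nu>(2)
      have i1: "integrable \<nu> f"
        by (rule N.integrable_const_bound[where B=B]) (auto simp: B)
      have i2: "integrable \<nu> ?h"
        by (rule N.integrable_const_bound[where B=1]) (use h01 in auto)
      have i3: "integrable \<nu> (\<lambda>x. f x * ?h x)"
        using B h01 by (intro N.integrable_const_bound[where B="B * 1"])
          (auto simp: abs_mult intro!: mult_mono AE_I2 simp del: mult_1_right)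
      have "\<bar>integral\<^sup>L \<nu> f - (\<integral>x. f x * ?h x \<partial>\<nu>)\<bar> = \<bar>\<integral>x. f x - f x * ?h x \<partial>\<nu>\<bar>"
        using i1 i3 by simp
      also have "\<dots> \<le> (\<integral>x. \<bar>f x - f x * ?h x\<bar> \<partial>\<nu>)"
        by (rule integral_abs_bound)
      also have "\<dots> \<le> (\<integral>x. B * (1 - ?h x) \<partial>\<nu>)"
      proof (rule integral_mono)
        show "\<bar>f x - f x * ?h x\<bar> \<le> B * (1 - ?h x)" for x
        proof -
          have "f x - f x * ?h x = f x * (1 - ?h x)" by (simp add: algebra_simps)
          then show ?thesis using B(1)[of x] h01[of "real k" x] by (auto simp: abs_mult intro!: mult_mono)
        qed
      qed (use i1 i2 i3 in auto)
      also have "\<dots> = B * (1 - integral\<^sup>L \<nu> ?h)"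
        using i2 by (simp add: N.prob_space)
      finally show ?thesis .
    qed
    have "(\<lambda>n. integral\<^sup>L (\<nu> n) ?h) \<longlonglongrightarrow> integral\<^sup>L \<mu> ?h"
      by (rule levy_continuity_compact_support[OF p s ch hc h0])
    then have 1: "\<forall>\<^sub>F n in sequentially. integral\<^sup>L (\<nu> n) ?h > 1 - r / (4 * B)"
      using k by (rule order_tendstoD(1))
    have "(\<lambda>n. (\<integral>x. f x * ?h x \<partial>\<nu> n)) \<longlonglongrightarrow> (\<integral>x. f x * ?h x \<partial>\<mu>)"
      by (rule levy_continuity_compact_support[OF p s ch, of _ "real k + 1"])
         (auto intro!: continuous_intros f hc simp: h0)
    then have "\<forall>\<^sub>F n in sequentially. dist (\<integral>x. f x * ?h x \<partial>\<nu> n) (\<integral>x. f x * ?h x \<partial>\<mu>) < r / 4"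
      using r by (intro tendstoD) auto
    with 1 have "\<forall>\<^sub>F n in sequentially. norm (integral\<^sup>L (\<nu> n) f - integral\<^sup>L \<mu> f) < r"
    proof eventually_elim
      case (elim n)
      have "B * (1 - integral\<^sup>L (\<nu> n) ?h) \<le> r / 4" "B * (1 - integral\<^sup>L \<mu> ?h) \<le> r / 4"
        using elim(1) k B(2) by (auto simp: field_simps)
      with fh[OF p(1) s(1), of n] fh[OF p(2) s(2)] elim(2) r show ?case
        unfolding dist_real_def real_norm_def by linarith
    qed
    then show "\<exists>N. \<forall>n\<ge>N. norm (integral\<^sup>L (\<nu> n) f - integral\<^sup>L \<mu> f) < r"
      by (simp add: eventually_sequentially)
  qed
qed

text \<open>Levy's theorem for a constant sequence identifies the integrals of bounded continuous
  functions. These determine the closed sets, through truncations of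
  \<open>1 - real n * infdist x C\<close>, and closed sets are an intersection-stable
  generator.\<close>

theorem char_unique_euclidean:
  fixes \<mu> \<nu> :: "'a::euclidean_space measure"
  assumes p: "prob_space \<nu>" "prob_space \<mu>"
    and s: "sets \<nu> = sets borel" "sets \<mu> = sets borel"
    and ch: "\<And>t. (CLINT x|\<nu>. cis (t \<bullet> x)) = (CLINT x|\<mu>. cis (t \<bullet> x))"
  shows "\<nu> = \<mu>"
proof -
  interpret N: prob_space \<nu> by fact
  interpret m: prob_space \<mu> by fact
  have int: "integral\<^sup>L \<nu> f = integral\<^sup>L \<mu> f"
    if "continuous_on UNIV f" "bounded (range f)" for f :: "'a \<Rightarrow> real"
    using levy_continuity_euclidean[of "\<lambda>_. \<nu>" \<mu> f] p s ch that by (simp add: LIMSEQ_const_iff)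
  \<comment> \<open>\<open>infdist\<close> to the empty set is 0, which would make every
    \<open>?f n\<close> equal to 1; the empty set is therefore treated separately.\<close>
  have closed: "measure \<nu> C = measure \<mu> C" if C: "closed C" "C \<noteq> {}" for C :: "'a set"
  proof -
    let ?f = "\<lambda>n x. max 0 (1 - real n * infdist x C)"
    have lim: "(\<lambda>n. integral\<^sup>L \<kappa> (?f n)) \<longlonglongrightarrow> measure \<kappa> C"
      if \<kappa>: "prob_space \<kappa>" "sets \<kappa> = sets borel" for \<kappa> :: "'a measure"
    proof -
      interpret K: prob_space \<kappa> by fact
      note [measurable_cong] = \<kappa>(2)
      have [measurable]: "(\<lambda>x. infdist x C) \<in> borel_measurable borel"
        by (intro borel_measurable_continuous_onI continuous_intros)
      have [measurable]: "C \<in> sets \<kappa>" using C \<kappa> by simp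
      have pw: "(\<lambda>n. ?f n x) \<longlonglongrightarrow> indicator C x" for x
      proof (cases "x \<in> C")
        case True
        then show ?thesis by simp
      next
        case False
        then have pos: "infdist x C > 0"
          using C by (simp add: infdist_pos_not_in_closed)
        have "\<forall>\<^sub>F n in sequentially. 1 / infdist x C \<le> real n"
          using eventually_ge_at_top[of "nat \<lceil>1 / infdist x C\<rceil>"] by eventually_elim linarith
        then have "\<forall>\<^sub>F n in sequentially. ?f n x = 0"
          by eventually_elim (use pos in \<open>auto simp: field_simps max_def\<close>)
        with False show ?thesis by (simp add: tendsto_eventually)
      qed
      have "(\<lambda>n. integral\<^sup>L \<kappa> (?f n)) \<longlonglongrightarrow> integral\<^sup>L \<kappa> (indicator C)"
        by (rule integral_dominated_convergence[where w="\<lambda>_. 1"])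
           (use pw in \<open>auto simp: infdist_nonneg\<close>)
      then show ?thesis using sets.sets_into_space[of C \<kappa>] by (simp add: Int_absorb2)
    qed
    have "integral\<^sup>L \<nu> (?f n) = integral\<^sup>L \<mu> (?f n)" for n
      by (rule int) (auto intro!: continuous_intros boundedI[where B=1] simp: infdist_nonneg)
    with lim[OF p(1) s(1)] lim[OF p(2) s(2)] show ?thesis
      using LIMSEQ_unique by auto
  qed
  show ?thesis
  proof (rule measure_eqI_generator_eq[where E="Collect closed" and \<Omega>=UNIV and A="\<lambda>_. UNIV"])
    show "Int_stable (Collect (closed :: 'a set \<Rightarrow> bool))"
      by (auto simp: Int_stable_def)
    show "emeasure \<nu> X = emeasure \<mu> X" if "X \<in> Collect closed" for X
      using closed[of X] that by (cases "X = {}") (auto simp: N.emeasure_eq_measure m.emeasure_eq_measure)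
    show "sets \<nu> = sigma_sets UNIV (Collect closed)" "sets \<mu> = sigma_sets UNIV (Collect closed)"
      by (simp_all add: s borel_eq_closed)
  qed auto
qed

section \<open>Rotation invariance\<close>

lemma borel_measurable_orthogonal_transformation:
  "orthogonal_transformation R \<Longrightarrow> R \<in> borel_measurable (borel :: 'a::euclidean_space measure)"
  by (intro borel_measurable_continuous_onI linear_continuous_on)
     (simp add: linear_conv_bounded_linear[symmetric] orthogonal_transformation_linear)

text \<open>The characteristic function of \<open>std_gauss\<close> depends only on the norm, which
  \<open>R\<close> preserves, so uniqueness of characteristic functions applies.\<close>

lemma distr_std_gauss_orthogonal:
  fixes R :: "'a::euclidean_space \<Rightarrow> 'a"
  assumes R: "orthogonal_transformation R"
  shows "distr std_gauss borel R = std_gauss"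
proof (rule char_unique_euclidean)
  note [measurable] = borel_measurable_orthogonal_transformation[OF R]
  interpret G: prob_space "std_gauss :: 'a measure" by (rule prob_space_std_gauss)
  show "prob_space (distr std_gauss borel R)"
    by (rule G.prob_space_distr) simp
  fix t :: 'a
  obtain u where u: "t = R u"
    using orthogonal_transformation_surj[OF R] by (metis surjD)
  have "(CLINT x|distr std_gauss borel R. cis (t \<bullet> x)) = (CLINT x|std_gauss. cis (u \<bullet> x))"
    using R by (simp add: integral_distr u orthogonal_transformation_def)
  then show "(CLINT x|distr std_gauss borel R. cis (t \<bullet> x)) = (CLINT x|std_gauss. cis (t \<bullet> x))"
    by (simp add: char_std_gauss u orthogonal_transformation_norm[OF R])
qed (auto simp: prob_space_std_gauss)

text \<open>The library has this only for wellordered index types.  Here it follows from the rotation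
  invariance of the standard Gaussian law, whose density depends on the norm only.\<close>

lemma distr_lborel_orthogonal:
  fixes R :: "'a::euclidean_space \<Rightarrow> 'a"
  assumes R: "orthogonal_transformation R"
  shows "distr lborel borel R = lborel"
proof -
  note [measurable] = borel_measurable_orthogonal_transformation[OF R]
  let ?w = "\<lambda>x::'a. ennreal (sqrt (2 * pi) ^ DIM('a) * exp ((norm x)\<^sup>2 / 2))"
  have [measurable]: "?w \<in> borel_measurable borel" by measurable
  have lb: "lborel = density std_gauss ?w"
  proof -
    have "density std_gauss ?w = density lborel (\<lambda>x::'a. 1)"
      unfolding std_gauss_def prod_std_normal_density
      by (subst density_density_eq)
         (auto intro!: density_cong simp: ennreal_mult[symmetric] exp_minus field_simps)
    then show ?thesis by (simp add: density_1)
  qed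
  have "distr lborel borel R = distr (density std_gauss (\<lambda>x. ?w (R x))) borel R"
    by (subst lb) (simp add: orthogonal_transformation_norm[OF R])
  also have "\<dots> = density (distr std_gauss borel R) ?w"
    by (rule density_distr[symmetric]) auto
  also have "\<dots> = lborel"
    by (simp add: distr_std_gauss_orthogonal[OF R] lb)
  finally show ?thesis .
qed

section \<open>Surface measure and tangential rescaling\<close>

text \<open>Scaling by a constant becomes a constant density, so that integrals and
  almost-everywhere statements follow from the rules for \<open>density\<close>.\<close>

lemma sphere_surface_density:
  "(sphere_surface :: (real ^ 'd) measure) =
    density (distr (restrict_space lborel (ball 0 1 - {0})) borel (\<lambda>x. x /\<^sub>R norm x)) (\<lambda>_. ennreal (real CARD('d)))"
  unfolding sphere_surface_def
  by (intro measure_eqI) (auto simp: emeasure_density_const ennreal_of_nat_eq_real_of_nat)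

lemma sets_sphere_surface [simp, measurable_cong]: "sets sphere_surface = sets borel"
  by (simp add: sphere_surface_def)

lemma space_sphere_surface [simp]: "space sphere_surface = UNIV"
  by (simp add: sphere_surface_def space_scale_measure)

lemma punctured_ball_borel [measurable]: "ball (0 :: 'a::euclidean_space) r - {0} \<in> sets borel"
  by auto

lemma measurable_normalize [measurable]:
  "(\<lambda>x. x /\<^sub>R norm x) \<in> borel_measurable (restrict_space lborel (S :: 'a::euclidean_space set))"
  by (intro measurable_restrict_space1) measurable

lemma integral_sphere_surface:
  fixes f :: "real ^ 'd \<Rightarrow> real"
  assumes [measurable]: "f \<in> borel_measurable borel"
  shows "integral\<^sup>L sphere_surface f
    = real CARD('d) * (\<integral>y. indicator (ball 0 1 - {0}) y * f (y /\<^sub>R norm y) \<partial>lborel)"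
  unfolding sphere_surface_density
  by (simp add: integral_density integral_distr integral_restrict_space)

lemma emeasure_sphere_surface_finite: "emeasure (sphere_surface :: (real ^ 'd) measure) A < \<infinity>"
proof -
  have "emeasure (sphere_surface :: (real ^ 'd) measure) A \<le> emeasure (sphere_surface :: (real ^ 'd) measure) UNIV"
    by (rule emeasure_mono) auto
  also have "\<dots> = of_nat CARD('d) * emeasure (lborel :: (real ^ 'd) measure) (ball 0 1 - {0})"
    by (simp add: sphere_surface_def emeasure_distr space_restrict_space emeasure_restrict_space)
  also have "\<dots> \<le> of_nat CARD('d) * emeasure (lborel :: (real ^ 'd) measure) (ball 0 1)"
    by (intro mult_left_mono emeasure_mono) auto
  also have "\<dots> < \<infinity>"
    using emeasure_lborel_ball_finite[of "0 :: real ^ 'd" 1] by (simp add: ennreal_mult_less_top of_nat_less_top)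
  finally show ?thesis .
qed

lemma finite_measure_sphere_surface: "finite_measure (sphere_surface :: (real ^ 'd) measure)"
  by standard (metis emeasure_sphere_surface_finite infinity_ennreal_def less_irrefl)

lemma AE_sphere_surface: "AE x in (sphere_surface :: (real ^ 'd) measure). x \<in> sphere 0 1"
  unfolding sphere_surface_density
  by (subst AE_density) (auto simp: AE_distr_iff space_restrict_space AE_restrict_space_iff)

lemma integrable_sphere_surface_bounded:
  fixes f :: "real ^ 'd \<Rightarrow> real"
  assumes [measurable]: "f \<in> borel_measurable borel" and "\<And>x. x \<in> sphere 0 1 \<Longrightarrow> \<bar>f x\<bar> \<le> B"
  shows "integrable sphere_surface f"
proof (rule finite_measure.integrable_const_bound[OF finite_measure_sphere_surface])
  show "AE x in sphere_surface. norm (f x) \<le> B"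
    using AE_sphere_surface by eventually_elim (simp add: assms)
qed simp

text \<open>An orthogonal map preserves the punctured ball and commutes with radial projection, so
  invariance passes from Lebesgue measure to the cone measure. The reflection in
  \<open>integral_sphere_odd\<close> is the case of interest.\<close>

lemma integral_sphere_surface_orthogonal:
  fixes f :: "real ^ 'd \<Rightarrow> real" and Q :: "real ^ 'd \<Rightarrow> real ^ 'd"
  assumes Q: "orthogonal_transformation Q" and [measurable]: "f \<in> borel_measurable borel"
  shows "(\<integral>x. f (Q x) \<partial>sphere_surface) = integral\<^sup>L sphere_surface f"
proof -
  note [measurable] = borel_measurable_orthogonal_transformation[OF Q]
  let ?g = "\<lambda>y. indicator (ball 0 1 - {0}) y * f (y /\<^sub>R norm y)"
  have "indicator (ball 0 1 - {0}) y * f (Q (y /\<^sub>R norm y)) = ?g (Q y)" for y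
  proof -
    have n: "norm (Q y) = norm y"
      by (rule orthogonal_transformation_norm[OF Q])
    then have "Q y = 0 \<longleftrightarrow> y = 0"
      by (metis norm_eq_zero)
    with n show ?thesis
      by (simp add: indicator_def orthogonal_transformation_scaleR[OF Q])
  qed
  then have "(\<integral>x. f (Q x) \<partial>sphere_surface) = real CARD('d) * (\<integral>y. ?g (Q y) \<partial>lborel)"
    by (subst integral_sphere_surface) auto
  also have "(\<integral>y. ?g (Q y) \<partial>lborel) = integral\<^sup>L (distr lborel borel Q) ?g"
    by (rule integral_distr[symmetric]) measurable
  finally show ?thesis
    by (simp add: distr_lborel_orthogonal[OF Q] integral_sphere_surface)
qed

section \<open>Scaling of the directions orthogonal to q\<close>

lemma rotate_basis_vector:
  fixes q :: "real ^ 'd"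
  assumes "norm q = 1"
  obtains e and R :: "real ^ 'd \<Rightarrow> real ^ 'd" where "e \<in> Basis" "orthogonal_transformation R" "R e = q"
  using assms by (metis SOME_Basis norm_Basis orthogonal_transformation_exists_1)

text \<open>Acts on the ball rather than on the sphere: the component along \<open>q\<close> is kept
  as radial coordinate, and the d - 1 scaled directions account for the power \<beta>^(- (d - 1) /
  2).\<close>

definition tangent_scale :: "'a::real_inner \<Rightarrow> real \<Rightarrow> 'a \<Rightarrow> 'a" where
  "tangent_scale q t y = (q \<bullet> y) *\<^sub>R q + t *\<^sub>R (y - (q \<bullet> y) *\<^sub>R q)"

lemma borel_measurable_tangent_scale [measurable]: "tangent_scale (q::'a::euclidean_space) t \<in> borel_measurable borel"
  unfolding tangent_scale_def by measurable

text \<open>After a rotation taking a basis vector \<open>e\<close> to \<open>q\<close>, the map is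
  diagonal with entry 1 at \<open>e\<close> and \<open>t\<close> at the other basis vectors, whence
  the determinant.\<close>

lemma integral_tangent_scale:
  fixes q :: "real ^ 'd" and f :: "real ^ 'd \<Rightarrow> real"
  assumes q: "norm q = 1" and t: "t > 0" and [measurable]: "f \<in> borel_measurable borel"
  shows "integral\<^sup>L lborel f = t ^ (CARD('d) - 1) * (\<integral>y. f (tangent_scale q t y) \<partial>lborel)"
proof -
  obtain e and R :: "real ^ 'd \<Rightarrow> real ^ 'd" where e: "e \<in> Basis" and R: "orthogonal_transformation R" "R e = q"
    using rotate_basis_vector[OF q] .
  note [measurable] = borel_measurable_orthogonal_transformation[OF R(1)]
  have rot: "(\<integral>y. g (R y) \<partial>lborel) = integral\<^sup>L lborel g"
    if [measurable]: "g \<in> borel_measurable borel" for g :: "real ^ 'd \<Rightarrow> real"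
    by (subst (2) distr_lborel_orthogonal[OF R(1), symmetric]) (simp add: integral_distr)
  define c where "c j = (if j = e then 1 else t)" for j :: "real ^ 'd"
  define D where "D x = (\<Sum>j\<in>Basis. (c j * (x \<bullet> j)) *\<^sub>R j)" for x
  have [measurable]: "D \<in> borel_measurable borel"
    unfolding D_def by measurable
  have D: "D x = tangent_scale e t x" for x
  proof -
    have "D x = (x \<bullet> e) *\<^sub>R e + t *\<^sub>R (\<Sum>j\<in>Basis - {e}. (x \<bullet> j) *\<^sub>R j)"
      using e by (simp add: D_def sum.remove[of _ e] c_def scaleR_sum_right)
    also have "(\<Sum>j\<in>Basis - {e}. (x \<bullet> j) *\<^sub>R j) = x - (x \<bullet> e) *\<^sub>R e"
      using e euclidean_representation[of x] by (simp add: sum.remove[of _ e] algebra_simps)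
    finally show ?thesis
      by (simp add: tangent_scale_def inner_commute)
  qed
  have "(\<Prod>j\<in>Basis. \<bar>c j\<bar>) = t ^ (CARD('d) - 1)"
  proof -
    have "(\<Prod>j\<in>Basis. \<bar>c j\<bar>) = (\<Prod>j\<in>Basis - {e}. t)"
      using e t by (simp add: prod.remove[of _ e] c_def)
    then show ?thesis using e by (simp add: card_Diff_singleton)
  qed
  moreover have "lborel = density (distr lborel borel D) (\<lambda>_. ennreal (\<Prod>j\<in>Basis. \<bar>c j\<bar>))"
    using lborel_affine_euclidean[of c 0] t by (simp add: c_def D_def[abs_def])
  ultimately have lb: "lborel = density (distr lborel borel D) (\<lambda>_. ennreal (t ^ (CARD('d) - 1)))"
    by simp
  have "integral\<^sup>L lborel f = (\<integral>y. f (R y) \<partial>lborel)"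
    by (simp add: rot)
  also have "\<dots> = t ^ (CARD('d) - 1) * (\<integral>y. f (R (D y)) \<partial>lborel)"
    using t by (subst lb) (simp add: integral_density integral_distr)
  also have "(\<lambda>y. f (R (D y))) = (\<lambda>y. f (tangent_scale q t (R y)))"
  proof
    fix y
    have l: "linear R" using R(1) by (rule orthogonal_transformation_linear)
    have "q \<bullet> R y = e \<bullet> y"
      using R by (metis orthogonal_transformation_def)
    then show "f (R (D y)) = f (tangent_scale q t (R y))"
      unfolding D tangent_scale_def by (simp add: linear_add[OF l] linear_diff[OF l] linear_cmul[OF l] R(2))
  qed
  also have "(\<integral>y. f (tangent_scale q t (R y)) \<partial>lborel) = (\<integral>y. f (tangent_scale q t y) \<partial>lborel)"
    by (subst rot[symmetric]) auto
  finally show ?thesis .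
qed

section \<open>Gaussian moments on the tangent space\<close>

text \<open>The integrand depends on the tangent coordinates only through \<open>(y \<bullet> b) / (y \<bullet> e)\<close>;
  substituting contributes \<open>r ^ (DIM('a) - 1)\<close> for \<open>r = y \<bullet> e\<close>, which integrates to \<open>1 / DIM('a)\<close>
  and cancels the factor in the cone-measure definition of \<^const>\<open>sphere_surface\<close>.\<close>

lemma has_bochner_integral_cone_prod:
  fixes e :: "'a::euclidean_space" and g :: "'a \<Rightarrow> real \<Rightarrow> real"
  assumes e: "e \<in> Basis" and g: "\<And>b. b \<in> Basis - {e} \<Longrightarrow> integrable lborel (g b)"
  shows "has_bochner_integral lborel
    (\<lambda>y. indicator {0<..<1} (y \<bullet> e) * (\<Prod>b\<in>Basis - {e}. g b (y \<bullet> b / (y \<bullet> e))))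
    ((\<Prod>b\<in>Basis - {e}. integral\<^sup>L lborel (g b)) / DIM('a))"
proof -
  interpret product_sigma_finite "\<lambda>_::'a. lborel :: real measure" ..
  let ?I = "Basis - {e}"
  interpret I: finite_product_sigma_finite "\<lambda>_::'a. lborel :: real measure" ?I
    by standard simp
  have gm [measurable]: "b \<in> ?I \<Longrightarrow> g b \<in> borel_measurable borel" for b
    using borel_measurable_integrable[OF g] by simp
  let ?F = "\<lambda>f. indicator {0<..<1::real} (f e) * (\<Prod>b\<in>?I. g b (f b / f e))"
  have Fm: "?F \<in> borel_measurable (\<Pi>\<^sub>M b\<in>Basis. lborel)"
    using e by measurable
  have ins: "insert e ?I = Basis" using e by auto
  have k: "Suc (card ?I) = DIM('a)" using e by (simp add: card_Suc_Diff1)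
  have scl: "integrable lborel (\<lambda>u. g b (u / r))" "(\<integral>u. g b (u / r) \<partial>lborel) = r * integral\<^sup>L lborel (g b)"
    if "b \<in> ?I" "0 < r" for b r
    using lborel_integrable_real_affine[OF g[OF that(1)], of "1 / r" 0]
      lborel_integral_real_affine[of "1 / r" "g b" 0] that by (auto simp: field_simps)
  have scl_abs: "(\<integral>u. \<bar>g b (u / r)\<bar> \<partial>lborel) = r * (\<integral>u. \<bar>g b u\<bar> \<partial>lborel)"
    if "b \<in> ?I" "0 < r" for b r
    using lborel_integral_real_affine[of "1 / r" "\<lambda>u. \<bar>g b u\<bar>" 0] that by (auto simp: field_simps)
  have int_pow: "has_bochner_integral lborel (\<lambda>r::real. indicator {0<..<1} r * (r ^ card ?I * c)) (c / DIM('a))" for c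
  proof -
    have "has_bochner_integral lborel (\<lambda>r::real. (r ^ card ?I * c) * indicator {0..1} r)
      (1 ^ Suc (card ?I) * c / DIM('a) - 0 ^ Suc (card ?I) * c / DIM('a))"
    proof (rule has_bochner_integral_FTC_Icc_real)
      show "((\<lambda>r::real. r ^ Suc (card ?I) * c / DIM('a)) has_real_derivative r ^ card ?I * c) (at r)" for r
        using DERIV_cmult[OF DERIV_pow[of "Suc (card ?I)" r UNIV], of "c / DIM('a)"]
        by (simp add: k[symmetric] del: power_Suc) (simp add: mult_ac)
    qed (auto intro!: continuous_intros)
    moreover have "AE r in lborel. indicator {0<..<1} r * (r ^ card ?I * c) = (r ^ card ?I * c) * indicator {0..1::real} r"
      using AE_lborel_singleton[of 0] AE_lborel_singleton[of 1] by eventually_elim (auto simp: indicator_def)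
    ultimately show ?thesis
      by (subst has_bochner_integral_cong_AE) auto
  qed
  \<comment> \<open>Tonelli for the absolute value, with the same scaling in each coordinate, gives
    the integrability that the iterated integral below requires.\<close>
  have int: "integrable (\<Pi>\<^sub>M b\<in>Basis. lborel) ?F"
  proof (rule integrableI_bounded[OF Fm])
    have "(\<integral>\<^sup>+f. norm (?F f) \<partial>(\<Pi>\<^sub>M b\<in>Basis. lborel))
        = (\<integral>\<^sup>+r. (\<integral>\<^sup>+f. norm (?F (f(e := r))) \<partial>(\<Pi>\<^sub>M b\<in>?I. lborel)) \<partial>lborel)"
      using product_nn_integral_insert_rev[of ?I e "\<lambda>f. ennreal (norm (?F f))"] Fm ins by simp
    also have "\<dots> = (\<integral>\<^sup>+r. ennreal (indicator {0<..<1} r * (r ^ card ?I * (\<Prod>b\<in>?I. \<integral>u. \<bar>g b u\<bar> \<partial>lborel))) \<partial>lborel)"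
    proof (rule nn_integral_cong)
      fix r :: real
      show "(\<integral>\<^sup>+f. norm (?F (f(e := r))) \<partial>(\<Pi>\<^sub>M b\<in>?I. lborel))
        = ennreal (indicator {0<..<1} r * (r ^ card ?I * (\<Prod>b\<in>?I. \<integral>u. \<bar>g b u\<bar> \<partial>lborel)))"
      proof (cases "0 < r \<and> r < 1")
        case True
        have "norm (?F (f(e := r))) = (\<Prod>b\<in>?I. \<bar>g b (f b / r)\<bar>)" for f
          using True by (auto simp: abs_prod intro!: prod.cong)
        moreover have "integrable (\<Pi>\<^sub>M b\<in>?I. lborel) (\<lambda>f. \<Prod>b\<in>?I. \<bar>g b (f b / r)\<bar>)"
          using True scl(1) by (intro product_integrable_prod) auto
        ultimately have "(\<integral>\<^sup>+f. norm (?F (f(e := r))) \<partial>(\<Pi>\<^sub>M b\<in>?I. lborel))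
            = ennreal (\<integral>f. (\<Prod>b\<in>?I. \<bar>g b (f b / r)\<bar>) \<partial>(\<Pi>\<^sub>M b\<in>?I. lborel))"
          by (simp add: nn_integral_eq_integral prod_nonneg)
        also have "(\<integral>f. (\<Prod>b\<in>?I. \<bar>g b (f b / r)\<bar>) \<partial>(\<Pi>\<^sub>M b\<in>?I. lborel)) = (\<Prod>b\<in>?I. \<integral>u. \<bar>g b (u / r)\<bar> \<partial>lborel)"
          using True scl(1) by (intro product_integral_prod) auto
        also have "\<dots> = r ^ card ?I * (\<Prod>b\<in>?I. \<integral>u. \<bar>g b u\<bar> \<partial>lborel)"
          using True scl_abs by (simp add: prod.distrib)
        finally show ?thesis using True by simp
      qed auto
    qed
    also have "\<dots> < \<infinity>"
      using int_pow[of "\<Prod>b\<in>?I. \<integral>u. \<bar>g b u\<bar> \<partial>lborel"]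
      by (subst nn_integral_eq_integral) (auto simp: has_bochner_integral_iff prod_nonneg indicator_def)
    finally show "(\<integral>\<^sup>+f. norm (?F f) \<partial>(\<Pi>\<^sub>M b\<in>Basis. lborel)) < \<infinity>" .
  qed
  have "integral\<^sup>L (\<Pi>\<^sub>M b\<in>Basis. lborel) ?F
      = (\<integral>x. (\<integral>f. ?F (merge {e} ?I (x, f)) \<partial>(\<Pi>\<^sub>M b\<in>?I. lborel)) \<partial>(\<Pi>\<^sub>M b\<in>{e}. lborel))"
    using product_integral_fold[of "{e}" ?I ?F] int ins by simp
  also have "\<dots> = (\<integral>x. (\<integral>f. indicator {0<..<1::real} (x e) * (\<Prod>b\<in>?I. g b (f b / x e)) \<partial>(\<Pi>\<^sub>M b\<in>?I. lborel)) \<partial>(\<Pi>\<^sub>M b\<in>{e}. lborel))"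
    by (intro Bochner_Integration.integral_cong refl arg_cong2[where f="(*)"] prod.cong)
       (auto simp: merge_def)
  also have "\<dots> = (\<integral>r. (\<integral>f. indicator {0<..<1::real} r * (\<Prod>b\<in>?I. g b (f b / r)) \<partial>(\<Pi>\<^sub>M b\<in>?I. lborel)) \<partial>lborel)"
    by (rule product_integral_singleton) measurable
  also have "\<dots> = (\<integral>r. indicator {0<..<1} r * (r ^ card ?I * (\<Prod>b\<in>?I. integral\<^sup>L lborel (g b))) \<partial>lborel)"
  proof (intro Bochner_Integration.integral_cong refl)
    fix r :: real
    show "(\<integral>f. indicator {0<..<1::real} r * (\<Prod>b\<in>?I. g b (f b / r)) \<partial>(\<Pi>\<^sub>M b\<in>?I. lborel))
        = indicator {0<..<1} r * (r ^ card ?I * (\<Prod>b\<in>?I. integral\<^sup>L lborel (g b)))"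
    proof (cases "0 < r \<and> r < 1")
      case True
      have "(\<integral>f. (\<Prod>b\<in>?I. g b (f b / r)) \<partial>(\<Pi>\<^sub>M b\<in>?I. lborel)) = (\<Prod>b\<in>?I. \<integral>u. g b (u / r) \<partial>lborel)"
        using True scl(1) by (intro product_integral_prod) auto
      with True scl(2) show ?thesis by (simp add: prod.distrib)
    qed auto
  qed
  also have "\<dots> = (\<Prod>b\<in>?I. integral\<^sup>L lborel (g b)) / DIM('a)"
    using int_pow by (simp add: has_bochner_integral_iff)
  finally have val: "integral\<^sup>L (\<Pi>\<^sub>M b\<in>Basis. lborel) ?F = (\<Prod>b\<in>?I. integral\<^sup>L lborel (g b)) / DIM('a)" .
  let ?G = "\<lambda>y. indicator {0<..<1} (y \<bullet> e) * (\<Prod>b\<in>?I. g b (y \<bullet> b / (y \<bullet> e)))"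
  have [measurable]: "?G \<in> borel_measurable borel"
    by measurable
  have comp: "(\<Sum>b'\<in>Basis. f b' *\<^sub>R b') \<bullet> b = f b" if "b \<in> Basis" for f and b :: 'a
    using that by (simp add: inner_sum_left inner_Basis if_distrib cong: if_cong)
  have eq: "?G (\<Sum>b\<in>Basis. f b *\<^sub>R b) = ?F f" for f
    using e by (auto simp: comp intro!: prod.cong)
  show ?thesis
    unfolding has_bochner_integral_iff
  proof
    show "integrable lborel ?G"
      using int by (subst lborel_eq, subst integrable_distr_eq) (simp_all only: eq, simp_all)
    show "integral\<^sup>L lborel ?G = (\<Prod>b\<in>?I. integral\<^sup>L lborel (g b)) / DIM('a)"
      by (subst lborel_eq, subst integral_distr) (simp_all only: eq val, simp_all)
  qed
qed

section \<open>Gaussian moments in one variable and in tangent coordinates\<close>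

lemma has_bochner_integral_gaussian_power:
  assumes "has_bochner_integral lborel (\<lambda>x. std_normal_density x * x ^ k) c"
  shows "has_bochner_integral lborel (\<lambda>u::real. exp (- u\<^sup>2 / 2) * u ^ k) (sqrt (2 * pi) * c)"
proof -
  have "has_bochner_integral lborel (\<lambda>u. sqrt (2 * pi) * (std_normal_density u * u ^ k)) (sqrt (2 * pi) * c)"
    using assms by (intro has_bochner_integral_mult_right) auto
  moreover have "sqrt (2 * pi) * (std_normal_density u * u ^ k) = exp (- u\<^sup>2 / 2) * u ^ k" for u
    by (simp add: std_normal_density_def)
  ultimately show ?thesis by (simp only:)
qed

lemma gaussian_moments_0: "has_bochner_integral lborel (\<lambda>u::real. exp (- u\<^sup>2 / 2)) (sqrt (2 * pi))"
  using has_bochner_integral_gaussian_power[of 0 1] std_normal_moment_even[of 0] by simp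

lemma gaussian_moments_1: "has_bochner_integral lborel (\<lambda>u::real. exp (- u\<^sup>2 / 2) * u) 0"
  using has_bochner_integral_gaussian_power[of 1 0] std_normal_moment_odd[of 0] by simp

lemma gaussian_moments_2: "has_bochner_integral lborel (\<lambda>u::real. exp (- u\<^sup>2 / 2) * u\<^sup>2) (sqrt (2 * pi))"
  using has_bochner_integral_gaussian_power[of 2 1] std_normal_moment_even[of 1] by (simp add: fact_numeral)

text \<open>For distinct \<open>b\<close> and \<open>c\<close> the factor at \<open>b\<close> is a
  first moment, which is 0. For \<open>b = c\<close> it is a second moment, which equals the mass
  sqrt (2 pi), so all d - 1 factors agree.\<close>

lemma has_bochner_integral_cone_moment_basis:
  fixes e :: "'a::euclidean_space"
  assumes e: "e \<in> Basis" and bc: "b \<in> Basis - {e}" "c \<in> Basis - {e}"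
  shows "has_bochner_integral lborel
    (\<lambda>y. indicator {0<..<1} (y \<bullet> e) * (exp (- (\<Sum>a\<in>Basis - {e}. (y \<bullet> a / (y \<bullet> e))\<^sup>2) / 2)
        * (y \<bullet> b / (y \<bullet> e)) * (y \<bullet> c / (y \<bullet> e))))
    (if b = c then sqrt (2 * pi) ^ (DIM('a) - 1) / DIM('a) else 0)"
proof -
  let ?I = "Basis - {e}"
  define g :: "'a \<Rightarrow> real \<Rightarrow> real" where
    "g a u = exp (- u\<^sup>2 / 2) * (if a = b then u else 1) * (if a = c then u else 1)" for a u
  have g: "has_bochner_integral lborel (g a)
      (if a = b \<and> a \<noteq> c \<or> a \<noteq> b \<and> a = c then 0 else sqrt (2 * pi))" for a
    using gaussian_moments_0 gaussian_moments_1 gaussian_moments_2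
    by (auto simp: g_def[abs_def] power2_eq_square mult.assoc)
  then have gi: "integral\<^sup>L lborel (g a) = (if a = b \<and> a \<noteq> c \<or> a \<noteq> b \<and> a = c then 0 else sqrt (2 * pi))" for a
    by (simp add: has_bochner_integral_iff)
  have int: "has_bochner_integral lborel
    (\<lambda>y. indicator {0<..<1} (y \<bullet> e) * (\<Prod>a\<in>?I. g a (y \<bullet> a / (y \<bullet> e))))
    ((\<Prod>a\<in>?I. integral\<^sup>L lborel (g a)) / DIM('a))"
    using g by (intro has_bochner_integral_cone_prod[OF e]) (auto simp: has_bochner_integral_iff)
  have val: "(\<Prod>a\<in>?I. integral\<^sup>L lborel (g a)) = (if b = c then sqrt (2 * pi) ^ (DIM('a) - 1) else 0)"
  proof (cases "b = c")
    case True
    then have "(\<Prod>a\<in>?I. integral\<^sup>L lborel (g a)) = (\<Prod>a\<in>?I. sqrt (2 * pi))"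
      by (intro prod.cong) (auto simp: gi)
    with True e show ?thesis by (simp add: card_Diff_singleton)
  next
    case False
    then show ?thesis using bc by (auto simp: gi intro!: prod_zero)
  qed
  have pr: "(\<Prod>a\<in>?I. g a (v a)) = exp (- (\<Sum>a\<in>?I. (v a)\<^sup>2) / 2) * v b * v c" for v
  proof -
    have "(\<Prod>a\<in>?I. if a = b then v a else 1) = v b" "(\<Prod>a\<in>?I. if a = c then v a else 1) = v c"
      using bc by simp_all
    then show ?thesis
      unfolding g_def by (simp only: prod.distrib) (simp add: exp_sum[symmetric] sum_negf sum_divide_distrib)
  qed
  have "(if b = c then sqrt (2 * pi) ^ (DIM('a) - 1) else 0) / DIM('a)
      = (if b = c then sqrt (2 * pi) ^ (DIM('a) - 1) / DIM('a) else 0)"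
    by simp
  with int show ?thesis
    unfolding val pr by (simp only:)
qed

text \<open>The slope \<open>R y /\<^sub>R (y \<bullet> e) - q\<close> is the central projection of
  \<open>R y\<close> to the tangent hyperplane at \<open>q\<close>, shifted to the origin. Its
  coordinates in the orthonormal frame \<open>R b\<close> are the ratios that
  \<open>has_bochner_integral_cone_prod\<close> integrates.\<close>

lemma tangent_coordinates:
  fixes q :: "real ^ 'd"
  assumes q: "norm q = 1"
  obtains e and R :: "real ^ 'd \<Rightarrow> real ^ 'd" where
    "e \<in> Basis" "orthogonal_transformation R" "R e = q" "\<forall>y. q \<bullet> R y = y \<bullet> e"
    "\<forall>y. y \<bullet> e > 0 \<longrightarrow> R y /\<^sub>R (y \<bullet> e) - q = (\<Sum>b\<in>Basis - {e}. (y \<bullet> b / (y \<bullet> e)) *\<^sub>R R b)"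
    "\<forall>y. y \<bullet> e > 0 \<longrightarrow> (norm (R y /\<^sub>R (y \<bullet> e) - q))\<^sup>2 = (\<Sum>b\<in>Basis - {e}. (y \<bullet> b / (y \<bullet> e))\<^sup>2)"
proof -
  obtain e and R :: "real ^ 'd \<Rightarrow> real ^ 'd" where e: "e \<in> Basis" and R: "orthogonal_transformation R" "R e = q"
    using rotate_basis_vector[OF q] .
  have l: "linear R" using R(1) by (rule orthogonal_transformation_linear)
  let ?I = "Basis - {e}"
  have qR: "q \<bullet> R y = y \<bullet> e" for y
    using R by (metis orthogonal_transformation_def inner_commute)
  have vR: "R y /\<^sub>R (y \<bullet> e) - q = (\<Sum>b\<in>?I. (y \<bullet> b / (y \<bullet> e)) *\<^sub>R R b)" if "y \<bullet> e > 0" for y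
  proof -
    have "R y = R (\<Sum>b\<in>Basis. (y \<bullet> b) *\<^sub>R b)"
      by (simp add: euclidean_representation)
    also have "\<dots> = (y \<bullet> e) *\<^sub>R q + (\<Sum>b\<in>?I. (y \<bullet> b) *\<^sub>R R b)"
      unfolding linear_sum[OF l] linear_cmul[OF l] using e by (simp add: sum.remove[of _ e] R(2))
    finally show ?thesis
      using that by (simp add: scaleR_add_right scaleR_sum_right divide_inverse mult.commute)
  qed
  have nv: "(norm (R y /\<^sub>R (y \<bullet> e) - q))\<^sup>2 = (\<Sum>b\<in>?I. (y \<bullet> b / (y \<bullet> e))\<^sup>2)" if "y \<bullet> e > 0" for y
  proof -
    have "(\<Sum>c\<in>?I. (y \<bullet> c / (y \<bullet> e)) * ((y \<bullet> b / (y \<bullet> e)) * (R b \<bullet> R c))) = (y \<bullet> b / (y \<bullet> e))\<^sup>2"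
      if b: "b \<in> ?I" for b
    proof -
      have "(\<Sum>c\<in>?I. (y \<bullet> c / (y \<bullet> e)) * ((y \<bullet> b / (y \<bullet> e)) * (R b \<bullet> R c)))
          = (\<Sum>c\<in>?I. if c = b then (y \<bullet> b / (y \<bullet> e))\<^sup>2 else 0)"
        using R(1) b by (intro sum.cong) (auto simp: orthogonal_transformation_def inner_Basis power2_eq_square)
      then show ?thesis using b by simp
    qed
    then have "(\<Sum>b\<in>?I. \<Sum>c\<in>?I. (y \<bullet> c / (y \<bullet> e)) * ((y \<bullet> b / (y \<bullet> e)) * (R b \<bullet> R c))) = (\<Sum>b\<in>?I. (y \<bullet> b / (y \<bullet> e))\<^sup>2)"
      by (rule sum.cong[OF refl])
    then show ?thesis
      unfolding power2_norm_eq_inner vR[OF that] inner_sum_left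
      unfolding inner_sum_right by (simp only: inner_scaleR_left inner_scaleR_right)
  qed
  show ?thesis
    by (rule that[OF e R]; intro allI impI qR vR nv; assumption)
qed

lemma has_bochner_integral_orthogonal:
  fixes R :: "'a::euclidean_space \<Rightarrow> 'a" and f :: "'a \<Rightarrow> real"
  assumes R: "orthogonal_transformation R" and [measurable]: "f \<in> borel_measurable borel"
    and "has_bochner_integral lborel (\<lambda>y. f (R y)) c"
  shows "has_bochner_integral lborel f c"
proof -
  note [measurable] = borel_measurable_orthogonal_transformation[OF R]
  have "has_bochner_integral (distr lborel borel R) f c"
    using assms(3) by (simp add: has_bochner_integral_iff integrable_distr_eq integral_distr)
  then show ?thesis by (simp add: distr_lborel_orthogonal[OF R])
qed

lemma has_bochner_integral_tangent_mass:
  fixes q :: "real ^ 'd"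
  assumes q: "norm q = 1"
  shows "has_bochner_integral lborel
    (\<lambda>y. indicator {0<..<1} (q \<bullet> y) * exp (- (norm (y /\<^sub>R (q \<bullet> y) - q))\<^sup>2 / 2))
    (sqrt (2 * pi) ^ (CARD('d) - 1) / CARD('d))"
proof -
  obtain e and R :: "real ^ 'd \<Rightarrow> real ^ 'd" where e: "e \<in> Basis" and R: "orthogonal_transformation R" "R e = q"
    and "\<forall>y. q \<bullet> R y = y \<bullet> e"
    and "\<forall>y. y \<bullet> e > 0 \<longrightarrow> R y /\<^sub>R (y \<bullet> e) - q = (\<Sum>b\<in>Basis - {e}. (y \<bullet> b / (y \<bullet> e)) *\<^sub>R R b)"
    and "\<forall>y. y \<bullet> e > 0 \<longrightarrow> (norm (R y /\<^sub>R (y \<bullet> e) - q))\<^sup>2 = (\<Sum>b\<in>Basis - {e}. (y \<bullet> b / (y \<bullet> e))\<^sup>2)"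
    using tangent_coordinates[OF q] .
  then have qR: "\<And>y. q \<bullet> R y = y \<bullet> e"
    and vR: "\<And>y. y \<bullet> e > 0 \<Longrightarrow> R y /\<^sub>R (y \<bullet> e) - q = (\<Sum>b\<in>Basis - {e}. (y \<bullet> b / (y \<bullet> e)) *\<^sub>R R b)"
    and nv: "\<And>y. y \<bullet> e > 0 \<Longrightarrow> (norm (R y /\<^sub>R (y \<bullet> e) - q))\<^sup>2 = (\<Sum>b\<in>Basis - {e}. (y \<bullet> b / (y \<bullet> e))\<^sup>2)"
    by blast+
  let ?I = "Basis - {e}"
  let ?f = "\<lambda>y. indicator {0<..<1} (q \<bullet> y) * exp (- (norm (y /\<^sub>R (q \<bullet> y) - q))\<^sup>2 / 2)"
  have "has_bochner_integral lborel
    (\<lambda>y. indicator {0<..<1} (y \<bullet> e) * (\<Prod>a\<in>?I. exp (- (y \<bullet> a / (y \<bullet> e))\<^sup>2 / 2)))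
    ((\<Prod>a\<in>?I. \<integral>u. exp (- u\<^sup>2 / 2) \<partial>lborel) / DIM(real ^ 'd))"
    by (rule has_bochner_integral_cone_prod[OF e, of "\<lambda>_ u. exp (- u\<^sup>2 / 2)"])
       (use gaussian_moments_0 in \<open>simp add: has_bochner_integral_iff\<close>)
  also have "(\<lambda>y. indicator {0<..<1} (y \<bullet> e) * (\<Prod>a\<in>?I. exp (- (y \<bullet> a / (y \<bullet> e))\<^sup>2 / 2))) = (\<lambda>y. ?f (R y))"
  proof
    fix y
    have "(\<Prod>a\<in>?I. exp (- (y \<bullet> a / (y \<bullet> e))\<^sup>2 / 2)) = exp (- (\<Sum>a\<in>?I. (y \<bullet> a / (y \<bullet> e))\<^sup>2) / 2)"
      by (simp add: exp_sum[symmetric] sum_negf sum_divide_distrib)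
    then show "indicator {0<..<1} (y \<bullet> e) * (\<Prod>a\<in>?I. exp (- (y \<bullet> a / (y \<bullet> e))\<^sup>2 / 2)) = ?f (R y)"
      by (cases "0 < y \<bullet> e") (simp_all only: qR nv, simp)
  qed
  also have "(\<Prod>a\<in>?I. \<integral>u. exp (- u\<^sup>2 / 2) \<partial>lborel) / DIM(real ^ 'd) = sqrt (2 * pi) ^ (CARD('d) - 1) / CARD('d)"
    using e gaussian_moments_0 by (simp add: has_bochner_integral_iff card_Diff_singleton)
  finally show ?thesis
    by (rule has_bochner_integral_orthogonal[OF R(1), rotated]) measurable
qed

text \<open>Expanding both linear forms in the frame \<open>R b\<close> leaves only diagonal terms.
  Their sum is Parseval's identity without the direction \<open>q\<close>, so the form of
  \<open>tang_proj q\<close> appears; this is the source of the projection in the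
  covariance.\<close>

lemma has_bochner_integral_tangent_moment:
  fixes q s s' :: "real ^ 'd"
  assumes q: "norm q = 1"
  shows "has_bochner_integral lborel
    (\<lambda>y. indicator {0<..<1} (q \<bullet> y) * (exp (- (norm (y /\<^sub>R (q \<bullet> y) - q))\<^sup>2 / 2)
      * (s \<bullet> (y /\<^sub>R (q \<bullet> y) - q)) * (s' \<bullet> (y /\<^sub>R (q \<bullet> y) - q))))
    (sqrt (2 * pi) ^ (CARD('d) - 1) * (s \<bullet> s' - (q \<bullet> s) * (q \<bullet> s')) / CARD('d))"
proof -
  obtain e and R :: "real ^ 'd \<Rightarrow> real ^ 'd" where e: "e \<in> Basis" and R: "orthogonal_transformation R" "R e = q"
    and "\<forall>y. q \<bullet> R y = y \<bullet> e"
    and "\<forall>y. y \<bullet> e > 0 \<longrightarrow> R y /\<^sub>R (y \<bullet> e) - q = (\<Sum>b\<in>Basis - {e}. (y \<bullet> b / (y \<bullet> e)) *\<^sub>R R b)"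
    and "\<forall>y. y \<bullet> e > 0 \<longrightarrow> (norm (R y /\<^sub>R (y \<bullet> e) - q))\<^sup>2 = (\<Sum>b\<in>Basis - {e}. (y \<bullet> b / (y \<bullet> e))\<^sup>2)"
    using tangent_coordinates[OF q] .
  then have qR: "\<And>y. q \<bullet> R y = y \<bullet> e"
    and vR: "\<And>y. y \<bullet> e > 0 \<Longrightarrow> R y /\<^sub>R (y \<bullet> e) - q = (\<Sum>b\<in>Basis - {e}. (y \<bullet> b / (y \<bullet> e)) *\<^sub>R R b)"
    and nv: "\<And>y. y \<bullet> e > 0 \<Longrightarrow> (norm (R y /\<^sub>R (y \<bullet> e) - q))\<^sup>2 = (\<Sum>b\<in>Basis - {e}. (y \<bullet> b / (y \<bullet> e))\<^sup>2)"
    by blast+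
  let ?I = "Basis - {e}"
  let ?f = "\<lambda>y. indicator {0<..<1} (q \<bullet> y) * (exp (- (norm (y /\<^sub>R (q \<bullet> y) - q))\<^sup>2 / 2)
      * (s \<bullet> (y /\<^sub>R (q \<bullet> y) - q)) * (s' \<bullet> (y /\<^sub>R (q \<bullet> y) - q)))"
  let ?K = "sqrt (2 * pi) ^ (CARD('d) - 1) / CARD('d)"
  let ?h = "\<lambda>b c y. indicator {0<..<1} (y \<bullet> e) * (exp (- (\<Sum>a\<in>?I. (y \<bullet> a / (y \<bullet> e))\<^sup>2) / 2)
        * (y \<bullet> b / (y \<bullet> e)) * (y \<bullet> c / (y \<bullet> e)))"
  have eq: "?f (R y) = (\<Sum>b\<in>?I. \<Sum>c\<in>?I. ((s \<bullet> R b) * (s' \<bullet> R c)) * ?h b c y)" for y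
  proof (cases "0 < y \<bullet> e \<and> y \<bullet> e < 1")
    case True
    have inn: "s \<bullet> (R y /\<^sub>R (y \<bullet> e) - q) = (\<Sum>b\<in>?I. (s \<bullet> R b) * (y \<bullet> b / (y \<bullet> e)))" for s
      using True by (simp only: vR inner_sum_right inner_scaleR_right mult.commute)
    let ?E = "exp (- (\<Sum>a\<in>?I. (y \<bullet> a / (y \<bullet> e))\<^sup>2) / 2)"
    have "?f (R y) = ?E * ((\<Sum>b\<in>?I. (s \<bullet> R b) * (y \<bullet> b / (y \<bullet> e))) * (\<Sum>c\<in>?I. (s' \<bullet> R c) * (y \<bullet> c / (y \<bullet> e))))"
      using True by (simp only: qR nv inn) simp
    also have "\<dots> = (\<Sum>b\<in>?I. \<Sum>c\<in>?I. ((s \<bullet> R b) * (s' \<bullet> R c)) * ?h b c y)"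
      unfolding sum_product unfolding sum_distrib_left using True by (intro sum.cong refl) simp
    finally show ?thesis .
  qed (auto simp: qR)
  have "has_bochner_integral lborel (\<lambda>y. ?f (R y))
      (\<Sum>b\<in>?I. \<Sum>c\<in>?I. ((s \<bullet> R b) * (s' \<bullet> R c)) * (if b = c then ?K else 0))"
  proof -
    have "has_bochner_integral lborel (?h b c) (if b = c then ?K else 0)" if "b \<in> ?I" "c \<in> ?I" for b c
      using has_bochner_integral_cone_moment_basis[OF e that] by (simp only: DIM_cart DIM_real mult_1_right)
    then show ?thesis
      unfolding eq by (intro has_bochner_integral_sum has_bochner_integral_mult_right)
  qed
  also have "(\<Sum>b\<in>?I. \<Sum>c\<in>?I. ((s \<bullet> R b) * (s' \<bullet> R c)) * (if b = c then ?K else 0))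
      = (\<Sum>b\<in>?I. (s \<bullet> R b) * (s' \<bullet> R b)) * ?K"
    unfolding sum_distrib_right
  proof (intro sum.cong refl)
    fix b assume b: "b \<in> ?I"
    have "(\<Sum>c\<in>?I. ((s \<bullet> R b) * (s' \<bullet> R c)) * (if b = c then ?K else 0))
      = (\<Sum>c\<in>?I. if b = c then (s \<bullet> R b) * (s' \<bullet> R b) * ?K else 0)"
      by (intro sum.cong) auto
    then show "(\<Sum>c\<in>?I. ((s \<bullet> R b) * (s' \<bullet> R c)) * (if b = c then ?K else 0)) = (s \<bullet> R b) * (s' \<bullet> R b) * ?K"
      using b by simp
  qed
  also have "(\<Sum>b\<in>?I. (s \<bullet> R b) * (s' \<bullet> R b)) = s \<bullet> s' - (q \<bullet> s) * (q \<bullet> s')"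
  proof -
    obtain u u' where u: "s = R u" "s' = R u'"
      using orthogonal_transformation_surj[OF R(1)] by (metis surjD)
    have "s \<bullet> s' = u \<bullet> u'" "s \<bullet> R b = u \<bullet> b" "s' \<bullet> R b = u' \<bullet> b" for b
      using R(1) by (auto simp: u orthogonal_transformation_def)
    moreover have "q \<bullet> s = u \<bullet> e" "q \<bullet> s' = u' \<bullet> e"
      by (simp_all add: u qR)
    ultimately show ?thesis
      using e by (simp add: euclidean_inner[of u u'] sum.remove[of _ e])
  qed
  finally have "has_bochner_integral lborel (\<lambda>y. ?f (R y)) ((s \<bullet> s' - (q \<bullet> s) * (q \<bullet> s')) * ?K)" .
  then have "has_bochner_integral lborel ?f ((s \<bullet> s' - (q \<bullet> s) * (q \<bullet> s')) * ?K)"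
    by (rule has_bochner_integral_orthogonal[OF R(1), rotated]) measurable
  then show ?thesis by (simp add: mult.commute)
qed

section \<open>Laplace asymptotics on the sphere\<close>

text \<open>The direction of \<open>tangent_scale q t y\<close> when \<open>v\<close> is the slope
  of \<open>y\<close> and \<open>q \<bullet> y\<close> is positive: on the sphere, the point reached
  from the tangent vector t v by radial projection.\<close>

definition near_point :: "'a::real_inner \<Rightarrow> 'a \<Rightarrow> real \<Rightarrow> 'a" where
  "near_point q v t = (q + t *\<^sub>R v) /\<^sub>R norm (q + t *\<^sub>R v)"

text \<open>With c the cosine, 1 - c^2 = (1 - c) (1 + c) \<le> 2 (1 - c), and the tangential part of
  \<open>y\<close> is at most the sine because \<open>norm y < 1\<close>. This gives a Gaussian
  bound for the weight on the whole ball, not just near \<open>q\<close>.\<close>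

lemma one_minus_inner_normalize_ge:
  fixes y q :: "'a::real_inner"
  assumes q: "norm q = 1" and y: "norm y < 1" "y \<noteq> 0"
  shows "1 - q \<bullet> (y /\<^sub>R norm y) \<ge> (norm (y - (q \<bullet> y) *\<^sub>R q))\<^sup>2 / 2"
proof -
  let ?c = "q \<bullet> (y /\<^sub>R norm y)"
  have qq: "q \<bullet> q = 1" using q by (simp add: norm_eq_1)
  have "?c \<le> 1" "?c \<ge> -1"
    using Cauchy_Schwarz_ineq2[of q "y /\<^sub>R norm y"] q y by (auto simp: abs_le_iff)
  then have "(1 - ?c) * (1 + ?c) \<le> (1 - ?c) * 2"
    by (intro mult_left_mono) auto
  then have 1: "(1 - ?c\<^sup>2) / 2 \<le> 1 - ?c"
    by (simp add: power2_eq_square left_diff_distrib right_diff_distrib distrib_left distrib_right del: inner_scaleR_right)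
  have "(norm (y - (q \<bullet> y) *\<^sub>R q))\<^sup>2 = (norm y)\<^sup>2 - (q \<bullet> y)\<^sup>2"
    unfolding power2_norm_eq_inner
    by (simp add: inner_diff_left inner_diff_right qq power2_eq_square inner_commute)
  also have "(q \<bullet> y)\<^sup>2 = ?c\<^sup>2 * (norm y)\<^sup>2"
    using y by (simp add: power_divide power_mult_distrib inverse_eq_divide)
  also have "(norm y)\<^sup>2 - ?c\<^sup>2 * (norm y)\<^sup>2 = (1 - ?c\<^sup>2) * (norm y)\<^sup>2"
    by (simp add: algebra_simps)
  also have "\<dots> \<le> (1 - ?c\<^sup>2) * 1"
    using \<open>?c \<le> 1\<close> \<open>?c \<ge> -1\<close> y by (intro mult_left_mono) (auto simp: power_le_one abs_square_le_1 abs_le_iff)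
  finally show ?thesis using 1 by simp
qed

text \<open>The weight enters the bound with half its exponent so that moments carrying a factor
  \<beta> can still be dominated, see \<open>mult_exp_minus_le\<close>. Pointwise limits are taken
  along \<open>near_point\<close> because after rescaling the normalised argument depends on
  \<open>y\<close> through its slope.\<close>

lemma laplace_sphere:
  fixes q :: "real ^ 'd" and H :: "nat \<Rightarrow> real ^ 'd \<Rightarrow> real"
  assumes q: "norm q = 1" and \<beta>: "\<And>n. \<beta> n > 0" "filterlim \<beta> at_top sequentially"
    and Hm [measurable]: "\<And>n. H n \<in> borel_measurable borel"
    and bound: "\<And>n x. norm x = 1 \<Longrightarrow> \<bar>H n x\<bar> \<le> C * exp (- \<beta> n * (1 - q \<bullet> x) / 2)"
    and lim: "\<And>v. q \<bullet> v = 0 \<Longrightarrow> (\<lambda>n. H n (near_point q v (1 / sqrt (\<beta> n)))) \<longlonglongrightarrow> G v"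
    and I: "has_bochner_integral lborel (\<lambda>y. indicator {0<..<1} (q \<bullet> y) * G (y /\<^sub>R (q \<bullet> y) - q)) (I / CARD('d))"
  shows "(\<lambda>n. \<beta> n powr ((real CARD('d) - 1) / 2) * integral\<^sup>L sphere_surface (H n)) \<longlonglongrightarrow> I"
proof -
  let ?d = "real CARD('d)"
  let ?t = "\<lambda>n. 1 / sqrt (\<beta> n)"
  have qq: "q \<bullet> q = 1" using q by (simp add: norm_eq_1)
  have t: "?t n > 0" for n using \<beta>(1) by simp
  have C: "C \<ge> 0"
    using bound[of q 0] q by (simp add: qq)
  define F where "F n y = indicator (ball 0 1 - {0}) y * H n (y /\<^sub>R norm y)" for n and y :: "real ^ 'd"
  have [measurable]: "F n \<in> borel_measurable borel" for n
    unfolding F_def by measurable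
  let ?L = "\<lambda>n. tangent_scale q (?t n)"
  \<comment> \<open>The Jacobian of the scaling cancels the power of \<beta> in the claim
    exactly.\<close>
  have pw: "\<beta> n powr ((?d - 1) / 2) * ?t n ^ (CARD('d) - 1) = 1" for n
  proof -
    have "?t n = \<beta> n powr (- (1 / 2))"
      using \<beta>(1)[of n] by (simp only: powr_minus_divide powr_half_sqrt[OF less_imp_le])
    then have "?t n ^ (CARD('d) - 1) = (\<beta> n powr (- (1 / 2))) powr real (CARD('d) - 1)"
      using \<beta>(1)[of n] by (simp only: powr_realpow[symmetric] powr_gt_zero)
    also have "\<dots> = \<beta> n powr (- ((?d - 1) / 2))"
      unfolding powr_powr by (simp add: of_nat_diff algebra_simps)
    finally show ?thesis
      using \<beta>(1)[of n] by (simp add: powr_minus)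
  qed
  have eq: "\<beta> n powr ((?d - 1) / 2) * integral\<^sup>L sphere_surface (H n) = ?d * (\<integral>y. F n (?L n y) \<partial>lborel)" for n
  proof -
    have "integral\<^sup>L sphere_surface (H n) = ?d * (?t n ^ (CARD('d) - 1) * (\<integral>y. F n (?L n y) \<partial>lborel))"
      by (subst integral_tangent_scale[OF q t, symmetric]) (auto simp: F_def[abs_def] integral_sphere_surface)
    then show ?thesis using pw[of n] by (simp add: algebra_simps)
  qed
  have nL: "(norm (?L n y))\<^sup>2 = (q \<bullet> y)\<^sup>2 + (norm (y - (q \<bullet> y) *\<^sub>R q))\<^sup>2 / \<beta> n" for n y
    unfolding power2_norm_eq_inner tangent_scale_def using \<beta>(1)[of n]
    by (simp add: inner_add_left inner_add_right inner_diff_left inner_diff_right qq power2_eq_square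
        inner_commute algebra_simps add_divide_distrib diff_divide_distrib)
  have qL: "q \<bullet> ?L n y = q \<bullet> y" for n y
    by (simp add: tangent_scale_def inner_add_right inner_diff_right qq)
  \<comment> \<open>On the support \<open>(q \<bullet> y)\<^sup>2 \<le> 1\<close>, so with w the
    tangential part of y the bound exp (- |w|^2 / 4) is at most exp (1 / 4) exp (- |y|^2 / 4), which
    decays along \<open>q\<close> as well.\<close>
  have dom: "\<bar>F n (?L n y)\<bar> \<le> C * (exp (1 / 4) * exp (- (1 / 4) * (norm y)\<^sup>2))" for n y
  proof (cases "?L n y \<in> ball 0 1 - {0}")
    case True
    then have y: "norm (?L n y) < 1" "?L n y \<noteq> 0" by auto
    have "(norm (?L n y))\<^sup>2 \<le> 1" using y by (simp add: abs_square_le_1)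
    then have qy: "(q \<bullet> y)\<^sup>2 \<le> 1"
      using nL[of n y] divide_nonneg_pos[OF zero_le_power2 \<beta>(1), of "norm (y - (q \<bullet> y) *\<^sub>R q)" n] by linarith
    let ?w = "y - (q \<bullet> y) *\<^sub>R q"
    have nw: "(norm y)\<^sup>2 = (q \<bullet> y)\<^sup>2 + (norm ?w)\<^sup>2"
      unfolding power2_norm_eq_inner by (simp add: inner_diff_left inner_diff_right qq power2_eq_square inner_commute)
    have "?L n y - (q \<bullet> ?L n y) *\<^sub>R q = ?t n *\<^sub>R ?w"
      by (simp only: qL) (simp add: tangent_scale_def)
    then have "(norm (?L n y - (q \<bullet> ?L n y) *\<^sub>R q))\<^sup>2 = (norm ?w)\<^sup>2 / \<beta> n"
      using \<beta>(1)[of n] by (simp add: power_divide)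
    then have "(norm ?w)\<^sup>2 / \<beta> n / 2 \<le> 1 - q \<bullet> (?L n y /\<^sub>R norm (?L n y))"
      using one_minus_inner_normalize_ge[OF q y] by simp
    then have "(norm ?w)\<^sup>2 / 2 \<le> \<beta> n * (1 - q \<bullet> (?L n y /\<^sub>R norm (?L n y)))"
      using \<beta>(1)[of n] by (simp add: field_simps)
    then have le: "- \<beta> n * (1 - q \<bullet> (?L n y /\<^sub>R norm (?L n y))) / 2 \<le> 1 / 4 + (- (1 / 4) * (norm y)\<^sup>2)"
    proof -
      have "- \<beta> n * (1 - q \<bullet> (?L n y /\<^sub>R norm (?L n y))) / 2
        = - (\<beta> n * (1 - q \<bullet> (?L n y /\<^sub>R norm (?L n y)))) / 2"
        by simp
      then show ?thesis
        using nw qy \<open>(norm ?w)\<^sup>2 / 2 \<le> \<beta> n * (1 - q \<bullet> (?L n y /\<^sub>R norm (?L n y)))\<close> by linarith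
    qed
    have "\<bar>F n (?L n y)\<bar> = \<bar>H n (?L n y /\<^sub>R norm (?L n y))\<bar>"
      using True by (simp add: F_def)
    also have "\<dots> \<le> C * exp (- \<beta> n * (1 - q \<bullet> (?L n y /\<^sub>R norm (?L n y))) / 2)"
      using y by (intro bound) simp
    also have "\<dots> \<le> C * exp (1 / 4 + (- (1 / 4) * (norm y)\<^sup>2))"
      using le C by (intro mult_left_mono) auto
    finally show ?thesis by (simp add: exp_add[symmetric])
  next
    case False
    then show ?thesis using C by (simp add: F_def)
  qed
  have ptw: "(\<lambda>n. F n (?L n y)) \<longlonglongrightarrow> indicator {0<..<1} (q \<bullet> y) * G (y /\<^sub>R (q \<bullet> y) - q)" for y
  proof -
    have inv0: "(\<lambda>n. (norm (y - (q \<bullet> y) *\<^sub>R q))\<^sup>2 / \<beta> n) \<longlonglongrightarrow> 0"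
      by (rule real_tendsto_divide_at_top[OF tendsto_const \<beta>(2)])
    \<comment> \<open>On the far side of the equator the weight is exponentially small; at height at
      least 1 the scaled point is outside the open ball; between them the limit \<open>G\<close>
      appears.\<close>
    consider "q \<bullet> y \<le> 0" | "q \<bullet> y \<ge> 1" | "0 < q \<bullet> y" "q \<bullet> y < 1" by linarith
    then show ?thesis
    proof cases
      case 1
      have le: "norm (F n (?L n y)) \<le> C * exp (- (\<beta> n / 2))" for n
      proof (cases "?L n y \<in> ball 0 1 - {0}")
        case True
        then have y: "norm (?L n y) < 1" "?L n y \<noteq> 0" by auto
        let ?x = "?L n y /\<^sub>R norm (?L n y)"
        have "q \<bullet> ?x \<le> 0"
          using 1 qL[of n y] y by (simp add: mult_nonneg_nonpos)
        then have "\<beta> n * 1 \<le> \<beta> n * (1 - q \<bullet> ?x)"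
          using \<beta>(1)[of n] by (intro mult_left_mono) auto
        then have le: "- \<beta> n * (1 - q \<bullet> ?x) / 2 \<le> - (\<beta> n / 2)"
          by simp
        have "\<bar>F n (?L n y)\<bar> = \<bar>H n ?x\<bar>"
          using True by (simp add: F_def)
        also have "\<dots> \<le> C * exp (- \<beta> n * (1 - q \<bullet> ?x) / 2)"
          using y by (intro bound) simp
        also have "\<dots> \<le> C * exp (- (\<beta> n / 2))"
          using le C by (intro mult_left_mono) auto
        finally show ?thesis by (simp only: real_norm_def)
      next
        case False
        then show ?thesis using C by (simp add: F_def)
      qed
      have lim0: "(\<lambda>n. C * exp (- (\<beta> n / 2))) \<longlonglongrightarrow> 0"
      proof -
        have "filterlim (\<lambda>n. (1 / 2) * \<beta> n) at_top sequentially"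
          by (rule filterlim_tendsto_pos_mult_at_top[OF tendsto_const _ \<beta>(2)]) simp
        then have "((\<lambda>n. exp (- ((1 / 2) * \<beta> n))) \<longlongrightarrow> 0) sequentially"
          by (intro filterlim_compose[OF exp_at_bot]) (simp only: filterlim_uminus_at_top)
        from tendsto_mult_right_zero[OF this, of C] show ?thesis by simp
      qed
      have "(\<lambda>n. F n (?L n y)) \<longlonglongrightarrow> 0"
        by (rule Lim_null_comparison[OF always_eventually[OF allI[OF le]] lim0])
      with 1 show ?thesis by simp
    next
      case 2
      have "F n (?L n y) = 0" for n
      proof -
        have "1\<^sup>2 \<le> (q \<bullet> y)\<^sup>2" using 2 by (intro power_mono) auto
        then have "(norm (?L n y))\<^sup>2 \<ge> 1\<^sup>2"
          using nL[of n y] divide_nonneg_pos[OF zero_le_power2 \<beta>(1), of "norm (y - (q \<bullet> y) *\<^sub>R q)" n] by linarith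
        then have "norm (?L n y) \<ge> 1"
          by (rule power2_le_imp_le) simp
        then show ?thesis by (simp add: F_def)
      qed
      with 2 show ?thesis by simp
    next
      case 3
      let ?r = "q \<bullet> y" and ?v = "y /\<^sub>R (q \<bullet> y) - q"
      have v: "q \<bullet> ?v = 0"
        using 3 by (simp add: inner_diff_right qq)
      \<comment> \<open>The height \<open>?r\<close> factors out and normalisation removes it,
        leaving the slope alone.\<close>
      have Lr: "?L n y = ?r *\<^sub>R (q + ?t n *\<^sub>R ?v)" for n
        using 3 by (simp add: tangent_scale_def scaleR_add_right scaleR_diff_right algebra_simps)
      have np: "?L n y /\<^sub>R norm (?L n y) = near_point q ?v (?t n)" for n
        using 3 unfolding Lr near_point_def by simp
      \<comment> \<open>The squared norm of the scaled point tends to \<open>?r\<^sup>2\<close>,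
        which is less than 1, so the point is eventually inside the ball and the indicator in
        \<open>F\<close> is 1.\<close>
      have "(\<lambda>n. ?r\<^sup>2 + (norm (y - ?r *\<^sub>R q))\<^sup>2 / \<beta> n) \<longlonglongrightarrow> ?r\<^sup>2 + 0"
        by (intro tendsto_add tendsto_const inv0)
      moreover have "?r\<^sup>2 + 0 < 1"
        using 3 by (simp add: abs_square_less_1)
      ultimately have "\<forall>\<^sub>F n in sequentially. ?r\<^sup>2 + (norm (y - ?r *\<^sub>R q))\<^sup>2 / \<beta> n < 1"
        by (rule order_tendstoD(2))
      then have "\<forall>\<^sub>F n in sequentially. H n (near_point q ?v (?t n)) = F n (?L n y)"
      proof eventually_elim
        case (elim n)
        then have "(norm (?L n y))\<^sup>2 < 1" by (simp add: nL)
        then have "norm (?L n y) < 1" by (simp add: abs_square_less_1)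
        moreover have "?L n y \<noteq> 0" using qL[of n y] 3 by auto
        ultimately show ?case by (simp add: F_def np)
      qed
      then have "(\<lambda>n. F n (?L n y)) \<longlonglongrightarrow> G ?v"
        using lim[OF v] by (rule Lim_transform_eventually[rotated])
      with 3 show ?thesis by simp
    qed
  qed
  have "(\<lambda>n. \<integral>y. F n (?L n y) \<partial>lborel) \<longlonglongrightarrow> (\<integral>y. indicator {0<..<1} (q \<bullet> y) * G (y /\<^sub>R (q \<bullet> y) - q) \<partial>lborel)"
  proof (rule integral_dominated_convergence[where w="\<lambda>y. C * (exp (1 / 4) * exp (- (1 / 4) * (norm y)\<^sup>2))"])
    show "integrable lborel (\<lambda>y::real ^ 'd. C * (exp (1 / 4) * exp (- (1 / 4) * (norm y)\<^sup>2)))"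
      by (intro integrable_mult_right integrable_exp_norm2) simp
    show "(\<lambda>y. indicator {0<..<1} (q \<bullet> y) * G (y /\<^sub>R (q \<bullet> y) - q)) \<in> borel_measurable lborel"
      using I by (auto simp: has_bochner_integral_iff)
    show "AE y in lborel. norm (F n (?L n y)) \<le> C * (exp (1 / 4) * exp (- (1 / 4) * (norm y)\<^sup>2))" for n
      using dom by (intro AE_I2) simp
  qed (use ptw in auto)
  then have "(\<lambda>n. ?d * (\<integral>y. F n (?L n y) \<partial>lborel)) \<longlonglongrightarrow> ?d * (I / ?d)"
    using I by (intro tendsto_mult tendsto_const) (simp add: has_bochner_integral_iff)
  then show ?thesis by (simp add: eq)
qed

section \<open>Expansions at q and elementary bounds for the weight\<close>

lemma norm_near_point:
  fixes q :: "'a::real_inner"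
  assumes q: "norm q = 1" and v: "q \<bullet> v = 0"
  shows "norm (q + t *\<^sub>R v) = sqrt (1 + t\<^sup>2 * (norm v)\<^sup>2)" "norm (near_point q v t) = 1"
proof -
  have "(norm (q + t *\<^sub>R v))\<^sup>2 = 1 + t\<^sup>2 * (norm v)\<^sup>2"
    unfolding power2_norm_eq_inner using q v
    by (simp add: inner_add_left inner_add_right inner_commute norm_eq_1 power2_eq_square)
  then show 1: "norm (q + t *\<^sub>R v) = sqrt (1 + t\<^sup>2 * (norm v)\<^sup>2)"
    by (metis abs_norm_cancel real_sqrt_abs)
  have "1 + t\<^sup>2 * (norm v)\<^sup>2 > 0"
    by (simp add: add_pos_nonneg)
  then show "norm (near_point q v t) = 1"
    unfolding near_point_def by (simp add: 1)
qed

text \<open>The normalising factor differs from 1 at order 1 / \<beta>, so the displacement along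
  \<open>q\<close> vanishes even after multiplication by sqrt \<beta>.\<close>

lemma near_point_tendsto:
  fixes q :: "'a::real_inner"
  assumes q: "norm q = 1" and v: "q \<bullet> v = 0"
    and \<beta>: "\<And>n. \<beta> n > 0" "filterlim \<beta> at_top sequentially"
  shows "(\<lambda>n. sqrt (\<beta> n) *\<^sub>R (near_point q v (1 / sqrt (\<beta> n)) - q)) \<longlonglongrightarrow> v"
proof -
  let ?N = "\<lambda>n. sqrt (1 + (norm v)\<^sup>2 / \<beta> n)"
  have N: "norm (q + (1 / sqrt (\<beta> n)) *\<^sub>R v) = ?N n" for n
    using norm_near_point(1)[OF q v, of "1 / sqrt (\<beta> n)"] \<beta>(1)[of n] by (simp add: power_divide)
  have "(\<lambda>n. (norm v)\<^sup>2 / \<beta> n) \<longlonglongrightarrow> 0"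
    by (rule real_tendsto_divide_at_top[OF tendsto_const \<beta>(2)])
  then have Nlim: "?N \<longlonglongrightarrow> 1"
    using tendsto_real_sqrt[OF tendsto_add[OF tendsto_const[of 1]]] by fastforce
  have sq: "filterlim (\<lambda>n. sqrt (\<beta> n)) at_top sequentially"
    by (rule filterlim_compose[OF sqrt_at_top \<beta>(2)])
  have lim0: "(\<lambda>n. (norm v)\<^sup>2 / sqrt (\<beta> n)) \<longlonglongrightarrow> 0"
    by (rule real_tendsto_divide_at_top[OF tendsto_const sq])
  \<comment> \<open>Rationalisation, 1 - m = (1 - m^2) / (1 + m), replaces an indeterminate product
    by an expression with an evident limit.\<close>
  have alg: "s * (1 / m - 1) = - (a / s) / (m * (1 + m))"
    if "s > 0" "m > 0" "m\<^sup>2 = 1 + a / (s * s)" for s m a :: real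
  proof -
    have "s * (1 / m - 1) * (m * (1 + m)) = s * (1 - m\<^sup>2)"
      using that(2) by (simp add: field_simps power2_eq_square)
    also have "\<dots> = - (a / s)"
      using that(1,3) by simp
    finally show ?thesis
      using that(2) by (subst nonzero_eq_divide_eq) auto
  qed
  have eq: "sqrt (\<beta> n) *\<^sub>R (near_point q v (1 / sqrt (\<beta> n)) - q)
      = (- ((norm v)\<^sup>2 / sqrt (\<beta> n)) / (?N n * (1 + ?N n))) *\<^sub>R q + (1 / ?N n) *\<^sub>R v" for n
  proof -
    let ?s = "sqrt (\<beta> n)" and ?M = "?N n"
    have s: "?s > 0" "?s * ?s = \<beta> n" using \<beta>(1)[of n] by auto
    have M: "?M > 0" "?M\<^sup>2 = 1 + (norm v)\<^sup>2 / \<beta> n"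
      using \<beta>(1)[of n] by (auto simp: add_pos_nonneg)
    have "near_point q v (1 / ?s) = (1 / ?M) *\<^sub>R (q + (1 / ?s) *\<^sub>R v)"
      unfolding near_point_def N by (simp add: divide_inverse)
    then have 1: "?s *\<^sub>R (near_point q v (1 / ?s) - q) = (?s * (1 / ?M - 1)) *\<^sub>R q + (1 / ?M) *\<^sub>R v"
    proof -
      have "?s * (1 / ?M * (1 / ?s)) = 1 / ?M" using s(1) by simp
      then have "?s *\<^sub>R ((1 / ?M) *\<^sub>R (q + (1 / ?s) *\<^sub>R v) - q) = (?s * (1 / ?M)) *\<^sub>R q + (1 / ?M) *\<^sub>R v - ?s *\<^sub>R q"
        by (simp only: scaleR_diff_right scaleR_add_right scaleR_scaleR)
      then show ?thesis
        unfolding \<open>near_point q v (1 / ?s) = (1 / ?M) *\<^sub>R (q + (1 / ?s) *\<^sub>R v)\<close>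
        by (simp only: right_diff_distrib scaleR_diff_left) simp
    qed
    have "?s * (1 / ?M - 1) = - ((norm v)\<^sup>2 / ?s) / (?M * (1 + ?M))"
      by (rule alg) (use s M in simp_all)
    with 1 show ?thesis by simp
  qed
  have "(\<lambda>n. (- ((norm v)\<^sup>2 / sqrt (\<beta> n)) / (?N n * (1 + ?N n))) *\<^sub>R q + (1 / ?N n) *\<^sub>R v)
      \<longlonglongrightarrow> (- 0 / (1 * (1 + 1))) *\<^sub>R q + (1 / 1) *\<^sub>R v"
    by (intro tendsto_intros lim0 Nlim) auto
  then show ?thesis by (simp add: eq)
qed

text \<open>Links the exponent to the squared chord: Cauchy-Schwarz bounds in
  \<open>norm (x - q)\<close> become bounds in \<open>1 - q \<bullet> x\<close>, which the weight
  absorbs.\<close>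

lemma norm_diff_unit:
  fixes q x :: "'a::real_inner"
  assumes "norm q = 1" "norm x = 1"
  shows "(norm (x - q))\<^sup>2 = 2 * (1 - q \<bullet> x)"
  using assms unfolding power2_norm_eq_inner
  by (simp add: inner_diff_left inner_diff_right inner_commute norm_eq_1)

lemma one_minus_inner_nonneg:
  fixes q x :: "'a::real_inner"
  assumes "norm q = 1" "norm x = 1"
  shows "0 \<le> 1 - q \<bullet> x"
  by (metis norm_diff_unit[OF assms] zero_le_power2 mult_le_0_iff not_le zero_less_numeral zero_le_mult_iff)

lemma le_exp_half: "u \<le> exp (u / 2)" if "u \<ge> 0" for u :: real
proof -
  \<comment> \<open>The right side minus the left is (1 - u / 4)^2.\<close>
  have "u \<le> (1 + u / 4)\<^sup>2"
    using zero_le_power2[of "1 - u / 4"] by (simp add: power2_eq_square algebra_simps)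
  also have "\<dots> \<le> (exp (u / 4))\<^sup>2"
    using that by (intro power_mono exp_ge_add_one_self) auto
  also have "\<dots> = exp (u / 2)"
    by (simp add: exp_double[symmetric])
  finally show ?thesis .
qed

text \<open>A linear factor costs half of the exponent; this is how moments multiplied by \<beta>
  meet the domination hypothesis of \<open>laplace_sphere\<close>.\<close>

lemma mult_exp_minus_le: "u * exp (- u) \<le> exp (- u / 2)" if "u \<ge> 0" for u :: real
proof -
  have "u * exp (- u) \<le> exp (u / 2) * exp (- u)"
    using le_exp_half[OF that] by (intro mult_right_mono) auto
  also have "\<dots> = exp (- u / 2)"
    by (simp add: exp_add[symmetric])
  finally show ?thesis .
qed

text \<open>Summing \<open>has_bochner_integral_tangent_moment\<close> over the basis produces the
  trace d - 1 of the tangential projection, hence the coefficient of the drift along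
  \<open>q\<close>.\<close>

lemma has_bochner_integral_tangent_norm2:
  fixes q :: "real ^ 'd"
  assumes q: "norm q = 1"
  shows "has_bochner_integral lborel
    (\<lambda>y. indicator {0<..<1} (q \<bullet> y) * (exp (- (norm (y /\<^sub>R (q \<bullet> y) - q))\<^sup>2 / 2)
      * (norm (y /\<^sub>R (q \<bullet> y) - q))\<^sup>2))
    (sqrt (2 * pi) ^ (CARD('d) - 1) * (real CARD('d) - 1) / CARD('d))"
proof -
  let ?v = "\<lambda>y. y /\<^sub>R (q \<bullet> y) - q"
  have "has_bochner_integral lborel
    (\<lambda>y. \<Sum>b\<in>Basis. indicator {0<..<1} (q \<bullet> y) * (exp (- (norm (?v y))\<^sup>2 / 2) * (b \<bullet> ?v y) * (b \<bullet> ?v y)))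
    (\<Sum>b\<in>Basis. sqrt (2 * pi) ^ (CARD('d) - 1) * (b \<bullet> b - (q \<bullet> b) * (q \<bullet> b)) / CARD('d))"
    by (intro has_bochner_integral_sum has_bochner_integral_tangent_moment q)
  also have "(\<Sum>b\<in>Basis. sqrt (2 * pi) ^ (CARD('d) - 1) * (b \<bullet> b - (q \<bullet> b) * (q \<bullet> b)) / CARD('d))
      = sqrt (2 * pi) ^ (CARD('d) - 1) * (\<Sum>b\<in>Basis. b \<bullet> b - (q \<bullet> b) * (q \<bullet> b)) / CARD('d)"
    by (simp only: sum_distrib_left sum_divide_distrib)
  also have "(\<Sum>b\<in>Basis. b \<bullet> b - (q \<bullet> b) * (q \<bullet> b)) = real CARD('d) - 1"
  proof -
    have "(\<Sum>b\<in>(Basis :: (real ^ 'd) set). b \<bullet> b) = (\<Sum>b\<in>(Basis :: (real ^ 'd) set). 1)"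
      by (intro sum.cong) (auto simp: inner_Basis)
    moreover have "(\<Sum>b\<in>Basis. (q \<bullet> b) * (q \<bullet> b)) = 1"
      using q by (simp add: euclidean_inner[symmetric] norm_eq_1)
    ultimately show ?thesis by (simp add: sum_subtractf)
  qed
  also have "(\<lambda>y. \<Sum>b\<in>Basis. indicator {0<..<1} (q \<bullet> y) * (exp (- (norm (?v y))\<^sup>2 / 2) * (b \<bullet> ?v y) * (b \<bullet> ?v y)))
      = (\<lambda>y. indicator {0<..<1} (q \<bullet> y) * (exp (- (norm (?v y))\<^sup>2 / 2) * (norm (?v y))\<^sup>2))"
  proof
    fix y
    have "(norm (?v y))\<^sup>2 = (\<Sum>b\<in>Basis. (b \<bullet> ?v y) * (b \<bullet> ?v y))"
      unfolding power2_norm_eq_inner by (subst euclidean_inner) (simp only: inner_commute)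
    then show "(\<Sum>b\<in>Basis. indicator {0<..<1} (q \<bullet> y) * (exp (- (norm (?v y))\<^sup>2 / 2) * (b \<bullet> ?v y) * (b \<bullet> ?v y)))
      = indicator {0<..<1} (q \<bullet> y) * (exp (- (norm (?v y))\<^sup>2 / 2) * (norm (?v y))\<^sup>2)"
      by (simp only: sum_distrib_left mult.assoc)
  qed
  finally show ?thesis .
qed

text \<open>Reflection in the axis \<open>q\<close> preserves the weight and flips the sign of a tangential linear form.\<close>

lemma integral_sphere_odd:
  fixes q p :: "real ^ 'd"
  assumes q: "norm q = 1" and p: "q \<bullet> p = 0"
  shows "(\<integral>x. (p \<bullet> (x - q)) * exp (- b * (1 - q \<bullet> x)) \<partial>sphere_surface) = 0"
proof -
  let ?Q = "\<lambda>x. (2 * (q \<bullet> x)) *\<^sub>R q - x"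
  have qq: "q \<bullet> q = 1" using q by (simp add: norm_eq_1)
  have "linear ?Q"
    by (intro linearI) (simp_all add: inner_add_right scaleR_add_left algebra_simps)
  then have Q: "orthogonal_transformation ?Q"
    unfolding orthogonal_transformation_def
    by (auto simp: inner_diff_left inner_diff_right qq inner_commute)
  let ?f = "\<lambda>x. (p \<bullet> (x - q)) * exp (- b * (1 - q \<bullet> x))"
  have "?f (?Q x) = - ?f x" for x
    using p by (simp add: inner_diff_right qq inner_commute[of p q])
  then have "(\<integral>x. - ?f x \<partial>sphere_surface) = integral\<^sup>L sphere_surface ?f"
    using integral_sphere_surface_orthogonal[OF Q, of ?f] by simp
  then show ?thesis by simp
qed

text \<open>The remainder quotient tends to 0 while \<open>b n *\<^sub>R (x n - q)\<close>
  converges, so their product vanishes and the linear term alone gives the limit.\<close>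

lemma has_derivative_sequence:
  fixes f :: "'a::real_normed_vector \<Rightarrow> real"
  assumes f: "(f has_derivative D) (at q)"
    and b: "filterlim b at_top sequentially" and x: "(\<lambda>n. b n *\<^sub>R (x n - q)) \<longlonglongrightarrow> v"
  shows "x \<longlonglongrightarrow> q" "(\<lambda>n. b n * (f (x n) - f q)) \<longlonglongrightarrow> D v"
proof -
  have bl: "bounded_linear D" using f by (rule has_derivative_bounded_linear)
  have pos: "\<forall>\<^sub>F n in sequentially. b n > 0"
    using b by (simp add: filterlim_at_top_dense)
  have "(\<lambda>n. inverse (b n) *\<^sub>R (b n *\<^sub>R (x n - q))) \<longlonglongrightarrow> 0 *\<^sub>R v"
    by (intro tendsto_scaleR x tendsto_inverse_0_at_top b)
  moreover have "\<forall>\<^sub>F n in sequentially. inverse (b n) *\<^sub>R (b n *\<^sub>R (x n - q)) = x n - q"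
    using pos by eventually_elim simp
  ultimately have h0: "(\<lambda>n. x n - q) \<longlonglongrightarrow> 0"
    by (simp add: tendsto_cong)
  then show "x \<longlonglongrightarrow> q" by (simp add: LIM_zero_iff)
  \<comment> \<open>Division by zero makes \<open>\<phi> 0 = 0\<close>, so \<open>\<phi>\<close> is
    continuous at 0 and indices with \<open>x n = q\<close> are covered.\<close>
  define \<phi> where "\<phi> h = norm (f (q + h) - f q - D h) / norm h" for h
  have "\<phi> \<midarrow>0\<rightarrow> \<phi> 0"
  proof -
    have "(\<lambda>h. norm (f (q + h) - f q - D h) / norm h) \<midarrow>0\<rightarrow> 0"
      using f by (simp only: has_derivative_at)
    moreover have "\<phi> 0 = 0" by (simp add: \<phi>_def)
    ultimately show ?thesis by (simp only: \<phi>_def[abs_def])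
  qed
  then have "(\<lambda>n. \<phi> (x n - q)) \<longlonglongrightarrow> \<phi> 0"
    using h0 isCont_tendsto_compose[of 0 \<phi>] by (simp add: isCont_def)
  then have lim: "(\<lambda>n. norm (b n *\<^sub>R (x n - q)) * \<phi> (x n - q)) \<longlonglongrightarrow> norm v * 0"
    by (intro tendsto_mult tendsto_norm x) (simp add: \<phi>_def)
  have ev: "\<forall>\<^sub>F n in sequentially. norm (b n * (f (x n) - f q) - D (b n *\<^sub>R (x n - q)))
      \<le> norm (b n *\<^sub>R (x n - q)) * \<phi> (x n - q)"
    using pos
  proof eventually_elim
    case (elim n)
    have "b n * (f (x n) - f q) - D (b n *\<^sub>R (x n - q)) = b n * (f (x n) - f q - D (x n - q))"
      by (simp add: linear_simps(5)[OF bl] right_diff_distrib)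
    moreover have "norm (f (x n) - f q - D (x n - q)) = norm (x n - q) * \<phi> (x n - q)"
      by (cases "x n = q") (auto simp: \<phi>_def linear_simps(3)[OF bl])
    ultimately show ?case using elim by (simp add: abs_mult)
  qed
  have 0: "(\<lambda>n. b n * (f (x n) - f q) - D (b n *\<^sub>R (x n - q))) \<longlonglongrightarrow> 0"
    using lim by (intro Lim_null_comparison[OF ev]) simp
  have "(\<lambda>n. D (b n *\<^sub>R (x n - q))) \<longlonglongrightarrow> D v"
    by (rule bounded_linear.tendsto[OF bl x])
  from tendsto_add[OF 0 this] show "(\<lambda>n. b n * (f (x n) - f q)) \<longlonglongrightarrow> D v"
    by simp
qed

text \<open>Near \<open>q\<close> the derivative with tolerance 1 gives slope \<open>K + 1\<close>;
  at distance at least \<open>d\<close> the crude bound \<open>2 * B\<close> is at most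
  \<open>2 * B / d\<close> times the distance. Dominating the density increment requires such a
  global estimate.\<close>

lemma has_derivative_bounded_quotient:
  fixes f :: "'a::real_normed_vector \<Rightarrow> real"
  assumes f: "(f has_derivative D) (at q)" and B: "\<And>x. x \<in> S \<Longrightarrow> \<bar>f x\<bar> \<le> B" and q: "q \<in> S"
  obtains L where "L \<ge> 0" "\<And>x. x \<in> S \<Longrightarrow> \<bar>f x - f q\<bar> \<le> L * norm (x - q)"
proof -
  have bl: "bounded_linear D" using f by (rule has_derivative_bounded_linear)
  then obtain K where K: "\<And>h. norm (D h) \<le> norm h * K" "K \<ge> 0"
    using bounded_linear.nonneg_bounded by blast
  obtain d where d: "d > 0" "\<And>x. norm (x - q) < d \<Longrightarrow> norm (f x - f q - D (x - q)) \<le> 1 * norm (x - q)"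
    using f[unfolded has_derivative_at_alt] zero_less_one by blast
  have B0: "B \<ge> 0" using B[OF q] by linarith
  have quot: "\<bar>f x - f q\<bar> \<le> (K + 1 + 2 * B / d) * norm (x - q)" if x: "x \<in> S" for x
  proof (cases "norm (x - q) < d")
    case True
    have "\<bar>f x - f q\<bar> \<le> norm (x - q) + norm (x - q) * K"
      using d(2)[OF True] K(1)[of "x - q"] by (simp add: abs_le_iff)
    also have "\<dots> \<le> (K + 1 + 2 * B / d) * norm (x - q)"
      using d B0 by (simp add: algebra_simps)
    finally show ?thesis .
  next
    case False
    have "\<bar>f x - f q\<bar> \<le> 2 * B"
      using B[OF x] B[OF q] by linarith
    also have "2 * B = 2 * B / d * d" using d by simp
    also have "\<dots> \<le> 2 * B / d * norm (x - q)"
      using False d B0 by (intro mult_left_mono) auto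
    also have "\<dots> \<le> (K + 1 + 2 * B / d) * norm (x - q)"
      using K B0 by (intro mult_right_mono) auto
    finally show ?thesis .
  qed
  have "K + 1 + 2 * B / d \<ge> 0" using K d B0 by simp
  then show ?thesis using quot by (rule that)
qed

section \<open>Limits of the weighted moments of the density\<close>

locale sphere_density =
  fixes q :: "real ^ 'd" and \<rho> :: "real ^ 'd \<Rightarrow> real" and g :: "real ^ 'd" and B :: real
  assumes q: "norm q = 1"
    and \<rho>_meas [measurable]: "\<rho> \<in> borel_measurable borel"
    and \<rho>_bound: "\<And>x. norm x = 1 \<Longrightarrow> \<bar>\<rho> x\<bar> \<le> B"
    and \<rho>_deriv: "GDERIV \<rho> q :> g"
begin

lemma B_nonneg: "B \<ge> 0"
  using \<rho>_bound[OF q] by linarith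

lemma qq: "q \<bullet> q = 1"
  using q by (simp add: norm_eq_1)

text \<open>The sequence \<beta> is a parameter of the context rather than of the locale, because
  \<open>second_moment_limit\<close> applies the results to 2 \<beta>.\<close>

context
  fixes \<beta> :: "nat \<Rightarrow> real"
  assumes \<beta>: "\<And>n. \<beta> n > 0" "filterlim \<beta> at_top sequentially"
begin

lemma near_point_limits:
  assumes v: "q \<bullet> v = 0"
  defines "x \<equiv> \<lambda>n. near_point q v (1 / sqrt (\<beta> n))"
  shows "(\<lambda>n. \<rho> (x n)) \<longlonglongrightarrow> \<rho> q"
    and "(\<lambda>n. \<beta> n * (1 - q \<bullet> x n)) \<longlonglongrightarrow> (norm v)\<^sup>2 / 2"
    and "(\<lambda>n. sqrt (\<beta> n) * (\<rho> (x n) - \<rho> q)) \<longlonglongrightarrow> g \<bullet> v"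
    and "(\<lambda>n. sqrt (\<beta> n) * (s \<bullet> (x n - q))) \<longlonglongrightarrow> s \<bullet> v"
proof -
  have sq: "filterlim (\<lambda>n. sqrt (\<beta> n)) at_top sequentially"
    by (rule filterlim_compose[OF sqrt_at_top \<beta>(2)])
  have lim: "(\<lambda>n. sqrt (\<beta> n) *\<^sub>R (x n - q)) \<longlonglongrightarrow> v"
    unfolding x_def by (rule near_point_tendsto[OF q v \<beta>])
  have der: "(\<rho> has_derivative (\<lambda>h. h \<bullet> g)) (at q)"
    using \<rho>_deriv by (simp add: gderiv_def)
  have "isCont \<rho> q"
    using has_derivative_continuous[OF der] .
  then show "(\<lambda>n. \<rho> (x n)) \<longlonglongrightarrow> \<rho> q"
    using has_derivative_sequence(1)[OF der sq lim] by (rule isCont_tendsto_compose)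
  show "(\<lambda>n. sqrt (\<beta> n) * (\<rho> (x n) - \<rho> q)) \<longlonglongrightarrow> g \<bullet> v"
    using has_derivative_sequence(2)[OF der sq lim] by (simp add: inner_commute)
  \<comment> \<open>By the chord identity the exponent is exactly half the squared norm of the
    rescaled displacement, so its limit follows from the first-order one.\<close>
  have "(\<lambda>n. (norm (sqrt (\<beta> n) *\<^sub>R (x n - q)))\<^sup>2 / 2) \<longlonglongrightarrow> (norm v)\<^sup>2 / 2"
    by (intro tendsto_intros lim) simp
  moreover have "(norm (sqrt (\<beta> n) *\<^sub>R (x n - q)))\<^sup>2 / 2 = \<beta> n * (1 - q \<bullet> x n)" for n
    using norm_diff_unit[OF q norm_near_point(2)[OF q v], of "1 / sqrt (\<beta> n)"] \<beta>(1)[of n]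
    by (simp add: x_def power_mult_distrib)
  ultimately show "(\<lambda>n. \<beta> n * (1 - q \<bullet> x n)) \<longlonglongrightarrow> (norm v)\<^sup>2 / 2"
    by simp
  show "(\<lambda>n. sqrt (\<beta> n) * (s \<bullet> (x n - q))) \<longlonglongrightarrow> s \<bullet> v"
    using tendsto_inner[OF tendsto_const[of s] lim] by simp
qed

lemma laplace_mass:
  "(\<lambda>n. \<beta> n powr ((real CARD('d) - 1) / 2) * (\<integral>x. \<rho> x * exp (- \<beta> n * (1 - q \<bullet> x)) \<partial>sphere_surface))
    \<longlonglongrightarrow> sqrt (2 * pi) ^ (CARD('d) - 1) * \<rho> q"
proof (rule laplace_sphere[OF q \<beta>, where C=B and G="\<lambda>v. \<rho> q * exp (- (norm v)\<^sup>2 / 2)"])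
  fix n x assume x: "norm (x :: real ^ 'd) = 1"
  have "- \<beta> n * (1 - q \<bullet> x) \<le> - \<beta> n * (1 - q \<bullet> x) / 2"
    using one_minus_inner_nonneg[OF q x] \<beta>(1)[of n] by simp
  then show "\<bar>\<rho> x * exp (- \<beta> n * (1 - q \<bullet> x))\<bar> \<le> B * exp (- \<beta> n * (1 - q \<bullet> x) / 2)"
    unfolding abs_mult using \<rho>_bound[OF x] B_nonneg by (intro mult_mono) auto
next
  fix v assume v: "q \<bullet> v = 0"
  have "(\<lambda>n. \<rho> (near_point q v (1 / sqrt (\<beta> n))) * exp (- (\<beta> n * (1 - q \<bullet> near_point q v (1 / sqrt (\<beta> n))))))
    \<longlonglongrightarrow> \<rho> q * exp (- ((norm v)\<^sup>2 / 2))"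
    by (intro tendsto_intros near_point_limits v)
  then show "(\<lambda>n. \<rho> (near_point q v (1 / sqrt (\<beta> n))) * exp (- \<beta> n * (1 - q \<bullet> near_point q v (1 / sqrt (\<beta> n)))))
    \<longlonglongrightarrow> \<rho> q * exp (- (norm v)\<^sup>2 / 2)"
    by simp
next
  have "has_bochner_integral lborel
    (\<lambda>y. \<rho> q * (indicator {0<..<1} (q \<bullet> y) * exp (- (norm (y /\<^sub>R (q \<bullet> y) - q))\<^sup>2 / 2))) (\<rho> q * (sqrt (2 * pi) ^ (CARD('d) - 1) / CARD('d)))"
    by (intro has_bochner_integral_mult_right has_bochner_integral_tangent_mass q)
  then show "has_bochner_integral lborel
    (\<lambda>y. indicator {0<..<1} (q \<bullet> y) * (\<rho> q * exp (- (norm (y /\<^sub>R (q \<bullet> y) - q))\<^sup>2 / 2))) (sqrt (2 * pi) ^ (CARD('d) - 1) * \<rho> q / CARD('d))"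
    by (simp add: mult.left_commute mult.commute)
qed measurable

text \<open>The factor \<beta> is used up by the two linear forms, one square root each, so of the
  density just its value at \<open>q\<close> survives, and of \<open>s\<close> just the tangential
  part.\<close>

lemma laplace_second_moment:
  "(\<lambda>n. \<beta> n powr ((real CARD('d) - 1) / 2)
      * (\<integral>x. \<beta> n * (s \<bullet> (x - q))\<^sup>2 * (\<rho> x * exp (- \<beta> n * (1 - q \<bullet> x))) \<partial>sphere_surface))
    \<longlonglongrightarrow> sqrt (2 * pi) ^ (CARD('d) - 1) * (\<rho> q * (s \<bullet> s - (q \<bullet> s)\<^sup>2))"
proof (rule laplace_sphere[OF q \<beta>, where C="2 * (norm s)\<^sup>2 * B"
      and G="\<lambda>v. (s \<bullet> v)\<^sup>2 * (\<rho> q * exp (- (norm v)\<^sup>2 / 2))"])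
  fix n x assume x: "norm (x :: real ^ 'd) = 1"
  let ?u = "\<beta> n * (1 - q \<bullet> x)"
  have u: "?u \<ge> 0" using one_minus_inner_nonneg[OF q x] \<beta>(1)[of n] by simp
  \<comment> \<open>Cauchy-Schwarz and the chord identity produce the factor
    \<open>2 * (norm s)\<^sup>2\<close> of the dominating constant.\<close>
  have "(s \<bullet> (x - q))\<^sup>2 \<le> (norm s)\<^sup>2 * (norm (x - q))\<^sup>2"
    using Cauchy_Schwarz_ineq[of s "x - q"] by (simp only: power2_norm_eq_inner)
  then have "\<beta> n * (s \<bullet> (x - q))\<^sup>2 \<le> \<beta> n * ((norm s)\<^sup>2 * (2 * (1 - q \<bullet> x)))"
    unfolding norm_diff_unit[OF q x] using \<beta>(1)[of n] by (intro mult_left_mono) auto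
  then have 1: "\<beta> n * (s \<bullet> (x - q))\<^sup>2 \<le> 2 * (norm s)\<^sup>2 * ?u"
    by (simp add: algebra_simps)
  have "\<bar>\<beta> n * (s \<bullet> (x - q))\<^sup>2 * (\<rho> x * exp (- \<beta> n * (1 - q \<bullet> x)))\<bar>
      = (\<beta> n * (s \<bullet> (x - q))\<^sup>2) * (\<bar>\<rho> x\<bar> * exp (- ?u))"
    using \<beta>(1)[of n] by (simp add: abs_mult)
  also have "\<dots> \<le> (2 * (norm s)\<^sup>2 * ?u) * (B * exp (- ?u))"
    using \<rho>_bound[OF x] u by (intro mult_mono[OF 1] mult_right_mono) auto
  also have "\<dots> = 2 * (norm s)\<^sup>2 * B * (?u * exp (- ?u))"
    by (simp only: mult_ac)
  also have "\<dots> \<le> 2 * (norm s)\<^sup>2 * B * exp (- ?u / 2)"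
    using B_nonneg mult_exp_minus_le[OF u] by (intro mult_left_mono) auto
  finally show "\<bar>\<beta> n * (s \<bullet> (x - q))\<^sup>2 * (\<rho> x * exp (- \<beta> n * (1 - q \<bullet> x)))\<bar>
      \<le> 2 * (norm s)\<^sup>2 * B * exp (- \<beta> n * (1 - q \<bullet> x) / 2)" by simp
next
  fix v assume v: "q \<bullet> v = 0"
  let ?x = "\<lambda>n. near_point q v (1 / sqrt (\<beta> n))"
  have "(\<lambda>n. (sqrt (\<beta> n) * (s \<bullet> (?x n - q)))\<^sup>2 * (\<rho> (?x n) * exp (- (\<beta> n * (1 - q \<bullet> ?x n)))))
    \<longlonglongrightarrow> (s \<bullet> v)\<^sup>2 * (\<rho> q * exp (- ((norm v)\<^sup>2 / 2)))"
    by (intro tendsto_intros near_point_limits v)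
  then show "(\<lambda>n. \<beta> n * (s \<bullet> (?x n - q))\<^sup>2 * (\<rho> (?x n) * exp (- \<beta> n * (1 - q \<bullet> ?x n))))
    \<longlonglongrightarrow> (s \<bullet> v)\<^sup>2 * (\<rho> q * exp (- (norm v)\<^sup>2 / 2))"
    using \<beta>(1) by (simp add: power_mult_distrib less_imp_le)
next
  let ?v = "\<lambda>y. y /\<^sub>R (q \<bullet> y) - q"
  have "has_bochner_integral lborel
    (\<lambda>y. \<rho> q * (indicator {0<..<1} (q \<bullet> y) * (exp (- (norm (?v y))\<^sup>2 / 2) * (s \<bullet> ?v y) * (s \<bullet> ?v y))))
    (\<rho> q * (sqrt (2 * pi) ^ (CARD('d) - 1) * (s \<bullet> s - (q \<bullet> s) * (q \<bullet> s)) / CARD('d)))"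
    by (intro has_bochner_integral_mult_right has_bochner_integral_tangent_moment q)
  also have "(\<lambda>y. \<rho> q * (indicator {0<..<1} (q \<bullet> y) * (exp (- (norm (?v y))\<^sup>2 / 2) * (s \<bullet> ?v y) * (s \<bullet> ?v y))))
    = (\<lambda>y. indicator {0<..<1} (q \<bullet> y) * ((s \<bullet> ?v y)\<^sup>2 * (\<rho> q * exp (- (norm (?v y))\<^sup>2 / 2))))"
    by (simp only: power2_eq_square mult_ac)
  also have "\<rho> q * (sqrt (2 * pi) ^ (CARD('d) - 1) * (s \<bullet> s - (q \<bullet> s) * (q \<bullet> s)) / CARD('d)) = sqrt (2 * pi) ^ (CARD('d) - 1) * (\<rho> q * (s \<bullet> s - (q \<bullet> s)\<^sup>2)) / CARD('d)"
    by (simp add: power2_eq_square)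
  finally show "has_bochner_integral lborel
    (\<lambda>y. indicator {0<..<1} (q \<bullet> y) * ((s \<bullet> ?v y)\<^sup>2 * (\<rho> q * exp (- (norm (?v y))\<^sup>2 / 2))))
    (sqrt (2 * pi) ^ (CARD('d) - 1) * (\<rho> q * (s \<bullet> s - (q \<bullet> s)\<^sup>2)) / CARD('d))" .
qed measurable

lemma laplace_first_moment:
  "(\<lambda>n. \<beta> n powr ((real CARD('d) - 1) / 2)
      * (\<integral>x. \<beta> n * (s \<bullet> (x - q)) * (\<rho> x * exp (- \<beta> n * (1 - q \<bullet> x))) \<partial>sphere_surface))
    \<longlonglongrightarrow> sqrt (2 * pi) ^ (CARD('d) - 1) * (s \<bullet> (g - (q \<bullet> g) *\<^sub>R q) - \<rho> q * ((real CARD('d) - 1) / 2) * (q \<bullet> s))"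
proof -
  define p where "p = s - (q \<bullet> s) *\<^sub>R q"
  have qp: "q \<bullet> p = 0" by (simp add: p_def inner_diff_right qq)
  obtain L where L: "L \<ge> 0" "\<And>x. x \<in> sphere 0 1 \<Longrightarrow> \<bar>\<rho> x - \<rho> q\<bar> \<le> L * norm (x - q)"
    using has_derivative_bounded_quotient[of \<rho> _ q "sphere 0 1" B] \<rho>_deriv \<rho>_bound q
    unfolding gderiv_def by (metis dist_0_norm mem_sphere)
  \<comment> \<open>Subtracting the constant \<open>\<rho> q\<close>, which does not contribute by oddness, gains the factor
    \<open>norm (x - q)\<close> that makes the tangential part dominated.\<close>
  define H where "H n x = ((p \<bullet> (x - q)) * (\<rho> x - \<rho> q) * \<beta> n - (q \<bullet> s) * (\<beta> n * (1 - q \<bullet> x)) * \<rho> x)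
      * exp (- \<beta> n * (1 - q \<bullet> x))" for n x
  have [measurable]: "H n \<in> borel_measurable borel" for n
    unfolding H_def by measurable
  \<comment> \<open>The first summand pairs Cauchy-Schwarz with the difference quotient
    \<open>L\<close>, the 2 coming from the squared chord; the second bounds the normal
    part.\<close>
  define C where "C = 2 * norm p * L + \<bar>q \<bullet> s\<bar> * B"
  have Hb: "\<bar>H n x\<bar> \<le> C * exp (- \<beta> n * (1 - q \<bullet> x) / 2)" if x: "norm x = 1" for n x
  proof -
    let ?u = "\<beta> n * (1 - q \<bullet> x)"
    have u: "?u \<ge> 0" using one_minus_inner_nonneg[OF q x] \<beta>(1)[of n] by simp
    have "\<bar>(p \<bullet> (x - q)) * (\<rho> x - \<rho> q)\<bar> \<le> (norm p * norm (x - q)) * (L * norm (x - q))"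
      unfolding abs_mult using L x by (intro mult_mono Cauchy_Schwarz_ineq2) auto
    also have "\<dots> = norm p * L * (norm (x - q))\<^sup>2"
      by (simp add: power2_eq_square)
    also have "\<dots> = 2 * norm p * L * (1 - q \<bullet> x)"
      unfolding norm_diff_unit[OF q x] by simp
    finally have "\<bar>(p \<bullet> (x - q)) * (\<rho> x - \<rho> q)\<bar> * \<beta> n \<le> 2 * norm p * L * (1 - q \<bullet> x) * \<beta> n"
      using \<beta>(1)[of n] by (intro mult_right_mono) auto
    then have 1: "\<bar>(p \<bullet> (x - q)) * (\<rho> x - \<rho> q) * \<beta> n\<bar> \<le> 2 * norm p * L * ?u"
      using \<beta>(1)[of n] by (simp add: abs_mult mult_ac)
    have "\<bar>(q \<bullet> s) * ?u * \<rho> x\<bar> = \<bar>q \<bullet> s\<bar> * ?u * \<bar>\<rho> x\<bar>"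
      unfolding abs_mult using u by (simp add: abs_mult[symmetric])
    also have "\<dots> \<le> \<bar>q \<bullet> s\<bar> * ?u * B"
      using \<rho>_bound[OF x] u by (intro mult_left_mono) auto
    finally have "\<bar>(p \<bullet> (x - q)) * (\<rho> x - \<rho> q) * \<beta> n - (q \<bullet> s) * ?u * \<rho> x\<bar> \<le> 2 * norm p * L * ?u + \<bar>q \<bullet> s\<bar> * ?u * B"
      using 1 abs_triangle_ineq4[of "(p \<bullet> (x - q)) * (\<rho> x - \<rho> q) * \<beta> n" "(q \<bullet> s) * ?u * \<rho> x"] by linarith
    also have "\<dots> = C * ?u" by (simp add: C_def algebra_simps)
    finally have "\<bar>H n x\<bar> \<le> C * ?u * exp (- ?u)"
      unfolding H_def abs_mult by (simp add: mult_right_mono)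
    also have "\<dots> \<le> C * exp (- ?u / 2)"
      unfolding mult.assoc using mult_exp_minus_le[OF u] L B_nonneg by (intro mult_left_mono) (auto simp: C_def)
    finally show ?thesis by simp
  qed
  let ?G = "\<lambda>v. ((p \<bullet> v) * (g \<bullet> v) - (q \<bullet> s) * ((norm v)\<^sup>2 / 2) * \<rho> q) * exp (- (norm v)\<^sup>2 / 2)"
  let ?I = "p \<bullet> g - (q \<bullet> p) * (q \<bullet> g) - (q \<bullet> s) * \<rho> q / 2 * (real CARD('d) - 1)"
  have main: "(\<lambda>n. \<beta> n powr ((real CARD('d) - 1) / 2) * integral\<^sup>L sphere_surface (H n)) \<longlonglongrightarrow> sqrt (2 * pi) ^ (CARD('d) - 1) * ?I"
  proof (rule laplace_sphere[OF q \<beta>, where C=C and G="?G"])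
    fix v assume v: "q \<bullet> v = 0"
    let ?x = "\<lambda>n. near_point q v (1 / sqrt (\<beta> n))"
    \<comment> \<open>The factor \<beta> is shared: one square root rescales the displacement, the
      other the increment of \<open>\<rho>\<close>, whose limit is the directional
      derivative.\<close>
    have "(\<lambda>n. ((sqrt (\<beta> n) * (p \<bullet> (?x n - q))) * (sqrt (\<beta> n) * (\<rho> (?x n) - \<rho> q))
        - (q \<bullet> s) * (\<beta> n * (1 - q \<bullet> ?x n)) * \<rho> (?x n)) * exp (- (\<beta> n * (1 - q \<bullet> ?x n))))
      \<longlonglongrightarrow> ((p \<bullet> v) * (g \<bullet> v) - (q \<bullet> s) * ((norm v)\<^sup>2 / 2) * \<rho> q) * exp (- ((norm v)\<^sup>2 / 2))"
      by (intro tendsto_intros near_point_limits v)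
    moreover have "(sqrt (\<beta> n) * a) * (sqrt (\<beta> n) * b) = a * b * \<beta> n" for n a b
    proof -
      have "(sqrt (\<beta> n) * a) * (sqrt (\<beta> n) * b) = (sqrt (\<beta> n) * sqrt (\<beta> n)) * (a * b)"
        by (simp only: mult_ac)
      then show ?thesis using \<beta>(1)[of n] by simp
    qed
    ultimately show "(\<lambda>n. H n (?x n)) \<longlonglongrightarrow> ?G v"
      by (simp add: H_def)
  next
    let ?v = "\<lambda>y. y /\<^sub>R (q \<bullet> y) - q"
    have "has_bochner_integral lborel
      (\<lambda>y. indicator {0<..<1} (q \<bullet> y) * (exp (- (norm (?v y))\<^sup>2 / 2) * (p \<bullet> ?v y) * (g \<bullet> ?v y))
        - (q \<bullet> s) * \<rho> q / 2 * (indicator {0<..<1} (q \<bullet> y) * (exp (- (norm (?v y))\<^sup>2 / 2) * (norm (?v y))\<^sup>2)))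
      (sqrt (2 * pi) ^ (CARD('d) - 1) * (p \<bullet> g - (q \<bullet> p) * (q \<bullet> g)) / CARD('d) - (q \<bullet> s) * \<rho> q / 2 * (sqrt (2 * pi) ^ (CARD('d) - 1) * (real CARD('d) - 1) / CARD('d)))"
      by (intro has_bochner_integral_diff has_bochner_integral_mult_right has_bochner_integral_tangent_moment
          has_bochner_integral_tangent_norm2 q)
    also have "(\<lambda>y. indicator {0<..<1} (q \<bullet> y) * (exp (- (norm (?v y))\<^sup>2 / 2) * (p \<bullet> ?v y) * (g \<bullet> ?v y))
        - (q \<bullet> s) * \<rho> q / 2 * (indicator {0<..<1} (q \<bullet> y) * (exp (- (norm (?v y))\<^sup>2 / 2) * (norm (?v y))\<^sup>2)))
      = (\<lambda>y. indicator {0<..<1} (q \<bullet> y) * ?G (?v y))"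
    proof
      fix y
      have "i * (E * a * b) - c * r / 2 * (i * (E * m)) = i * ((a * b - c * (m / 2) * r) * E)" for i E a b c r m :: real
        by (simp add: algebra_simps)
      then show "indicator {0<..<1} (q \<bullet> y) * (exp (- (norm (?v y))\<^sup>2 / 2) * (p \<bullet> ?v y) * (g \<bullet> ?v y))
        - (q \<bullet> s) * \<rho> q / 2 * (indicator {0<..<1} (q \<bullet> y) * (exp (- (norm (?v y))\<^sup>2 / 2) * (norm (?v y))\<^sup>2))
        = indicator {0<..<1} (q \<bullet> y) * ?G (?v y)" by blast
    qed
    also have "sqrt (2 * pi) ^ (CARD('d) - 1) * (p \<bullet> g - (q \<bullet> p) * (q \<bullet> g)) / CARD('d) - (q \<bullet> s) * \<rho> q / 2 * (sqrt (2 * pi) ^ (CARD('d) - 1) * (real CARD('d) - 1) / CARD('d))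
      = sqrt (2 * pi) ^ (CARD('d) - 1) * ?I / CARD('d)"
    proof -
      have "m * x / d - z * (m * e / d) = m * (x - z * e) / d" for m x d z e :: real
        by (simp add: diff_divide_distrib right_diff_distrib)
      then show ?thesis .
    qed
    finally show "has_bochner_integral lborel (\<lambda>y. indicator {0<..<1} (q \<bullet> y) * ?G (?v y)) (sqrt (2 * pi) ^ (CARD('d) - 1) * ?I / CARD('d))" .
  qed (use Hb in auto)
  have eq: "(\<integral>x. \<beta> n * (s \<bullet> (x - q)) * (\<rho> x * exp (- \<beta> n * (1 - q \<bullet> x))) \<partial>sphere_surface)
      = integral\<^sup>L sphere_surface (H n)" for n
  proof -
    let ?K = "\<lambda>x. (p \<bullet> (x - q)) * exp (- \<beta> n * (1 - q \<bullet> x))"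
    have iH: "integrable sphere_surface (H n)"
    proof (rule integrable_sphere_surface_bounded[where B="C"])
      fix x :: "real ^ 'd" assume x: "x \<in> sphere 0 1"
      then have "- \<beta> n * (1 - q \<bullet> x) / 2 \<le> 0"
        using one_minus_inner_nonneg[OF q, of x] \<beta>(1)[of n] by simp
      then have "C * exp (- \<beta> n * (1 - q \<bullet> x) / 2) \<le> C * 1"
        using L B_nonneg by (intro mult_left_mono) (auto simp: C_def)
      then show "\<bar>H n x\<bar> \<le> C"
        using Hb[of x n] x by simp
    qed simp
    have iK: "integrable sphere_surface ?K"
    proof (rule integrable_sphere_surface_bounded[where B="norm p * 2"])
      fix x :: "real ^ 'd" assume x: "x \<in> sphere 0 1"
      then have nx: "norm x = 1" by simp
      have "\<bar>p \<bullet> (x - q)\<bar> \<le> norm p * 2"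
      proof -
        have "norm (x - q) \<le> 2" using norm_triangle_ineq4[of x q] nx q by simp
        then show ?thesis
          using Cauchy_Schwarz_ineq2[of p "x - q"] mult_left_mono[of "norm (x - q)" 2 "norm p"] by simp
      qed
      moreover have "exp (- \<beta> n * (1 - q \<bullet> x)) \<le> 1"
        using one_minus_inner_nonneg[OF q nx] \<beta>(1)[of n] by simp
      ultimately have "\<bar>p \<bullet> (x - q)\<bar> * exp (- \<beta> n * (1 - q \<bullet> x)) \<le> (norm p * 2) * 1"
        by (intro mult_mono) auto
      then show "\<bar>?K x\<bar> \<le> norm p * 2"
        by (simp add: abs_mult)
    qed measurable
    \<comment> \<open>The original integrand is \<open>H n\<close> plus a multiple of the odd
      function \<open>?K\<close>, whose integral is 0; integrability of each part justifies the
      split.\<close>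
    have "\<beta> n * (s \<bullet> (x - q)) * (\<rho> x * exp (- \<beta> n * (1 - q \<bullet> x))) = H n x + \<rho> q * \<beta> n * ?K x" for x
    proof -
      have "s \<bullet> (x - q) = p \<bullet> (x - q) - (q \<bullet> s) * (1 - q \<bullet> x)"
        by (simp add: p_def inner_diff_left inner_diff_right qq inner_commute algebra_simps)
      moreover have "b * (a - c * t) * (r * E) = ((a * (r - r') * b - c * (b * t) * r) * E) + r' * b * (a * E)"
        for a b c t r r' E :: real
        by (simp add: algebra_simps)
      ultimately show ?thesis
        unfolding H_def by (simp only:)
    qed
    then have "(\<integral>x. \<beta> n * (s \<bullet> (x - q)) * (\<rho> x * exp (- \<beta> n * (1 - q \<bullet> x))) \<partial>sphere_surface)
        = integral\<^sup>L sphere_surface (H n) + \<rho> q * \<beta> n * integral\<^sup>L sphere_surface ?K"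
      using iH iK by simp
    then show ?thesis
      using integral_sphere_odd[OF q qp, of "\<beta> n"] by simp
  qed
  have "?I = s \<bullet> (g - (q \<bullet> g) *\<^sub>R q) - \<rho> q * ((real CARD('d) - 1) / 2) * (q \<bullet> s)"
    unfolding qp by (simp add: p_def inner_diff_left inner_diff_right inner_commute)
  with main show ?thesis
    by (simp only: eq)
qed

end

end

section \<open>Triangular arrays built from an i.i.d. sample\<close>

lemma norm_cis_diff_le: "norm (cis x - cis y) \<le> \<bar>x - y\<bar>"
proof -
  have "cis x - cis y = cis y * (cis (x - y) - 1)"
    by (simp add: right_diff_distrib cis_mult)
  then show ?thesis
    using iexp_approx1[of "x - y" 0] by (simp add: norm_mult cis_conv_exp)
qed

lemma norm_cis_taylor2:
  "norm (cis x - (1 + \<i> * complex_of_real x - complex_of_real (x\<^sup>2 / 2))) \<le> \<bar>x\<bar> ^ 3 / 6"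
  using iexp_approx1[of x 2] by (simp add: cis_conv_exp eval_nat_numeral power_mult_distrib)

text \<open>Compares with the powers of exp (L / n). Both bases lie in the closed unit disc, the
  second because \<open>Re L \<le> 0\<close>, and there n-th powers differ by at most n times the
  difference of the bases; complex logarithms are avoided.\<close>

lemma tendsto_power_exp_complex:
  fixes \<phi> :: "nat \<Rightarrow> complex"
  assumes le: "\<And>n. norm (\<phi> n) \<le> 1" and L: "Re L \<le> 0" and lim: "(\<lambda>n. of_nat n * (\<phi> n - 1)) \<longlonglongrightarrow> L"
  shows "(\<lambda>n. \<phi> n ^ n) \<longlonglongrightarrow> exp L"
proof -
  let ?w = "\<lambda>n. exp (L / of_nat n)"
  have w: "norm (?w n) \<le> 1" for n
    using L by (cases "n = 0") (auto simp: Re_divide_of_nat divide_nonpos_nonneg)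
  \<comment> \<open>n (exp (L / n) - 1) is the difference quotient of this function at 0 with
    increment 1 / n.\<close>
  have der: "((\<lambda>z. exp (L * z)) has_field_derivative L) (at 0)"
    by (auto intro!: derivative_eq_intros)
  have "filterlim (\<lambda>n. 1 / of_nat n :: complex) (at 0) sequentially"
    unfolding filterlim_at
    using eventually_gt_at_top[of 0] lim_1_over_n[where 'a=complex] by (auto elim: eventually_mono)
  then have "(\<lambda>n. (exp (L * (0 + 1 / of_nat n)) - exp (L * 0)) / (1 / of_nat n)) \<longlonglongrightarrow> L"
    using der unfolding DERIV_def by (rule filterlim_compose[rotated])
  then have wl: "(\<lambda>n. of_nat n * (?w n - 1)) \<longlonglongrightarrow> L"
    by (simp add: mult.commute)
  have "(\<lambda>n. of_nat n * (\<phi> n - 1) - of_nat n * (?w n - 1)) \<longlonglongrightarrow> 0"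
    using tendsto_diff[OF lim wl] by simp
  then have d0: "(\<lambda>n. norm (of_nat n * (\<phi> n - 1) - of_nat n * (?w n - 1))) \<longlonglongrightarrow> 0"
    by (rule tendsto_norm_zero)
  have "norm (\<phi> n ^ n - ?w n ^ n) \<le> norm (of_nat n * (\<phi> n - 1) - of_nat n * (?w n - 1))" for n
  proof -
    have "norm (\<phi> n ^ n - ?w n ^ n) \<le> real n * norm (\<phi> n - ?w n)"
      by (rule norm_power_diff[OF le w])
    also have "\<dots> = norm (of_nat n * (\<phi> n - ?w n))"
      by (simp add: norm_mult)
    also have "of_nat n * (\<phi> n - ?w n) = of_nat n * (\<phi> n - 1) - of_nat n * (?w n - 1)"
      by (simp add: algebra_simps)
    finally show ?thesis .
  qed
  then have 0: "(\<lambda>n. \<phi> n ^ n - ?w n ^ n) \<longlonglongrightarrow> 0"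
    by (intro Lim_null_comparison[OF always_eventually d0]) blast
  have "\<forall>\<^sub>F n in sequentially. ?w n ^ n = exp L"
    using eventually_gt_at_top[of 0] by eventually_elim (simp add: exp_of_nat_mult[symmetric])
  then have "(\<lambda>n. ?w n ^ n) \<longlonglongrightarrow> exp L"
    by (rule tendsto_eventually)
  from tendsto_add[OF 0 this] show ?thesis by simp
qed

locale iid_sample = prob_space M for M :: "'a measure" +
  fixes X :: "nat \<Rightarrow> 'a \<Rightarrow> 'b::euclidean_space" and D :: "'b measure"
  assumes X_meas [measurable]: "\<And>i. X i \<in> borel_measurable M"
    and X_indep: "indep_vars (\<lambda>_. borel) X UNIV"
    and X_law: "\<And>i. distr M borel (X i) = D"
begin

lemma sets_law [simp, measurable_cong]: "sets D = sets borel"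
  using X_law[of 0] by (metis sets_distr)

lemma prob_space_law: "prob_space D"
  using prob_space_distr[OF X_meas, of 0] by (simp add: X_law)

lemma integral_law:
  fixes h :: "'b \<Rightarrow> 'c::{banach, second_countable_topology}"
  assumes [measurable]: "h \<in> borel_measurable borel"
  shows "(\<integral>\<omega>. h (X i \<omega>) \<partial>M) = integral\<^sup>L D h"
  by (subst X_law[of i, symmetric], subst integral_distr) auto

lemma AE_law: "AE x in D. P x \<Longrightarrow> AE \<omega> in M. P (X i \<omega>)"
  using AE_distrD[OF X_meas[of i], of P] unfolding X_law .

lemma integral_mult_law:
  fixes h :: "'b \<Rightarrow> real"
  assumes [measurable]: "h \<in> borel_measurable borel" and c: "AE x in D. \<bar>h x\<bar> \<le> c"
  shows "(\<integral>\<omega>. h (X i \<omega>) * h (X j \<omega>) \<partial>M) = (if i = j then (\<integral>x. (h x)\<^sup>2 \<partial>D) else (\<integral>x. h x \<partial>D)\<^sup>2)"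
proof (cases "i = j")
  case True
  then show ?thesis
    using integral_law[of "\<lambda>x. (h x)\<^sup>2" i] by (simp add: power2_eq_square)
next
  case False
  have "indep_vars (\<lambda>_. borel) (\<lambda>i \<omega>. h (X i \<omega>)) {i, j}"
    by (rule indep_vars_compose2[OF indep_vars_subset[OF X_indep]]) auto
  moreover have "integrable M (\<lambda>\<omega>. h (X k \<omega>))" for k
    using AE_law[OF c, of k] by (intro integrable_const_bound[where B=c]) auto
  ultimately have "(\<integral>\<omega>. (\<Prod>k\<in>{i, j}. h (X k \<omega>)) \<partial>M) = (\<Prod>k\<in>{i, j}. \<integral>\<omega>. h (X k \<omega>) \<partial>M)"
    by (intro indep_vars_lebesgue_integral) auto
  with False show ?thesis
    by (simp add: integral_law power2_eq_square)
qed

lemma integrable_sum_law: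
  fixes h :: "'b \<Rightarrow> real"
  assumes [measurable]: "h \<in> borel_measurable borel" and c: "AE x in D. \<bar>h x\<bar> \<le> c"
  shows "integrable M (\<lambda>\<omega>. h (X i \<omega>))" "integrable M (\<lambda>\<omega>. h (X i \<omega>) * h (X j \<omega>))"
    "integrable M (\<lambda>\<omega>. (\<Sum>i\<in>{1..n}. h (X i \<omega>))\<^sup>2)"
proof -
  show "integrable M (\<lambda>\<omega>. h (X i \<omega>))"
    using AE_law[OF c, of i] by (intro integrable_const_bound[where B=c]) auto
  show *: "integrable M (\<lambda>\<omega>. h (X i \<omega>) * h (X j \<omega>))" for i j
  proof (intro integrable_const_bound[where B="c * c"])
    show "AE \<omega> in M. norm (h (X i \<omega>) * h (X j \<omega>)) \<le> c * c"
      using AE_law[OF c, of i] AE_law[OF c, of j]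
      by eventually_elim (auto simp: abs_mult intro!: mult_mono)
  qed measurable
  show "integrable M (\<lambda>\<omega>. (\<Sum>i\<in>{1..n}. h (X i \<omega>))\<^sup>2)"
    unfolding power2_eq_square sum_product using * by (intro Bochner_Integration.integrable_sum)
qed

lemma sum_second_moment:
  fixes h :: "'b \<Rightarrow> real"
  assumes [measurable]: "h \<in> borel_measurable borel" and c: "AE x in D. \<bar>h x\<bar> \<le> c"
  shows "(\<integral>\<omega>. (\<Sum>i\<in>{1..n}. h (X i \<omega>))\<^sup>2 \<partial>M)
    = real n * (\<integral>x. (h x)\<^sup>2 \<partial>D) + ((real n)\<^sup>2 - real n) * (\<integral>x. h x \<partial>D)\<^sup>2"
proof -
  let ?a = "\<integral>x. (h x)\<^sup>2 \<partial>D" and ?b = "(\<integral>x. h x \<partial>D)\<^sup>2"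
  have "(\<integral>\<omega>. (\<Sum>i\<in>{1..n}. h (X i \<omega>))\<^sup>2 \<partial>M) = (\<Sum>i\<in>{1..n}. \<Sum>j\<in>{1..n}. \<integral>\<omega>. h (X i \<omega>) * h (X j \<omega>) \<partial>M)"
    unfolding power2_eq_square sum_product
    by (simp add: integrable_sum_law(2)[OF assms])
  also have "\<dots> = (\<Sum>i\<in>{1..n}. \<Sum>j\<in>{1..n}. ?b + (if i = j then ?a - ?b else 0))"
    by (intro sum.cong refl) (simp add: integral_mult_law[OF assms])
  also have "\<dots> = real n * (real n * ?b + (?a - ?b))"
    by (simp add: sum.distrib)
  finally show ?thesis by (simp add: power2_eq_square algebra_simps)
qed

text \<open>Chebyshev, with the variance enlarged to n times the second moment; for weights in
  [0, 1] this is in turn at most n times the mean.\<close>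

lemma sum_deviation:
  fixes h :: "'b \<Rightarrow> real"
  assumes [measurable]: "h \<in> borel_measurable borel" and c: "AE x in D. \<bar>h x\<bar> \<le> c" and a: "a > 0"
  shows "prob {\<omega>\<in>space M. a \<le> \<bar>(\<Sum>i\<in>{1..n}. h (X i \<omega>)) - real n * (\<integral>x. h x \<partial>D)\<bar>}
    \<le> real n * (\<integral>x. (h x)\<^sup>2 \<partial>D) / a\<^sup>2"
proof -
  let ?S = "\<lambda>\<omega>. \<Sum>i\<in>{1..n}. h (X i \<omega>)"
  have E: "expectation ?S = real n * (\<integral>x. h x \<partial>D)"
    using integrable_sum_law(1)[OF assms(1,2)] by (simp add: integral_law)
  have "prob {\<omega>\<in>space M. a \<le> \<bar>?S \<omega> - expectation ?S\<bar>} \<le> variance ?S / a\<^sup>2"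
    using integrable_sum_law(3)[OF assms(1,2), of n] a by (intro Chebyshev_inequality) auto
  also have "variance ?S = expectation (\<lambda>\<omega>. (?S \<omega>)\<^sup>2) - (expectation ?S)\<^sup>2"
    using integrable_sum_law[OF assms(1,2)] by (intro variance_eq) auto
  also have "\<dots> = real n * (\<integral>x. (h x)\<^sup>2 \<partial>D) - real n * (\<integral>x. h x \<partial>D)\<^sup>2"
    unfolding sum_second_moment[OF assms(1,2)] E by (simp add: power2_eq_square algebra_simps)
  also have "\<dots> / a\<^sup>2 \<le> real n * (\<integral>x. (h x)\<^sup>2 \<partial>D) / a\<^sup>2"
    by (intro divide_right_mono) auto
  finally show ?thesis unfolding E .
qed

text \<open>Rows are i.i.d., so everything depends on n (\<open>\<phi> n\<close> - 1). The cubic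
  Taylor remainder is at most \<open>c n / 6\<close> times the second moment, so the vanishing
  supremum acts as a Lindeberg condition. The variables are not centred: with means of order 1 / n,
  second moment and variance have the same limit after multiplication by n. For \<kappa> = 0 the
  limit is degenerate, which gives laws of large numbers.\<close>

lemma char_triangular_array:
  fixes h :: "nat \<Rightarrow> 'b \<Rightarrow> real"
  assumes h [measurable]: "\<And>n. h n \<in> borel_measurable borel"
    and c: "\<And>n. AE x in D. \<bar>h n x\<bar> \<le> c n" "c \<longlonglongrightarrow> 0"
    and mean: "(\<lambda>n. real n * (\<integral>x. h n x \<partial>D)) \<longlonglongrightarrow> m"
    and var: "(\<lambda>n. real n * (\<integral>x. (h n x)\<^sup>2 \<partial>D)) \<longlonglongrightarrow> \<kappa>"
  shows "(\<lambda>n. CLINT \<omega>|M. cis (\<Sum>i\<in>{1..n}. h n (X i \<omega>))) \<longlonglongrightarrow> cis m * complex_of_real (exp (- \<kappa> / 2))"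
proof -
  interpret D: prob_space D by (rule prob_space_law)
  define \<phi> where "\<phi> n = (CLINT x|D. cis (h n x))" for n
  have cis_sum: "cis (sum f A) = (\<Prod>b\<in>A. cis (f b))" if "finite A" for A :: "nat set" and f
    using that by (induction A) (auto simp: cis_mult[symmetric])
  have eq: "(CLINT \<omega>|M. cis (\<Sum>i\<in>{1..n}. h n (X i \<omega>))) = \<phi> n ^ n" for n
  proof -
    have "indep_vars (\<lambda>_. borel) (\<lambda>i \<omega>. cis (h n (X i \<omega>))) {1..n}"
      by (rule indep_vars_compose2[OF indep_vars_subset[OF X_indep]]) auto
    moreover have "integrable M (\<lambda>\<omega>. cis (h n (X i \<omega>)))" for i
      by (intro integrable_const_bound[where B=1]) auto
    ultimately have "(CLINT \<omega>|M. (\<Prod>i\<in>{1..n}. cis (h n (X i \<omega>)))) = (\<Prod>i\<in>{1..n}. CLINT \<omega>|M. cis (h n (X i \<omega>)))"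
      by (intro indep_vars_lebesgue_integral) auto
    also have "\<dots> = \<phi> n ^ n"
      using integral_law[of "\<lambda>x. cis (h n x)"] by (simp add: \<phi>_def)
    finally show ?thesis by (simp add: cis_sum)
  qed
  have le1: "norm (\<phi> n) \<le> 1" for n
    unfolding \<phi>_def using integral_norm_bound[of D "\<lambda>x. cis (h n x)"] by (simp add: D.prob_space)
  have i1: "integrable D (h n)" for n
    using c(1)[of n] by (intro D.integrable_const_bound[where B="c n"]) auto
  have i2: "integrable D (\<lambda>x. (h n x)\<^sup>2)" for n
  proof (rule D.integrable_const_bound[where B="(c n)\<^sup>2"])
    show "AE x in D. norm ((h n x)\<^sup>2) \<le> (c n)\<^sup>2"
      using c(1)[of n] by eventually_elim (simp add: abs_le_square_iff[symmetric])
  qed measurable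
  define \<psi> where "\<psi> n = 1 + \<i> * of_real (\<integral>x. h n x \<partial>D) - of_real ((\<integral>x. (h n x)\<^sup>2 \<partial>D) / 2)" for n
  have approx: "norm (\<phi> n - \<psi> n) \<le> c n / 6 * (\<integral>x. (h n x)\<^sup>2 \<partial>D)" for n
  proof -
    let ?q = "\<lambda>x. 1 + \<i> * complex_of_real (h n x) - complex_of_real ((h n x)\<^sup>2 / 2)"
    have iz: "integrable D (\<lambda>x. complex_of_real ((h n x)\<^sup>2 / 2))"
      using i2[of n] by (intro integrable_of_real) simp
    have il: "integrable D (\<lambda>x. 1 + \<i> * complex_of_real (h n x))"
      using i1[of n] by (intro Bochner_Integration.integrable_add integrable_mult_right integrable_of_real) auto
    have iq: "integrable D ?q"
      by (intro Bochner_Integration.integrable_diff il iz)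
    have ic: "integrable D (\<lambda>x. cis (h n x))"
      by (intro D.integrable_const_bound[where B=1]) auto
    have "integral\<^sup>L D ?q = \<psi> n"
    proof -
      have "integral\<^sup>L D ?q = (CLINT x|D. 1 + \<i> * complex_of_real (h n x)) - (CLINT x|D. complex_of_real ((h n x)\<^sup>2 / 2))"
        by (rule Bochner_Integration.integral_diff[OF il iz])
      also have "(CLINT x|D. complex_of_real ((h n x)\<^sup>2 / 2)) = of_real ((\<integral>x. (h n x)\<^sup>2 \<partial>D) / 2)"
        by (simp only: integral_complex_of_real integral_divide_zero)
      also have "(CLINT x|D. 1 + \<i> * complex_of_real (h n x)) = 1 + \<i> * of_real (\<integral>x. h n x \<partial>D)"
        using i1[of n] D.prob_space by simp
      also have "1 + \<i> * of_real (\<integral>x. h n x \<partial>D) - of_real ((\<integral>x. (h n x)\<^sup>2 \<partial>D) / 2) = \<psi> n"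
        by (simp only: \<psi>_def)
      finally show ?thesis .
    qed
    then have "\<phi> n - \<psi> n = (CLINT x|D. cis (h n x) - ?q x)"
      using iq ic by (simp add: \<phi>_def)
    also have "norm \<dots> \<le> (\<integral>x. norm (cis (h n x) - ?q x) \<partial>D)"
      by (rule integral_norm_bound)
    also have "\<dots> \<le> (\<integral>x. c n / 6 * (h n x)\<^sup>2 \<partial>D)"
    proof (rule integral_mono_AE)
      show "AE x in D. norm (cis (h n x) - ?q x) \<le> c n / 6 * (h n x)\<^sup>2"
        using c(1)[of n]
      proof eventually_elim
        case (elim x)
        have "norm (cis (h n x) - ?q x) \<le> \<bar>h n x\<bar> ^ 3 / 6"
          using norm_cis_taylor2[of "h n x"] by simp
        also have "\<dots> = \<bar>h n x\<bar> * (h n x)\<^sup>2 / 6"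
          by (simp add: power3_eq_cube power2_eq_square abs_mult[symmetric])
        also have "\<dots> \<le> c n * (h n x)\<^sup>2 / 6"
          using elim by (intro divide_right_mono mult_right_mono) auto
        finally show ?case by simp
      qed
    qed (use iq ic i2 in auto)
    also have "\<dots> = c n / 6 * (\<integral>x. (h n x)\<^sup>2 \<partial>D)"
      by simp
    finally show ?thesis .
  qed
  have cv0: "(\<lambda>n. c n / 6 * (real n * (\<integral>x. (h n x)\<^sup>2 \<partial>D))) \<longlonglongrightarrow> 0"
    using tendsto_mult[OF tendsto_divide[OF c(2) tendsto_const[of 6]] var] by simp
  have le: "norm (of_nat n * (\<phi> n - \<psi> n)) \<le> c n / 6 * (real n * (\<integral>x. (h n x)\<^sup>2 \<partial>D))" for n
  proof -
    have "real n * norm (\<phi> n - \<psi> n) \<le> real n * (c n / 6 * (\<integral>x. (h n x)\<^sup>2 \<partial>D))"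
      by (intro mult_left_mono approx) simp
    then show ?thesis
      unfolding norm_mult norm_of_nat by (simp only: mult.left_commute)
  qed
  have 0: "(\<lambda>n. of_nat n * (\<phi> n - \<psi> n)) \<longlonglongrightarrow> 0"
    by (rule Lim_null_comparison[OF always_eventually[OF allI[OF le]] cv0])
  have "(\<lambda>n. \<i> * of_real (real n * (\<integral>x. h n x \<partial>D)) - of_real (real n * (\<integral>x. (h n x)\<^sup>2 \<partial>D) / 2))
      \<longlonglongrightarrow> \<i> * of_real m - of_real (\<kappa> / 2)"
    by (intro tendsto_intros mean var) simp
  from tendsto_add[OF 0 this]
  have "(\<lambda>n. of_nat n * (\<phi> n - \<psi> n) + (\<i> * of_real (real n * (\<integral>x. h n x \<partial>D)) - of_real (real n * (\<integral>x. (h n x)\<^sup>2 \<partial>D) / 2)))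
      \<longlonglongrightarrow> \<i> * of_real m - of_real (\<kappa> / 2)" by simp
  also have "(\<lambda>n. of_nat n * (\<phi> n - \<psi> n) + (\<i> * of_real (real n * (\<integral>x. h n x \<partial>D)) - of_real (real n * (\<integral>x. (h n x)\<^sup>2 \<partial>D) / 2)))
      = (\<lambda>n. of_nat n * (\<phi> n - 1))"
    by (simp add: \<psi>_def algebra_simps)
  finally have lim: "(\<lambda>n. of_nat n * (\<phi> n - 1)) \<longlonglongrightarrow> \<i> * of_real m - of_real (\<kappa> / 2)" .
  have "\<kappa> \<ge> 0"
    using var by (rule LIMSEQ_le_const) auto
  then have "(\<lambda>n. \<phi> n ^ n) \<longlonglongrightarrow> exp (\<i> * of_real m - of_real (\<kappa> / 2))"
    by (intro tendsto_power_exp_complex le1 lim) simp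
  moreover have "exp (\<i> * of_real m - of_real (\<kappa> / 2)) = cis m * complex_of_real (exp (- \<kappa> / 2))"
  proof -
    have "\<i> * complex_of_real m - of_real (\<kappa> / 2) = \<i> * of_real m + of_real (- \<kappa> / 2)"
      by simp
    then show ?thesis
      by (simp only: exp_add cis_conv_exp exp_of_real)
  qed
  ultimately show ?thesis unfolding eq by (simp only:)
qed

end

text \<open>Where \<open>R n\<close> is within \<delta> of 1 the phases differ by at most 2 \<delta>
  |A| \<le> 2 \<delta> (1 + A^2); elsewhere the trivial bound 2 is used. The uniform second moment
  bound \<open>K\<close> does the work of tightness.\<close>

lemma (in prob_space) char_slutsky:
  fixes A R :: "nat \<Rightarrow> 'a \<Rightarrow> real"
  assumes [measurable]: "\<And>n. A n \<in> borel_measurable M" "\<And>n. R n \<in> borel_measurable M"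
    and A2: "\<And>n. integrable M (\<lambda>\<omega>. (A n \<omega>)\<^sup>2)" "\<And>n. (\<integral>\<omega>. (A n \<omega>)\<^sup>2 \<partial>M) \<le> K"
    and R: "\<And>\<delta>. \<delta> > 0 \<Longrightarrow> (\<lambda>n. prob {\<omega>\<in>space M. \<delta> \<le> \<bar>R n \<omega> - 1\<bar>}) \<longlonglongrightarrow> 0"
    and ch: "(\<lambda>n. CLINT \<omega>|M. cis (A n \<omega>)) \<longlonglongrightarrow> z"
  shows "(\<lambda>n. CLINT \<omega>|M. cis (A n \<omega> / R n \<omega>)) \<longlonglongrightarrow> z"
proof -
  let ?P = "\<lambda>\<delta> n. prob {\<omega>\<in>space M. \<delta> \<le> \<bar>R n \<omega> - 1\<bar>}"
  have K0: "K \<ge> 0"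
  proof -
    have "0 \<le> (\<integral>\<omega>. (A 0 \<omega>)\<^sup>2 \<partial>M)" by simp
    with A2(2)[of 0] show ?thesis by linarith
  qed
  have bound: "norm ((CLINT \<omega>|M. cis (A n \<omega> / R n \<omega>)) - (CLINT \<omega>|M. cis (A n \<omega>))) \<le> 2 * ?P \<delta> n + 2 * \<delta> * (1 + K)"
    if \<delta>: "0 < \<delta>" "\<delta> \<le> 1 / 2" for \<delta> n
  proof -
    let ?B = "{\<omega>\<in>space M. \<delta> \<le> \<bar>R n \<omega> - 1\<bar>}"
    have i: "integrable M (\<lambda>\<omega>. cis (A n \<omega> / R n \<omega>))" "integrable M (\<lambda>\<omega>. cis (A n \<omega>))"
      by (intro integrable_const_bound[where B=1]; simp)+
    have iB: "integrable M (indicator ?B :: 'a \<Rightarrow> real)"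
      by (intro integrable_real_indicator) (auto simp: emeasure_eq_measure)
    have iW: "integrable M (\<lambda>\<omega>. 2 * indicator ?B \<omega> + 2 * \<delta> * (1 + (A n \<omega>)\<^sup>2))"
      using iB A2(1)[of n] by simp
    have "norm ((CLINT \<omega>|M. cis (A n \<omega> / R n \<omega>)) - (CLINT \<omega>|M. cis (A n \<omega>)))
        = norm (CLINT \<omega>|M. cis (A n \<omega> / R n \<omega>) - cis (A n \<omega>))"
      using i by simp
    also have "\<dots> \<le> (\<integral>\<omega>. norm (cis (A n \<omega> / R n \<omega>) - cis (A n \<omega>)) \<partial>M)"
      by (rule integral_norm_bound)
    also have "\<dots> \<le> (\<integral>\<omega>. 2 * indicator ?B \<omega> + 2 * \<delta> * (1 + (A n \<omega>)\<^sup>2) \<partial>M)"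
    proof (rule integral_mono)
      fix \<omega> assume \<omega>: "\<omega> \<in> space M"
      let ?a = "A n \<omega>" and ?r = "R n \<omega>"
      show "norm (cis (?a / ?r) - cis ?a) \<le> 2 * indicator ?B \<omega> + 2 * \<delta> * (1 + ?a\<^sup>2)"
      proof (cases "\<omega> \<in> ?B")
        case True
        have "norm (cis (?a / ?r) - cis ?a) \<le> 2"
          using norm_triangle_ineq4[of "cis (?a / ?r)" "cis ?a"] by simp
        moreover have "0 \<le> 2 * \<delta> * (1 + ?a\<^sup>2)" using \<delta> by simp
        ultimately show ?thesis using True by simp
      next
        case False
        then have r: "\<bar>?r - 1\<bar> < \<delta>" using \<omega> by auto
        then have r2: "?r \<ge> 1 / 2" using \<delta> by linarith
        have "?a / ?r - ?a = - ?a * (?r - 1) / ?r"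
          using r2 by (simp add: field_simps)
        then have "\<bar>?a / ?r - ?a\<bar> = \<bar>?a\<bar> * \<bar>?r - 1\<bar> / ?r"
          using r2 by (simp add: abs_mult)
        also have "\<dots> \<le> \<bar>?a\<bar> * \<delta> / (1 / 2)"
          using r r2 by (intro frac_le mult_left_mono mult_nonneg_nonneg) auto
        also have "\<dots> = 2 * \<delta> * \<bar>?a\<bar>" by simp
        also have "\<dots> \<le> 2 * \<delta> * (1 + ?a\<^sup>2)"
        proof (rule mult_left_mono)
          show "\<bar>?a\<bar> \<le> 1 + ?a\<^sup>2"
            using zero_le_power2[of "\<bar>?a\<bar> - 1"] abs_ge_zero[of ?a] by (simp add: power2_diff)
        qed (use \<delta> in simp)
        finally have "\<bar>?a / ?r - ?a\<bar> \<le> 2 * \<delta> * (1 + ?a\<^sup>2)" .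
        with norm_cis_diff_le[of "?a / ?r" ?a] False show ?thesis by simp
      qed
    qed (use i iW in auto)
    also have "\<dots> = 2 * ?P \<delta> n + 2 * \<delta> * (1 + (\<integral>\<omega>. (A n \<omega>)\<^sup>2 \<partial>M))"
      using iB A2(1)[of n] by (simp add: prob_space)
    also have "\<dots> \<le> 2 * ?P \<delta> n + 2 * \<delta> * (1 + K)"
      using A2(2)[of n] \<delta> by (intro add_left_mono mult_left_mono) auto
    finally show ?thesis .
  qed
  have "(\<lambda>n. (CLINT \<omega>|M. cis (A n \<omega> / R n \<omega>)) - (CLINT \<omega>|M. cis (A n \<omega>))) \<longlonglongrightarrow> 0"
  proof (rule tendstoI)
    fix e :: real assume e: "e > 0"
    \<comment> \<open>The entry 1 / 2 keeps \<open>R n\<close> away from 0; the other makes the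
      moment term at most \<open>e / 2\<close>, leaving \<open>e / 2\<close> for twice the
      probability.\<close>
    define \<delta> where "\<delta> = min (1 / 2) (e / (4 * (1 + K)))"
    have \<delta>: "0 < \<delta>" "\<delta> \<le> 1 / 2" "2 * \<delta> * (1 + K) \<le> e / 2"
    proof -
      show "0 < \<delta>" using e K0 by (simp add: \<delta>_def)
      show "\<delta> \<le> 1 / 2" unfolding \<delta>_def by (rule min.cobounded1)
      have "\<delta> \<le> e / (4 * (1 + K))" by (simp add: \<delta>_def)
      then show "2 * \<delta> * (1 + K) \<le> e / 2"
        using K0 by (simp add: field_simps)
    qed
    have "\<forall>\<^sub>F n in sequentially. ?P \<delta> n < e / 4"
      using R[OF \<delta>(1)] e by (intro order_tendstoD(2)) auto
    then show "\<forall>\<^sub>F n in sequentially. dist ((CLINT \<omega>|M. cis (A n \<omega> / R n \<omega>)) - (CLINT \<omega>|M. cis (A n \<omega>))) 0 < e"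
    proof eventually_elim
      case (elim n)
      with bound[OF \<delta>(1,2), of n] \<delta>(3) show ?case
        unfolding dist_0_norm dist_norm by simp
    qed
  qed
  from tendsto_add[OF this ch] show ?thesis by simp
qed

section \<open>Convergence criteria and degenerate Gaussian laws\<close>

lemma conv_in_distr_charI:
  fixes Y :: "nat \<Rightarrow> 'a \<Rightarrow> 'b::euclidean_space"
  assumes "prob_space M" and Y [measurable]: "\<And>n. Y n \<in> borel_measurable M"
    and \<mu>: "prob_space \<mu>" "sets \<mu> = sets borel"
    and ch: "\<And>t. (\<lambda>n. CLINT \<omega>|M. cis (t \<bullet> Y n \<omega>)) \<longlonglongrightarrow> (CLINT x|\<mu>. cis (t \<bullet> x))"
  shows "conv_in_distr M Y \<mu>"
  unfolding conv_in_distr_def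
proof (intro allI impI, elim conjE)
  interpret prob_space M by fact
  fix f :: "'b \<Rightarrow> real" assume f: "continuous_on UNIV f" "bounded (range f)"
  then have [measurable]: "f \<in> borel_measurable borel"
    by (intro borel_measurable_continuous_onI)
  have "(\<lambda>n. integral\<^sup>L (distr M borel (Y n)) f) \<longlonglongrightarrow> integral\<^sup>L \<mu> f"
    by (rule levy_continuity_euclidean) (use ch f \<mu> in \<open>simp_all add: prob_space_distr integral_distr\<close>)
  then show "(\<lambda>n. \<integral>\<omega>. f (Y n \<omega>) \<partial>M) \<longlonglongrightarrow> integral\<^sup>L \<mu> f"
    by (simp add: integral_distr)
qed

text \<open>The limit is a point mass, so convergence of characteristic functions gives convergence
  in law. The bounded continuous test function \<open>min e (dist x c)\<close> then controls the
  tail by Markov's inequality.\<close>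

lemma conv_in_prob_charI:
  fixes Y :: "nat \<Rightarrow> 'a \<Rightarrow> 'b::euclidean_space"
  assumes "prob_space M" and Y [measurable]: "\<And>n. Y n \<in> borel_measurable M"
    and ch: "\<And>t. (\<lambda>n. CLINT \<omega>|M. cis (t \<bullet> Y n \<omega>)) \<longlonglongrightarrow> cis (t \<bullet> c)"
  shows "conv_in_prob M Y c"
  unfolding conv_in_prob_def
proof (intro allI impI)
  interpret prob_space M by fact
  fix e :: real assume e: "e > 0"
  let ?f = "\<lambda>x. min e (dist x c)"
  have cd: "conv_in_distr M Y (return borel c)"
    by (rule conv_in_distr_charI) (use ch in \<open>simp_all add: \<open>prob_space M\<close> prob_space_return integral_return\<close>)
  have cont: "continuous_on UNIV ?f" "bounded (range ?f)"
    using e by (auto intro!: continuous_intros boundedI[where B=e])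
  have [measurable]: "?f \<in> borel_measurable borel"
    using cont(1) by (rule borel_measurable_continuous_onI)
  have "(\<lambda>n. \<integral>\<omega>. ?f (Y n \<omega>) \<partial>M) \<longlonglongrightarrow> integral\<^sup>L (return borel c) ?f"
    using cd cont unfolding conv_in_distr_def by blast
  then have lim: "(\<lambda>n. (\<integral>\<omega>. ?f (Y n \<omega>) \<partial>M) / e) \<longlonglongrightarrow> 0"
    using e by (intro tendsto_divide_zero) (simp add: integral_return)
  have "norm (measure M {\<omega>\<in>space M. dist (Y n \<omega>) c > e}) \<le> (\<integral>\<omega>. ?f (Y n \<omega>) \<partial>M) / e" for n
  proof -
    let ?B = "{\<omega>\<in>space M. dist (Y n \<omega>) c > e}"
    have "e * measure M ?B = (\<integral>\<omega>. e * indicator ?B \<omega> \<partial>M)"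
      by (simp add: Int_def conj_commute)
    also have "\<dots> \<le> (\<integral>\<omega>. ?f (Y n \<omega>) \<partial>M)"
    proof (rule integral_mono)
      show "integrable M (\<lambda>\<omega>. e * indicator ?B \<omega>)"
        by (intro integrable_mult_right integrable_real_indicator) (auto simp: emeasure_eq_measure)
      show "integrable M (\<lambda>\<omega>. ?f (Y n \<omega>))"
        using e by (intro integrable_const_bound[where B=e]) auto
      show "e * indicator ?B \<omega> \<le> ?f (Y n \<omega>)" for \<omega>
        using e by (simp add: indicator_def)
    qed
    finally show ?thesis using e by (simp add: field_simps)
  qed
  then show "(\<lambda>n. measure M {\<omega>\<in>space M. dist (Y n \<omega>) c > e}) \<longlonglongrightarrow> 0"
    using lim by (rule Lim_null_comparison[OF always_eventually[OF allI]])
qed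

lemma tang_proj_mult: "tang_proj q *v s = s - (q \<bullet> s) *\<^sub>R q"
proof -
  have "(\<chi> i j. q $ i * q $ j) *v s = (q \<bullet> s) *\<^sub>R q"
    by (simp add: vec_eq_iff matrix_vector_mult_def inner_vec_def sum_distrib_left mult_ac)
  then show ?thesis
    by (simp add: tang_proj_def matrix_vector_mult_diff_rdistrib)
qed

text \<open>\<open>t v* V\<close> is the transpose of \<open>V\<close> applied to \<open>t\<close>;
  for a unit vector \<open>q\<close> the covariance form is thus a squared tangential length, the
  shape in which the second moments arrive. The scalars \<open>a\<close> and \<open>c\<close> stand
  for the power of \<tau> and for \<open>c_d / \<rho> q\<close>.\<close>

lemma quadratic_form_tangent:
  fixes V :: "real ^ 'd ^ 'd"
  shows "t \<bullet> ((a *\<^sub>R (V ** (c *\<^sub>R tang_proj q) ** transpose V)) *v t)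
    = a * c * ((t v* V) \<bullet> (t v* V) - (q \<bullet> (t v* V))\<^sup>2)"
proof -
  let ?w = "t v* V"
  have "t \<bullet> ((a *\<^sub>R (V ** (c *\<^sub>R tang_proj q) ** transpose V)) *v t) = a * (?w \<bullet> (c *\<^sub>R (tang_proj q *v ?w)))"
    by (simp add: scaleR_matrix_vector_assoc[symmetric] matrix_vector_mul_assoc[symmetric] dot_lmul_matrix
        matrix_vector_mult_scaleR)
  then show ?thesis
    by (simp add: tang_proj_mult inner_diff_right power2_eq_square inner_commute)
qed

text \<open>The witness is an affine image of \<open>std_gauss\<close> with linear part sqrt k V
  P_q; since P_q is an orthogonal projection, its covariance is k V P_q V^T, possibly singular.
  \<open>gaussian_law\<close> sees \<open>C\<close> through its quadratic form, hence the shape of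
  the hypothesis.\<close>

lemma gaussian_law_tangent:
  fixes V C :: "real ^ 'd ^ 'd"
  assumes q: "norm q = 1" and k: "k \<ge> 0"
    and C: "\<And>t. t \<bullet> (C *v t) = k * ((t v* V) \<bullet> (t v* V) - (q \<bullet> (t v* V))\<^sup>2)"
  obtains \<mu> where "gaussian_law m C \<mu>"
proof -
  interpret G: prob_space "std_gauss :: (real ^ 'd) measure" by (rule prob_space_std_gauss)
  let ?f = "\<lambda>x. m + sqrt k *\<^sub>R (V *v (x - (q \<bullet> x) *\<^sub>R q))"
  have qq: "q \<bullet> q = 1" using q by (simp add: norm_eq_1)
  have [measurable]: "(\<lambda>x. V *v x) \<in> borel_measurable borel"
    by (intro borel_measurable_continuous_onI linear_continuous_on) (simp add: linear_conv_bounded_linear[symmetric])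
  have [measurable]: "?f \<in> borel_measurable borel" by measurable
  have "(CLINT x|distr std_gauss borel ?f. cis (t \<bullet> x)) = cis (t \<bullet> m) * complex_of_real (exp (- (t \<bullet> (C *v t)) / 2))" for t
  proof -
    let ?w = "t v* V"
    let ?u = "sqrt k *\<^sub>R (?w - (q \<bullet> ?w) *\<^sub>R q)"
    have "t \<bullet> ?f x = t \<bullet> m + ?u \<bullet> x" for x
      by (simp add: inner_add_right dot_lmul_matrix[symmetric] inner_diff_left inner_diff_right inner_commute algebra_simps)
    then have "(CLINT x|distr std_gauss borel ?f. cis (t \<bullet> x)) = (CLINT x|std_gauss. cis (t \<bullet> m) * cis (?u \<bullet> x))"
      by (subst integral_distr) (simp_all add: cis_mult)
    also have "\<dots> = cis (t \<bullet> m) * complex_of_real (exp (- (norm ?u)\<^sup>2 / 2))"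
      by (simp only: integral_mult_right_zero char_std_gauss)
    also have "(norm ?u)\<^sup>2 = t \<bullet> (C *v t)"
    proof -
      have "(norm ?u)\<^sup>2 = (sqrt k * sqrt k) * ((?w - (q \<bullet> ?w) *\<^sub>R q) \<bullet> (?w - (q \<bullet> ?w) *\<^sub>R q))"
        unfolding power2_norm_eq_inner inner_scaleR_left inner_scaleR_right by (simp only: mult.assoc)
      also have "(?w - (q \<bullet> ?w) *\<^sub>R q) \<bullet> (?w - (q \<bullet> ?w) *\<^sub>R q) = ?w \<bullet> ?w - (q \<bullet> ?w)\<^sup>2"
        by (simp add: inner_diff_left inner_diff_right qq inner_commute power2_eq_square)
      finally show ?thesis unfolding C using k by simp
    qed
    finally show ?thesis .
  qed
  then show ?thesis
    by (intro that[of "distr std_gauss borel ?f"]) (simp add: gaussian_law_def G.prob_space_distr)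
qed

section \<open>The attention output at a fixed query\<close>

text \<open>\<open>\<beta>_small\<close> is the growth condition on \<beta> raised to the power 1 /
  \<alpha>; by \<open>mass_limit\<close> it means that n times the mean weight tends to
  infinity.\<close>

locale attention_model =
  iid_sample M X D + sphere_density q \<rho> g B
  for M :: "'a measure" and X :: "nat \<Rightarrow> 'a \<Rightarrow> real ^ 'd" and D :: "(real ^ 'd) measure"
    and q :: "real ^ 'd" and \<rho> :: "real ^ 'd \<Rightarrow> real" and g :: "real ^ 'd" and B :: real +
  fixes \<beta> :: "nat \<Rightarrow> real" and V :: "real ^ 'd ^ 'd"
  assumes law: "D = density sphere_surface (\<lambda>x. ennreal (\<rho> x))"
    and \<rho>_nonneg: "\<And>x. norm x = 1 \<Longrightarrow> \<rho> x \<ge> 0" and \<rho>_pos: "\<rho> q > 0"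
    and \<beta>_pos: "\<And>n. \<beta> n > 0" and \<beta>_inf: "filterlim \<beta> at_top sequentially"
    and \<beta>_small: "(\<lambda>n. \<beta> n powr ((real CARD('d) - 1) / 2) / real n) \<longlonglongrightarrow> 0"
begin

text \<open>The mean weight is of order \<open>1 / bp n\<close>, so \<open>real n / bp n\<close> is
  the order of the effective sample size near \<open>q\<close>.\<close>

definition bp :: "nat \<Rightarrow> real" where
  "bp n = \<beta> n powr ((real CARD('d) - 1) / 2)"

definition wt :: "nat \<Rightarrow> real ^ 'd \<Rightarrow> real" where
  "wt n x = exp (- \<beta> n * (1 - q \<bullet> x))"

definition pn :: "nat \<Rightarrow> real" where
  "pn n = integral\<^sup>L D (wt n)"

lemma borel_measurable_wt [measurable]: "wt n \<in> borel_measurable borel"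
  unfolding wt_def by measurable

lemma bp_pos: "bp n > 0"
  using \<beta>_pos[of n] by (simp add: bp_def)

lemma integral_D:
  fixes f :: "real ^ 'd \<Rightarrow> real"
  assumes [measurable]: "f \<in> borel_measurable borel"
  shows "integral\<^sup>L D f = (\<integral>x. \<rho> x * f x \<partial>sphere_surface)"
  unfolding law
proof (subst integral_density)
  show "AE x in sphere_surface. 0 \<le> \<rho> x"
    using AE_sphere_surface by eventually_elim (simp add: \<rho>_nonneg)
qed auto

lemma AE_D: "AE x in D. norm x = 1"
  unfolding law using AE_sphere_surface by (subst AE_density) (auto elim: eventually_mono)

lemma wt_bounds: "norm x = 1 \<Longrightarrow> exp (- 2 * \<beta> n) \<le> wt n x" "norm x = 1 \<Longrightarrow> wt n x \<le> 1"
proof -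
  assume x: "norm x = 1"
  have "0 \<le> 1 - q \<bullet> x" by (rule one_minus_inner_nonneg[OF q x])
  moreover have "1 - q \<bullet> x \<le> 2"
    using Cauchy_Schwarz_ineq2[of q x] q x by simp
  ultimately have "\<beta> n * (1 - q \<bullet> x) \<le> \<beta> n * 2" "0 \<le> \<beta> n * (1 - q \<bullet> x)"
    using \<beta>_pos[of n] by (auto intro: mult_left_mono)
  then show "exp (- 2 * \<beta> n) \<le> wt n x" "wt n x \<le> 1"
    by (auto simp: wt_def)
qed

text \<open>A crude bound from the diameter of the sphere; positivity for every \<open>n\<close>
  licenses the later divisions by \<open>pn n\<close>.\<close>

lemma pn_pos: "pn n > 0"
proof -
  interpret D: prob_space D by (rule prob_space_law)
  have i: "integrable D (wt n)"
  proof (rule D.integrable_const_bound[where B=1])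
    show "AE x in D. norm (wt n x) \<le> 1"
      using AE_D by eventually_elim (use wt_bounds(2) in \<open>simp add: wt_def\<close>)
  qed measurable
  have "exp (- 2 * \<beta> n) \<le> pn n"
    unfolding pn_def
  proof (rule D.integral_ge_const[OF i])
    show "AE x in D. exp (- 2 * \<beta> n) \<le> wt n x"
      using AE_D by eventually_elim (rule wt_bounds(1))
  qed
  then show ?thesis
    using exp_gt_zero[of "- 2 * \<beta> n"] by linarith
qed

lemma mass_limit: "(\<lambda>n. bp n * pn n) \<longlonglongrightarrow> sqrt (2 * pi) ^ (CARD('d) - 1) * \<rho> q"
  using laplace_mass[OF \<beta>_pos \<beta>_inf] by (simp add: bp_def pn_def integral_D wt_def)

lemma first_moment_limit:
  "(\<lambda>n. bp n * (\<beta> n * (\<integral>x. (w \<bullet> (x - q)) * wt n x \<partial>D)))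
    \<longlonglongrightarrow> sqrt (2 * pi) ^ (CARD('d) - 1) * (w \<bullet> (g - (q \<bullet> g) *\<^sub>R q) - \<rho> q * ((real CARD('d) - 1) / 2) * (q \<bullet> w))"
proof -
  have "\<beta> n * (\<integral>x. (w \<bullet> (x - q)) * wt n x \<partial>D)
    = (\<integral>x. \<beta> n * (w \<bullet> (x - q)) * (\<rho> x * exp (- \<beta> n * (1 - q \<bullet> x))) \<partial>sphere_surface)" for n
    unfolding wt_def
    by (subst integral_D, simp, subst integral_mult_right_zero[symmetric]) (simp only: mult_ac)
  then show ?thesis
    unfolding bp_def using laplace_first_moment[OF \<beta>_pos \<beta>_inf, of w] by (simp only:)
qed

text \<open>Squaring the weight replaces \<beta> by 2 \<beta>, so
  \<open>laplace_second_moment\<close> is applied to the doubled sequence. The resulting powers of 2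
  reappear in \<open>c_d\<close>.\<close>

lemma second_moment_limit:
  "(\<lambda>n. 2 powr ((real CARD('d) - 1) / 2) * bp n * (2 * \<beta> n * (\<integral>x. ((w \<bullet> (x - q)) * wt n x)\<^sup>2 \<partial>D)))
    \<longlonglongrightarrow> sqrt (2 * pi) ^ (CARD('d) - 1) * (\<rho> q * (w \<bullet> w - (q \<bullet> w)\<^sup>2))"
proof -
  have 2: "2 * \<beta> n > 0" for n using \<beta>_pos by simp
  have inf: "filterlim (\<lambda>n. 2 * \<beta> n) at_top sequentially"
    by (rule filterlim_tendsto_pos_mult_at_top[OF tendsto_const _ \<beta>_inf]) simp
  have wt2: "(wt n x)\<^sup>2 = exp (- (2 * \<beta> n) * (1 - q \<bullet> x))" for n x
    unfolding wt_def exp_double[symmetric] by simp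
  have "2 * \<beta> n * (\<integral>x. ((w \<bullet> (x - q)) * wt n x)\<^sup>2 \<partial>D)
    = (\<integral>x. 2 * \<beta> n * (w \<bullet> (x - q))\<^sup>2 * (\<rho> x * exp (- (2 * \<beta> n) * (1 - q \<bullet> x))) \<partial>sphere_surface)" for n
    unfolding power_mult_distrib wt2
    by (subst integral_D, simp, subst integral_mult_right_zero[symmetric]) (simp only: mult_ac)
  moreover have "2 powr ((real CARD('d) - 1) / 2) * bp n = (2 * \<beta> n) powr ((real CARD('d) - 1) / 2)" for n
    using \<beta>_pos[of n] by (simp add: bp_def powr_mult)
  ultimately show ?thesis
    using laplace_second_moment[OF 2 inf, of w] by (simp only:)
qed

lemma Zn_eq: "Zn \<beta> q X n \<omega> = (\<Sum>i\<in>{1..n}. wt n (X i \<omega>))"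
  by (simp add: Zn_def Tq_def wt_def)

lemma Zn_pos: "n > 0 \<Longrightarrow> Zn \<beta> q X n \<omega> > 0"
  unfolding Zn_def by (intro sum_pos) auto

lemma borel_measurable_ATT [measurable]: "ATT V \<beta> q X n \<in> borel_measurable M"
proof -
  have [measurable]: "(\<lambda>x. V *v x) \<in> borel_measurable borel"
    by (intro borel_measurable_continuous_onI linear_continuous_on) (simp add: linear_conv_bounded_linear[symmetric])
  show ?thesis
    unfolding ATT_def[abs_def] Aw_def Zn_def Tq_def by measurable
qed

lemma borel_measurable_Ycal_n [measurable]: "Ycal_n V \<beta> q X n \<in> borel_measurable M"
  unfolding Ycal_n_def[abs_def] by measurable

text \<open>The attention weights sum to 1, so \<open>q\<close> can be subtracted inside the sum.
  For \<open>n = 0\<close> the sum is empty and the output error is the constant - V q.\<close>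

lemma inner_Ycal_n:
  assumes "n > 0"
  shows "t \<bullet> Ycal_n V \<beta> q X n \<omega>
    = (\<Sum>i\<in>{1..n}. ((t v* V) \<bullet> (X i \<omega> - q)) * wt n (X i \<omega>)) / Zn \<beta> q X n \<omega>"
proof -
  let ?w = "t v* V" and ?Z = "Zn \<beta> q X n \<omega>"
  have Z: "?Z \<noteq> 0" using Zn_pos[OF assms, of \<omega>] by simp
  have A: "Aw \<beta> q X n i \<omega> = wt n (X i \<omega>) / ?Z" for i
    by (simp add: Aw_def Tq_def wt_def)
  have "(\<Sum>i\<in>{1..n}. Aw \<beta> q X n i \<omega>) = 1"
    using Z by (simp add: A Zn_eq sum_divide_distrib[symmetric])
  then have "q = (\<Sum>i\<in>{1..n}. Aw \<beta> q X n i \<omega> *\<^sub>R q)"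
    by (simp add: scaleR_sum_left[symmetric])
  then have "(\<Sum>i\<in>{1..n}. Aw \<beta> q X n i \<omega> *\<^sub>R X i \<omega>) - q = (\<Sum>i\<in>{1..n}. Aw \<beta> q X n i \<omega> *\<^sub>R (X i \<omega> - q))"
    by (simp add: scaleR_diff_right sum_subtractf)
  moreover have "t \<bullet> Ycal_n V \<beta> q X n \<omega> = ?w \<bullet> ((\<Sum>i\<in>{1..n}. Aw \<beta> q X n i \<omega> *\<^sub>R X i \<omega>) - q)"
    by (simp add: Ycal_n_def ATT_def inner_diff_right dot_lmul_matrix)
  ultimately show ?thesis
    by (simp add: inner_sum_right A sum_divide_distrib mult.commute)
qed

text \<open>Weights lie in [0, 1], so their second moment is at most their mean and Chebyshev gives
  the bound 1 / (\<delta>^2 n \<open>pn n\<close>). Multiplying numerator and denominator by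
  \<open>bp n\<close> exposes two known limits.\<close>

lemma normalization_limit:
  assumes \<delta>: "\<delta> > 0"
  shows "(\<lambda>n. prob {\<omega>\<in>space M. \<delta> \<le> \<bar>Zn \<beta> q X n \<omega> / (real n * pn n) - 1\<bar>}) \<longlonglongrightarrow> 0"
proof -
  interpret D: prob_space D by (rule prob_space_law)
  let ?P = "\<lambda>n. prob {\<omega>\<in>space M. \<delta> \<le> \<bar>Zn \<beta> q X n \<omega> / (real n * pn n) - 1\<bar>}"
  have K: "sqrt (2 * pi) ^ (CARD('d) - 1) * \<rho> q > 0" using \<rho>_pos by simp
  have lim: "(\<lambda>n. (bp n / real n) / (\<delta>\<^sup>2 * (bp n * pn n))) \<longlonglongrightarrow> 0"
  proof -
    have "(\<lambda>n. (bp n / real n) / (\<delta>\<^sup>2 * (bp n * pn n))) \<longlonglongrightarrow> 0 / (\<delta>\<^sup>2 * (sqrt (2 * pi) ^ (CARD('d) - 1) * \<rho> q))"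
      using \<rho>_pos \<delta> by (intro tendsto_divide tendsto_mult[OF tendsto_const mass_limit] \<beta>_small[folded bp_def]) simp
    then show ?thesis by (simp only: div_0)
  qed
  have c: "AE x in D. \<bar>wt n x\<bar> \<le> 1" for n
    using AE_D by eventually_elim (use wt_bounds(2) in \<open>simp add: wt_def\<close>)
  have ev: "\<forall>\<^sub>F n in sequentially. norm (?P n) \<le> (bp n / real n) / (\<delta>\<^sup>2 * (bp n * pn n))"
    using eventually_gt_at_top[of 0]
  proof eventually_elim
    case (elim n)
    have np: "real n * pn n > 0" using elim pn_pos[of n] by simp
    have "\<delta> \<le> \<bar>z / (real n * pn n) - 1\<bar> \<longleftrightarrow> \<delta> * (real n * pn n) \<le> \<bar>z - real n * pn n\<bar>" for z
    proof -
      have "z / (real n * pn n) - 1 = (z - real n * pn n) / (real n * pn n)"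
        using np elim pn_pos[of n] by (simp add: diff_divide_distrib)
      then have "\<bar>z / (real n * pn n) - 1\<bar> = \<bar>z - real n * pn n\<bar> / (real n * pn n)"
        using np by (simp only: abs_divide abs_of_pos)
      then show ?thesis using np by (simp only: pos_le_divide_eq)
    qed
    then have "?P n = prob {\<omega>\<in>space M. \<delta> * (real n * pn n) \<le> \<bar>(\<Sum>i\<in>{1..n}. wt n (X i \<omega>)) - real n * integral\<^sup>L D (wt n)\<bar>}"
      by (simp only: Zn_eq pn_def)
    also have "\<dots> \<le> real n * (\<integral>x. (wt n x)\<^sup>2 \<partial>D) / (\<delta> * (real n * pn n))\<^sup>2"
      using \<delta> np by (intro sum_deviation[OF borel_measurable_wt c]) (rule mult_pos_pos)
    also have "\<dots> \<le> real n * pn n / (\<delta> * (real n * pn n))\<^sup>2"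
    proof (intro divide_right_mono mult_left_mono)
      show "(\<integral>x. (wt n x)\<^sup>2 \<partial>D) \<le> pn n"
        unfolding pn_def
      proof (rule integral_mono_AE)
        show "integrable D (wt n)"
          using c by (intro D.integrable_const_bound[where B=1]) auto
        show "integrable D (\<lambda>x. (wt n x)\<^sup>2)"
          using c[of n] by (intro D.integrable_const_bound[where B=1]) (auto elim!: eventually_mono simp: abs_square_le_1)
        show "AE x in D. (wt n x)\<^sup>2 \<le> wt n x"
          using AE_D by eventually_elim (use wt_bounds(2) in \<open>simp add: power2_eq_square wt_def mult_left_le\<close>)
      qed
    qed auto
    also have "\<dots> = (bp n / real n) / (\<delta>\<^sup>2 * (bp n * pn n))"
      using elim pn_pos[of n] bp_pos[of n] \<delta> by (simp add: power2_eq_square field_simps)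
    finally show ?case by simp
  qed
  show ?thesis
    by (rule Lim_null_comparison[OF ev lim])
qed

text \<open>With u the exponent, Cauchy-Schwarz and the chord identity leave u exp (- 2 u) \<le> 1,
  so each summand is uniformly of order \<beta>^(- 1 / 2). This feeds the vanishing supremum in
  \<open>char_triangular_array\<close>.\<close>

lemma summand_bound:
  assumes x: "norm x = 1"
  shows "((w \<bullet> (x - q)) * wt n x)\<^sup>2 \<le> 2 * (w \<bullet> w) / \<beta> n"
proof -
  let ?u = "\<beta> n * (1 - q \<bullet> x)"
  have u: "?u \<ge> 0" using one_minus_inner_nonneg[OF q x] \<beta>_pos[of n] by simp
  have 1: "(w \<bullet> (x - q))\<^sup>2 \<le> (w \<bullet> w) * (2 * (1 - q \<bullet> x))"
    using Cauchy_Schwarz_ineq[of w "x - q"] norm_diff_unit[OF q x] by (simp only: power2_norm_eq_inner)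
  have "?u * (wt n x)\<^sup>2 = (?u * exp (- ?u)) * exp (- ?u)"
    by (simp add: wt_def power2_eq_square)
  also have "\<dots> \<le> 1 * 1"
  proof (rule mult_mono)
    have "?u * exp (- ?u) \<le> exp (- ?u / 2)" by (rule mult_exp_minus_le[OF u])
    also have "\<dots> \<le> 1" using u by simp
    finally show "?u * exp (- ?u) \<le> 1" .
  qed (use u in auto)
  finally have 2: "?u * (wt n x)\<^sup>2 \<le> 1" by simp
  have "\<beta> n * ((w \<bullet> (x - q)) * wt n x)\<^sup>2 = \<beta> n * ((w \<bullet> (x - q))\<^sup>2 * (wt n x)\<^sup>2)"
    by (simp add: power_mult_distrib)
  also have "\<dots> \<le> \<beta> n * (((w \<bullet> w) * (2 * (1 - q \<bullet> x))) * (wt n x)\<^sup>2)"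
    using \<beta>_pos[of n] by (intro mult_left_mono mult_right_mono 1) auto
  also have "\<dots> = 2 * (w \<bullet> w) * (?u * (wt n x)\<^sup>2)"
    by (simp only: mult_ac)
  also have "\<dots> \<le> 2 * (w \<bullet> w) * 1"
    using 2 by (intro mult_left_mono) auto
  finally show ?thesis
    using \<beta>_pos[of n] by (simp add: field_simps)
qed

text \<open>Written with the ambient gradient \<open>g\<close> of the locale;
  \<open>sph_grad_ln\<close> identifies the first term with the spherical gradient of the
  log-density.\<close>

definition Ylim :: "real ^ 'd" where
  "Ylim = (1 / \<rho> q) *\<^sub>R (g - (q \<bullet> g) *\<^sub>R q) - ((real CARD('d) - 1) / 2) *\<^sub>R q"

text \<open>\<open>m\<close> compares the scaling with the drift scale \<beta>, and
  \<open>\<kappa>\<close> is the limiting variance factor. The scaling \<beta> gives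
  \<open>m = 1\<close>; that of the third regime gives \<open>\<kappa> = 1\<close> and
  \<open>m = 0\<close>; the scaling 1 gives 0 for both.\<close>

lemma char_scaled_Ycal_n:
  assumes \<kappa>: "(\<lambda>n. (s n)\<^sup>2 * (bp n / \<beta> n) / real n) \<longlonglongrightarrow> \<kappa>" and m: "(\<lambda>n. s n / \<beta> n) \<longlonglongrightarrow> m"
    and c_d: "c_d = 1 / (sqrt (2 * pi) ^ (CARD('d) - 1) * (2 powr ((real CARD('d) - 1) / 2) * 2))"
  shows "(\<lambda>n. CLINT \<omega>|M. cis (t \<bullet> (s n *\<^sub>R Ycal_n V \<beta> q X n \<omega>)))
    \<longlonglongrightarrow> cis (t \<bullet> (m *\<^sub>R (V *v Ylim)))
      * complex_of_real (exp (- (\<kappa> * (c_d / \<rho> q) * ((t v* V) \<bullet> (t v* V) - (q \<bullet> (t v* V))\<^sup>2)) / 2))"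
proof -
  interpret D: prob_space D by (rule prob_space_law)
  define w where "w = t v* V"
  let ?k2 = "2 powr ((real CARD('d) - 1) / 2) :: real"
  let ?K = "sqrt (2 * pi) ^ (CARD('d) - 1)"
  have Kp: "?K > 0" by simp
  \<comment> \<open>Dividing by n times the mean weight makes the projected, scaled output exactly
    the sum of the \<open>h n\<close> over \<open>R n\<close>, for positive
    \<open>n\<close>.\<close>
  define h where "h n x = s n / (real n * pn n) * ((w \<bullet> (x - q)) * wt n x)" for n x
  have hm [measurable]: "h n \<in> borel_measurable borel" for n
    unfolding h_def by measurable
  \<comment> \<open>The squared bound from \<open>summand_bound\<close>, regrouped into a factor
    converging to \<open>\<kappa>\<close>, the factor \<open>bp n / real n\<close> tending to 0, and
    a denominator with nonzero limit.\<close>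
  define c where "c n = sqrt (2 * (w \<bullet> w) * ((s n)\<^sup>2 * (bp n / \<beta> n) / real n) * (bp n / real n) / (bp n * pn n)\<^sup>2)" for n
  have hc: "AE x in D. \<bar>h n x\<bar> \<le> c n" for n
    using AE_D
  proof eventually_elim
    case (elim x)
    have "(h n x)\<^sup>2 = (s n / (real n * pn n))\<^sup>2 * ((w \<bullet> (x - q)) * wt n x)\<^sup>2"
      by (simp only: h_def power_mult_distrib)
    also have "\<dots> \<le> (s n / (real n * pn n))\<^sup>2 * (2 * (w \<bullet> w) / \<beta> n)"
      by (intro mult_left_mono summand_bound elim) simp
    also have "\<dots> = 2 * (w \<bullet> w) * ((s n)\<^sup>2 * (bp n / \<beta> n) / real n) * (bp n / real n) / (bp n * pn n)\<^sup>2"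
      using bp_pos[of n] pn_pos[of n] by (simp add: power2_eq_square mult_ac)
    finally show ?case
      unfolding c_def by (intro real_le_rsqrt) simp
  qed
  have "(\<lambda>n. 2 * (w \<bullet> w) * ((s n)\<^sup>2 * (bp n / \<beta> n) / real n) * (bp n / real n) / (bp n * pn n)\<^sup>2)
      \<longlonglongrightarrow> 2 * (w \<bullet> w) * \<kappa> * 0 / (?K * \<rho> q)\<^sup>2"
    using Kp \<rho>_pos by (intro tendsto_intros \<kappa> \<beta>_small[folded bp_def] mass_limit) simp
  then have c0: "c \<longlonglongrightarrow> 0"
    unfolding c_def using tendsto_real_sqrt by fastforce
  have mean: "(\<lambda>n. real n * (\<integral>x. h n x \<partial>D)) \<longlonglongrightarrow> m * (w \<bullet> Ylim)"
  proof -
    have "(\<lambda>n. (s n / \<beta> n) * (bp n * (\<beta> n * (\<integral>x. (w \<bullet> (x - q)) * wt n x \<partial>D))) / (bp n * pn n))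
      \<longlonglongrightarrow> m * (?K * (w \<bullet> (g - (q \<bullet> g) *\<^sub>R q) - \<rho> q * ((real CARD('d) - 1) / 2) * (q \<bullet> w))) / (?K * \<rho> q)"
      using Kp \<rho>_pos by (intro tendsto_intros m first_moment_limit mass_limit) simp
    also have "m * (?K * (w \<bullet> (g - (q \<bullet> g) *\<^sub>R q) - \<rho> q * ((real CARD('d) - 1) / 2) * (q \<bullet> w))) / (?K * \<rho> q) = m * (w \<bullet> Ylim)"
    proof -
      have "m * (k * (a - r * b * c)) / (k * r) = m * ((1 / r) * a - b * c)" if "k > 0" "r > 0" for k r a b c :: real
        using that by (simp add: field_simps)
      from this[OF Kp \<rho>_pos] show ?thesis
        by (simp only: Ylim_def inner_diff_right[of w "(1 / \<rho> q) *\<^sub>R _"] inner_scaleR_right inner_commute[of w q])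
    qed
    finally have lim: "(\<lambda>n. (s n / \<beta> n) * (bp n * (\<beta> n * (\<integral>x. (w \<bullet> (x - q)) * wt n x \<partial>D))) / (bp n * pn n)) \<longlonglongrightarrow> m * (w \<bullet> Ylim)" .
    have "\<forall>\<^sub>F n in sequentially. (s n / \<beta> n) * (bp n * (\<beta> n * (\<integral>x. (w \<bullet> (x - q)) * wt n x \<partial>D))) / (bp n * pn n)
      = real n * (\<integral>x. h n x \<partial>D)"
      using eventually_gt_at_top[of 0]
    proof eventually_elim
      case (elim n)
      then show ?case
        unfolding h_def integral_mult_right_zero using bp_pos[of n] pn_pos[of n] \<beta>_pos[of n] by simp
    qed
    with lim show ?thesis by (rule Lim_transform_eventually)
  qed
  have var: "(\<lambda>n. real n * (\<integral>x. (h n x)\<^sup>2 \<partial>D)) \<longlonglongrightarrow> \<kappa> * (c_d / \<rho> q) * (w \<bullet> w - (q \<bullet> w)\<^sup>2)"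
  proof -
    let ?I = "\<lambda>n. \<integral>x. ((w \<bullet> (x - q)) * wt n x)\<^sup>2 \<partial>D"
    \<comment> \<open>Regrouped into sequences with known limits; the denominator
      \<open>?k2 * 2\<close> undoes the doubling of \<beta> and, with one leftover
      \<open>?K\<close>, makes up \<open>c_d\<close>.\<close>
    have "(\<lambda>n. ((s n)\<^sup>2 * (bp n / \<beta> n) / real n) * (?k2 * bp n * (2 * \<beta> n * ?I n)) / (?k2 * 2 * (bp n * pn n)\<^sup>2))
      \<longlonglongrightarrow> \<kappa> * (?K * (\<rho> q * (w \<bullet> w - (q \<bullet> w)\<^sup>2))) / (?k2 * 2 * (?K * \<rho> q)\<^sup>2)"
      using Kp \<rho>_pos by (intro tendsto_intros \<kappa> second_moment_limit mass_limit) simp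
    also have "\<kappa> * (?K * (\<rho> q * (w \<bullet> w - (q \<bullet> w)\<^sup>2))) / (?k2 * 2 * (?K * \<rho> q)\<^sup>2) = \<kappa> * (c_d / \<rho> q) * (w \<bullet> w - (q \<bullet> w)\<^sup>2)"
      using Kp \<rho>_pos unfolding c_d by (simp add: power2_eq_square)
    finally have lim: "(\<lambda>n. ((s n)\<^sup>2 * (bp n / \<beta> n) / real n) * (?k2 * bp n * (2 * \<beta> n * ?I n)) / (?k2 * 2 * (bp n * pn n)\<^sup>2))
      \<longlonglongrightarrow> \<kappa> * (c_d / \<rho> q) * (w \<bullet> w - (q \<bullet> w)\<^sup>2)" .
    have "\<forall>\<^sub>F n in sequentially. ((s n)\<^sup>2 * (bp n / \<beta> n) / real n) * (?k2 * bp n * (2 * \<beta> n * ?I n)) / (?k2 * 2 * (bp n * pn n)\<^sup>2)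
      = real n * (\<integral>x. (h n x)\<^sup>2 \<partial>D)"
      using eventually_gt_at_top[of 0]
    proof eventually_elim
      case (elim n)
      have "(\<integral>x. (h n x)\<^sup>2 \<partial>D) = (s n / (real n * pn n))\<^sup>2 * ?I n"
        unfolding h_def power_mult_distrib[of "s n / (real n * pn n)"] by simp
      then show ?case
        using elim bp_pos[of n] pn_pos[of n] \<beta>_pos[of n] by (simp add: power2_eq_square)
    qed
    with lim show ?thesis by (rule Lim_transform_eventually)
  qed
  define A where "A n \<omega> = (\<Sum>i\<in>{1..n}. h n (X i \<omega>))" for n \<omega>
  define R where "R n \<omega> = Zn \<beta> q X n \<omega> / (real n * pn n)" for n \<omega>
  have Am: "A n \<in> borel_measurable M" and Rm: "R n \<in> borel_measurable M" for n
    unfolding A_def R_def Zn_def Tq_def by measurable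
  have Rlim: "(\<lambda>n. prob {\<omega>\<in>space M. \<delta> \<le> \<bar>R n \<omega> - 1\<bar>}) \<longlonglongrightarrow> 0" if "\<delta> > 0" for \<delta>
    using normalization_limit[OF that] by (simp only: R_def)
  have A2i: "integrable M (\<lambda>\<omega>. (A n \<omega>)\<^sup>2)" for n
    unfolding A_def by (rule integrable_sum_law(3)[OF hm hc])
  \<comment> \<open>Both moment sequences converge, hence are bounded over all \<open>n\<close>, and
    n^2 - n is at most n^2.\<close>
  obtain K where K: "\<And>n. (\<integral>\<omega>. (A n \<omega>)\<^sup>2 \<partial>M) \<le> K"
  proof -
    have "convergent (\<lambda>n. real n * (\<integral>x. (h n x)\<^sup>2 \<partial>D) + (real n * (\<integral>x. h n x \<partial>D))\<^sup>2)"
      using tendsto_add[OF var tendsto_power[OF mean, of 2]] by (rule convergentI)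
    then have "Bseq (\<lambda>n. real n * (\<integral>x. (h n x)\<^sup>2 \<partial>D) + (real n * (\<integral>x. h n x \<partial>D))\<^sup>2)"
      by (rule convergent_imp_Bseq)
    then obtain K where K: "\<forall>n. norm (real n * (\<integral>x. (h n x)\<^sup>2 \<partial>D) + (real n * (\<integral>x. h n x \<partial>D))\<^sup>2) \<le> K"
      by (rule BseqE)
    have "(\<integral>\<omega>. (A n \<omega>)\<^sup>2 \<partial>M) \<le> K" for n
    proof -
      have "(\<integral>\<omega>. (A n \<omega>)\<^sup>2 \<partial>M) = real n * (\<integral>x. (h n x)\<^sup>2 \<partial>D) + ((real n)\<^sup>2 - real n) * (\<integral>x. h n x \<partial>D)\<^sup>2"
        unfolding A_def by (rule sum_second_moment[OF hm hc])
      also have "\<dots> \<le> real n * (\<integral>x. (h n x)\<^sup>2 \<partial>D) + (real n * (\<integral>x. h n x \<partial>D))\<^sup>2"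
        by (simp add: power_mult_distrib mult_right_mono)
      also have "\<dots> \<le> K"
        using spec[OF K, of n] by simp
      finally show ?thesis .
    qed
    then show ?thesis by (rule that)
  qed
  have A_lim: "(\<lambda>n. CLINT \<omega>|M. cis (A n \<omega>)) \<longlonglongrightarrow> cis (m * (w \<bullet> Ylim))
      * complex_of_real (exp (- (\<kappa> * (c_d / \<rho> q) * (w \<bullet> w - (q \<bullet> w)\<^sup>2)) / 2))"
    unfolding A_def by (rule char_triangular_array[OF hm hc c0 mean var])
  have "(\<lambda>n. CLINT \<omega>|M. cis (A n \<omega> / R n \<omega>)) \<longlonglongrightarrow> cis (m * (w \<bullet> Ylim))
      * complex_of_real (exp (- (\<kappa> * (c_d / \<rho> q) * (w \<bullet> w - (q \<bullet> w)\<^sup>2)) / 2))"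
    by (rule char_slutsky[where A=A and R=R and K=K]) (fact Am Rm A2i K Rlim A_lim)+
  moreover have "\<forall>\<^sub>F n in sequentially. (CLINT \<omega>|M. cis (A n \<omega> / R n \<omega>)) = (CLINT \<omega>|M. cis (t \<bullet> (s n *\<^sub>R Ycal_n V \<beta> q X n \<omega>)))"
    using eventually_gt_at_top[of 0]
  proof eventually_elim
    case (elim n)
    have "A n \<omega> / R n \<omega> = t \<bullet> (s n *\<^sub>R Ycal_n V \<beta> q X n \<omega>)" for \<omega>
    proof -
      let ?S = "\<Sum>i\<in>{1..n}. (w \<bullet> (X i \<omega> - q)) * wt n (X i \<omega>)"
      have "A n \<omega> = s n / (real n * pn n) * ?S"
        by (simp only: A_def h_def sum_distrib_left)
      moreover have "t \<bullet> (s n *\<^sub>R Ycal_n V \<beta> q X n \<omega>) = s n * (?S / Zn \<beta> q X n \<omega>)"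
        by (simp only: inner_scaleR_right inner_Ycal_n[OF elim] w_def)
      ultimately show ?thesis
        using elim pn_pos[of n] Zn_pos[OF elim, of \<omega>] by (simp add: R_def)
    qed
    then show ?case by (simp only:)
  qed
  ultimately have "(\<lambda>n. CLINT \<omega>|M. cis (t \<bullet> (s n *\<^sub>R Ycal_n V \<beta> q X n \<omega>))) \<longlonglongrightarrow> cis (m * (w \<bullet> Ylim))
      * complex_of_real (exp (- (\<kappa> * (c_d / \<rho> q) * (w \<bullet> w - (q \<bullet> w)\<^sup>2)) / 2))"
    by (rule Lim_transform_eventually)
  then show ?thesis
    by (simp only: w_def inner_scaleR_right dot_lmul_matrix)
qed

end

section \<open>The spherical gradient of the log-density and the constant in the covariance\<close>

lemma GDERIV_unique:
  assumes "GDERIV f x :> a" "GDERIV f x :> b"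
  shows "a = b"
proof -
  have "(\<lambda>h. h \<bullet> a) = (\<lambda>h. h \<bullet> b)"
    using assms unfolding gderiv_def by (rule has_derivative_unique)
  then show ?thesis
    by (metis vector_eq_ldot)
qed

lemma has_derivative_imp_GDERIV:
  fixes f :: "'a::euclidean_space \<Rightarrow> real"
  assumes f: "(f has_derivative D) (at x)"
  obtains g where "GDERIV f x :> g"
proof -
  have l: "linear D" using f by (rule has_derivative_linear)
  have "D h = h \<bullet> (\<Sum>b\<in>Basis. D b *\<^sub>R b)" for h
  proof -
    have "D h = D (\<Sum>b\<in>Basis. (h \<bullet> b) *\<^sub>R b)"
      by (simp add: euclidean_representation)
    also have "\<dots> = (\<Sum>b\<in>Basis. (h \<bullet> b) * D b)"
      by (simp add: linear_sum[OF l] linear_cmul[OF l])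
    finally show ?thesis
      by (simp add: inner_sum_right mult.commute)
  qed
  then have "D = (\<lambda>h. h \<bullet> (\<Sum>b\<in>Basis. D b *\<^sub>R b))" by blast
  with f have "GDERIV f x :> (\<Sum>b\<in>Basis. D b *\<^sub>R b)"
    unfolding gderiv_def by simp
  then show ?thesis by (rule that)
qed

text \<open>\<open>grad\<close> is a definite description, so the chain rule for ln evaluates it
  only together with uniqueness of the gradient.\<close>

lemma sph_grad_ln:
  assumes "GDERIV \<rho> q :> g" "\<rho> q > 0"
  shows "sph_grad (\<lambda>x. ln (\<rho> x)) q = (1 / \<rho> q) *\<^sub>R (g - (q \<bullet> g) *\<^sub>R q)"
proof -
  have D: "GDERIV (\<lambda>x. ln (\<rho> x)) q :> (1 / \<rho> q) *\<^sub>R g"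
    using assms by (intro GDERIV_DERIV_compose) (auto intro!: derivative_eq_intros)
  have "grad (\<lambda>x. ln (\<rho> x)) q = (1 / \<rho> q) *\<^sub>R g"
    unfolding grad_def by (rule the_equality[where P="\<lambda>D. GDERIV (\<lambda>x. ln (\<rho> x)) q :> D", OF D]) (rule GDERIV_unique[OF _ D])
  then show ?thesis
    by (simp add: sph_grad_def tang_proj_mult scaleR_diff_right)
qed

text \<open>With k = (d - 1) / 2 the denominator is (2 pi)^k 2^k 2 = 2^(2 k + 1) pi^k, and 2 k + 1 =
  d. The first factor is the Gaussian mass, the others come from doubling \<beta>.\<close>

lemma gaussian_constant:
  assumes d: "d \<ge> (1::nat)"
  shows "2 powr (- real d) * pi powr (- (real d - 1) / 2)
    = 1 / (sqrt (2 * pi) ^ (d - 1) * (2 powr ((real d - 1) / 2) * 2))"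
proof -
  let ?k = "(real d - 1) / 2"
  have "sqrt (2 * pi) ^ (d - 1) = ((2 * pi) powr (1 / 2)) powr real (d - 1)"
    by (subst powr_realpow) (simp_all add: powr_half_sqrt)
  also have "\<dots> = (2 * pi) powr ?k"
    using d by (simp add: powr_powr of_nat_diff)
  also have "\<dots> = 2 powr ?k * pi powr ?k"
    by (simp add: powr_mult)
  finally have "sqrt (2 * pi) ^ (d - 1) * (2 powr ?k * 2) = (2 powr ?k * 2 powr ?k * 2 powr 1) * pi powr ?k"
    by simp
  also have "2 powr ?k * 2 powr ?k * 2 powr 1 = 2 powr real d"
    by (simp only: powr_add[symmetric]) simp
  finally have "sqrt (2 * pi) ^ (d - 1) * (2 powr ?k * 2) = 2 powr real d * pi powr ?k" .
  moreover have "pi powr (- (real d - 1) / 2) = 1 / pi powr ?k"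
    by (simp only: minus_divide_left[symmetric] powr_minus_divide)
  ultimately show ?thesis
    by (simp only: powr_minus_divide times_divide_times_eq mult_1)
qed

theorem mainTheorem6:
  fixes M :: "'a measure"
    and X :: "nat \<Rightarrow> 'a \<Rightarrow> real ^ 'd"
    and \<rho> :: "real ^ 'd \<Rightarrow> real"
    and U :: "(real ^ 'd) set"
    and q :: "real ^ 'd"
    and V :: "real ^ 'd ^ 'd"
    and \<beta> :: "nat \<Rightarrow> real"
    and \<alpha> c_d :: real
  assumes "prob_space M"
    and dim: "CARD('d) \<ge> 2"
    and q_sphere: "q \<in> sphere 0 1"
    and U_open: "open U" and U_sphere: "sphere 0 1 \<subseteq> U"
    and rho_C2: "C2_on U \<rho>"
    and rho_nonneg: "\<forall>x\<in>sphere 0 1. \<rho> x \<ge> 0"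
    and rho_prob: "integral\<^sup>L sphere_surface \<rho> = 1"
    and rho_q: "\<rho> q > 0"
    and X_rv: "\<And>i. X i \<in> borel_measurable M"
    and X_indep: "prob_space.indep_vars M (\<lambda>_. borel) X UNIV"
    and X_law: "\<And>i. distr M borel (X i) = density sphere_surface (\<lambda>x. ennreal (\<rho> x))"
    and \<beta>_pos: "\<And>n. \<beta> n > 0"
    and \<alpha>_def: "\<alpha> = 2 / (real CARD('d) - 1)"
    and c_d_def: "c_d = 2 powr (- real CARD('d)) * pi powr (- (real CARD('d) - 1) / 2)"
    and \<beta>_inf: "filterlim \<beta> at_top sequentially"
    and \<beta>_small: "(\<lambda>n. \<beta> n * real n powr (- \<alpha>)) \<longlonglongrightarrow> 0"
  shows
    "let Ylim = sph_grad (\<lambda>x. ln (\<rho> x)) q - ((real CARD('d) - 1) / 2) *\<^sub>R q;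
         Sig = (c_d / \<rho> q) *\<^sub>R tang_proj q;
         r = (\<lambda>n. \<beta> n powr (1 + \<alpha>) * real n powr (- \<alpha>))
     in ((r \<longlonglongrightarrow> 0) \<longrightarrow>
           conv_in_prob M (\<lambda>n \<omega>. \<beta> n *\<^sub>R Ycal_n V \<beta> q X n \<omega>) (V *v Ylim))
      \<and> (\<forall>\<tau>>0. (r \<longlonglongrightarrow> \<tau>) \<longrightarrow>
           (\<exists>\<mu>. gaussian_law (V *v Ylim) (\<tau> powr (1 / \<alpha>) *\<^sub>R (V ** Sig ** transpose V)) \<mu> \<and>
                conv_in_distr M (\<lambda>n \<omega>. \<beta> n *\<^sub>R Ycal_n V \<beta> q X n \<omega>) \<mu>))
      \<and> (filterlim r at_top sequentially \<longrightarrow>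
           (\<exists>\<mu>. gaussian_law 0 (V ** Sig ** transpose V) \<mu> \<and>
                conv_in_distr M
                  (\<lambda>n \<omega>. sqrt (real n * \<beta> n powr (1 - 1 / \<alpha>)) *\<^sub>R Ycal_n V \<beta> q X n \<omega>) \<mu>))
      \<and> ((r \<longlonglongrightarrow> 0) \<or> (\<exists>\<tau>>0. r \<longlonglongrightarrow> \<tau>) \<or> filterlim r at_top sequentially \<longrightarrow>
           conv_in_prob M (Ycal_n V \<beta> q X) 0 \<and> conv_in_prob M (ATT V \<beta> q X) (V *v q))"
proof -
  define k where "k = (real CARD('d) - 1) / 2"
  have k: "k > 0" and \<alpha>: "1 / \<alpha> = k" "\<alpha> * k = 1" "\<alpha> > 0"
    using dim by (auto simp: k_def \<alpha>_def)
  have nq: "norm q = 1" using q_sphere by simp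
  obtain Df where Df: "\<forall>x\<in>U. (\<rho> has_derivative blinfun_apply (Df x)) (at x)"
    using rho_C2 unfolding C2_on_def by blast
  obtain g where g: "GDERIV \<rho> q :> g"
    using has_derivative_imp_GDERIV Df q_sphere U_sphere by blast
  have "continuous_on (sphere 0 1) \<rho>"
    using Df U_sphere has_derivative_continuous by (intro continuous_at_imp_continuous_on) blast
  then have "compact (\<rho> ` sphere 0 1)"
    by (intro compact_continuous_image) auto
  then obtain B where B: "\<forall>x\<in>sphere 0 1. \<bar>\<rho> x\<bar> \<le> B"
    by (metis bounded_iff compact_imp_bounded imageI real_norm_def)
  \<comment> \<open>A non-integrable function has integral 0, so integral 1 forces integrability and
    with it measurability.\<close>
  have "integrable sphere_surface \<rho>"
    using rho_prob not_integrable_integral_eq by fastforce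
  then have \<rho>_meas: "\<rho> \<in> borel_measurable borel"
    using borel_measurable_integrable measurable_cong_sets[OF sets_sphere_surface refl] by blast
  \<comment> \<open>At \<open>n = 0\<close> both sides are 0, by the conventions for
    \<open>powr\<close> and for division.\<close>
  have n_powr: "(real n powr (- \<alpha>)) powr k = 1 / real n" for n
  proof -
    have "(real n powr (- \<alpha>)) powr k = real n powr (- 1)"
      using \<alpha>(2) by (simp only: powr_powr mult_minus_left)
    then show ?thesis by (cases "n = 0") (simp_all add: powr_minus_divide)
  qed
  have small: "(\<lambda>n. \<beta> n powr k / real n) \<longlonglongrightarrow> 0"
  proof -
    have "(\<lambda>n. (\<beta> n * real n powr (- \<alpha>)) powr k) \<longlonglongrightarrow> 0"
      using \<beta>_small k \<beta>_pos by (intro tendsto_zero_powrI[OF _ tendsto_const]) (auto simp: less_imp_le)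
    moreover have "(\<beta> n * real n powr (- \<alpha>)) powr k = \<beta> n powr k / real n" for n
      by (simp only: powr_mult n_powr times_divide_eq_right mult_1_right)
    ultimately show ?thesis by simp
  qed
  interpret attention_model M X "density sphere_surface (\<lambda>x. ennreal (\<rho> x))" q \<rho> g B \<beta> V
  proof (intro attention_model.intro iid_sample.intro iid_sample_axioms.intro sphere_density.intro attention_model_axioms.intro)
    show "(\<lambda>n. \<beta> n powr ((real CARD('d) - 1) / 2) / real n) \<longlonglongrightarrow> 0"
      using small by (simp only: k_def)
  qed (use assms(1) X_rv X_indep X_law nq \<rho>_meas B g rho_nonneg rho_q \<beta>_pos \<beta>_inf in auto)
  have bp: "bp n = \<beta> n powr k" for n
    by (simp add: bp_def k_def)
  have Y: "sph_grad (\<lambda>x. ln (\<rho> x)) q - ((real CARD('d) - 1) / 2) *\<^sub>R q = Ylim"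
    unfolding Ylim_def sph_grad_ln[OF g rho_q] ..
  have c_d: "c_d = 1 / (sqrt (2 * pi) ^ (CARD('d) - 1) * (2 powr ((real CARD('d) - 1) / 2) * 2))"
    unfolding c_d_def using dim by (intro gaussian_constant) simp
  then have c_pos: "c_d / \<rho> q > 0" using rho_q by simp
  let ?r = "\<lambda>n. \<beta> n powr (1 + \<alpha>) * real n powr (- \<alpha>)"
  \<comment> \<open>The k-th power of the regime parameter is the variance quantity of
    \<open>char_scaled_Ycal_n\<close> for the scaling \<beta>, so the case distinction is one on its
    limit.\<close>
  have r: "?r n powr k = (\<beta> n)\<^sup>2 * (bp n / \<beta> n) / real n" for n
  proof -
    have "?r n powr k = \<beta> n powr (k + 1) / real n"
      unfolding powr_mult n_powr powr_powr[of "\<beta> n"] using \<alpha>(2) by (simp add: distrib_right add.commute)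
    then show ?thesis
      using \<beta>_pos[of n] by (simp add: bp powr_add power2_eq_square)
  qed
  have beta_inv: "(\<lambda>n. 1 / \<beta> n) \<longlonglongrightarrow> 0"
    by (rule real_tendsto_divide_at_top[OF tendsto_const \<beta>_inf])
  have beta_ratio: "(\<lambda>n. \<beta> n / \<beta> n) \<longlonglongrightarrow> 1"
    using \<beta>_pos by (simp add: less_imp_neq[symmetric])
  let ?Q = "\<lambda>t. (t v* V) \<bullet> (t v* V) - (q \<bullet> (t v* V))\<^sup>2"
  have meas: "(\<lambda>\<omega>. s n *\<^sub>R Ycal_n V \<beta> q X n \<omega>) \<in> borel_measurable M" for s :: "nat \<Rightarrow> real" and n
    by measurable
  \<comment> \<open>\<open>C\<close> is constrained through its quadratic form so that one statement
    fits the covariances of the second and the third regime.\<close>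
  have clt: "\<exists>\<mu>. gaussian_law (m *\<^sub>R (V *v Ylim)) C \<mu> \<and> conv_in_distr M (\<lambda>n \<omega>. s n *\<^sub>R Ycal_n V \<beta> q X n \<omega>) \<mu>"
    if \<kappa>: "(\<lambda>n. (s n)\<^sup>2 * (bp n / \<beta> n) / real n) \<longlonglongrightarrow> \<kappa>" and m: "(\<lambda>n. s n / \<beta> n) \<longlonglongrightarrow> m"
      and "\<kappa> \<ge> 0" and C: "\<And>t. t \<bullet> (C *v t) = \<kappa> * (c_d / \<rho> q) * ?Q t"
    for s \<kappa> m and C :: "real ^ 'd ^ 'd"
  proof -
    have "\<kappa> * (c_d / \<rho> q) \<ge> 0" 
      by (rule mult_nonneg_nonneg[OF \<open>\<kappa> \<ge> 0\<close> less_imp_le[OF c_pos]])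
    then obtain \<mu> where \<mu>: "gaussian_law (m *\<^sub>R (V *v Ylim)) C \<mu>"
      by (rule gaussian_law_tangent[OF nq _ C])
    have "conv_in_distr M (\<lambda>n \<omega>. s n *\<^sub>R Ycal_n V \<beta> q X n \<omega>) \<mu>"
    proof (rule conv_in_distr_charI[OF prob_space_axioms meas])
      fix t
      have "(CLINT x|\<mu>. cis (t \<bullet> x)) = cis (t \<bullet> (m *\<^sub>R (V *v Ylim)))
          * complex_of_real (exp (- (\<kappa> * (c_d / \<rho> q) * ?Q t) / 2))"
        using \<mu> unfolding gaussian_law_def by (simp only: C)
      then show "(\<lambda>n. CLINT \<omega>|M. cis (t \<bullet> (s n *\<^sub>R Ycal_n V \<beta> q X n \<omega>))) \<longlonglongrightarrow> (CLINT x|\<mu>. cis (t \<bullet> x))"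
        using char_scaled_Ycal_n[OF \<kappa> m c_d, of t] by (simp only:)
    qed (use \<mu> in \<open>auto simp: gaussian_law_def\<close>)
    with \<mu> show ?thesis by blast
  qed
  \<comment> \<open>Zero limiting variance makes the Gaussian factor 1, leaving the characteristic
    function of a constant.\<close>
  have lln: "conv_in_prob M (\<lambda>n \<omega>. s n *\<^sub>R Ycal_n V \<beta> q X n \<omega>) (m *\<^sub>R (V *v Ylim))"
    if \<kappa>: "(\<lambda>n. (s n)\<^sup>2 * (bp n / \<beta> n) / real n) \<longlonglongrightarrow> 0" and m: "(\<lambda>n. s n / \<beta> n) \<longlonglongrightarrow> m" for s m
    by (rule conv_in_prob_charI[OF prob_space_axioms meas])
       (use char_scaled_Ycal_n[OF \<kappa> m c_d] in simp)
  let ?Sig = "(c_d / \<rho> q) *\<^sub>R tang_proj q"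
  have case1: "conv_in_prob M (\<lambda>n \<omega>. \<beta> n *\<^sub>R Ycal_n V \<beta> q X n \<omega>) (V *v Ylim)" if "?r \<longlonglongrightarrow> 0"
  proof -
    have "(\<lambda>n. ?r n powr k) \<longlonglongrightarrow> 0"
      using that k by (intro tendsto_zero_powrI[OF _ tendsto_const]) auto
    then show ?thesis
      using lln[of \<beta> 1] beta_ratio by (simp only: r scaleR_one)
  qed
  have case2: "\<exists>\<mu>. gaussian_law (V *v Ylim) (\<tau> powr (1 / \<alpha>) *\<^sub>R (V ** ?Sig ** transpose V)) \<mu> \<and>
      conv_in_distr M (\<lambda>n \<omega>. \<beta> n *\<^sub>R Ycal_n V \<beta> q X n \<omega>) \<mu>"
    if "\<tau> > 0" "?r \<longlonglongrightarrow> \<tau>" for \<tau>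
  proof -
    have "(\<lambda>n. ?r n powr k) \<longlonglongrightarrow> \<tau> powr k"
      using that by (intro tendsto_powr tendsto_const) auto
    then have "\<exists>\<mu>. gaussian_law (1 *\<^sub>R (V *v Ylim)) (\<tau> powr (1 / \<alpha>) *\<^sub>R (V ** ?Sig ** transpose V)) \<mu> \<and>
      conv_in_distr M (\<lambda>n \<omega>. \<beta> n *\<^sub>R Ycal_n V \<beta> q X n \<omega>) \<mu>"
      unfolding r by (intro clt[OF _ beta_ratio]) (simp_all only: \<alpha>(1) quadratic_form_tangent powr_ge_zero)
    then show ?thesis by (simp only: scaleR_one)
  qed
  have case3: "\<exists>\<mu>. gaussian_law 0 (V ** ?Sig ** transpose V) \<mu> \<and>
      conv_in_distr M (\<lambda>n \<omega>. sqrt (real n * \<beta> n powr (1 - 1 / \<alpha>)) *\<^sub>R Ycal_n V \<beta> q X n \<omega>) \<mu>"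
    if "filterlim ?r at_top sequentially"
  proof -
    let ?s = "\<lambda>n. sqrt (real n * \<beta> n powr (1 - 1 / \<alpha>))"
    \<comment> \<open>The scaling is chosen to make the variance factor exactly 1 for positive
      \<open>n\<close>.\<close>
    have s2: "(?s n)\<^sup>2 = real n * (\<beta> n / bp n)" for n
      using \<beta>_pos[of n] by (simp add: \<alpha> bp powr_diff)
    have "\<forall>\<^sub>F n in sequentially. (?s n)\<^sup>2 * (bp n / \<beta> n) / real n = 1"
      using eventually_gt_at_top[of 0]
    proof eventually_elim
      case (elim n)
      then show ?case unfolding s2 using bp_pos[of n] \<beta>_pos[of n] by simp
    qed
    then have \<kappa>: "(\<lambda>n. (?s n)\<^sup>2 * (bp n / \<beta> n) / real n) \<longlonglongrightarrow> 1"
      by (rule tendsto_eventually)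
    \<comment> \<open>Relative to \<beta> the scaling is the square root of the inverse of
      \<open>?r n powr k\<close>, which vanishes in this regime, so the drift disappears.\<close>
    have "(\<lambda>n. ?r n powr (- k)) \<longlonglongrightarrow> 0"
      using k that by (intro tendsto_neg_powr) auto
    then have "(\<lambda>n. sqrt (inverse (?r n powr k))) \<longlonglongrightarrow> sqrt 0"
      unfolding powr_minus by (rule tendsto_real_sqrt)
    moreover have "sqrt (inverse (?r n powr k)) = ?s n / \<beta> n" for n
    proof -
      have "inverse (?r n powr k) = (?s n / \<beta> n)\<^sup>2"
        unfolding r power_divide s2 using bp_pos[of n] \<beta>_pos[of n] by (simp add: power2_eq_square field_simps)
      moreover have "?s n / \<beta> n \<ge> 0" using \<beta>_pos[of n] by simp
      ultimately show ?thesis by (simp only: real_sqrt_unique)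
    qed
    ultimately have m: "(\<lambda>n. ?s n / \<beta> n) \<longlonglongrightarrow> 0" by simp
    have "t \<bullet> ((V ** ?Sig ** transpose V) *v t) = 1 * (c_d / \<rho> q) * ?Q t" for t
      using quadratic_form_tangent[of t 1 V "c_d / \<rho> q" q] by (simp only: scaleR_one)
    from clt[OF \<kappa> m _ this] show ?thesis
      by (simp only: scaleR_zero_left zero_le_one)
  qed
  \<comment> \<open>The scaling 1: \<open>\<kappa>\<close> and \<open>m\<close> vanish by the
    standing growth conditions, whatever the regime.\<close>
  have Y0: "conv_in_prob M (Ycal_n V \<beta> q X) 0"
  proof -
    have "(\<lambda>n. \<beta> n powr k / real n * (1 / \<beta> n)) \<longlonglongrightarrow> 0 * 0"
      by (intro tendsto_mult small beta_inv)
    then have "(\<lambda>n. 1\<^sup>2 * (bp n / \<beta> n) / real n) \<longlonglongrightarrow> 0"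
      by (simp add: bp mult.commute)
    from lln[OF this beta_inv] show ?thesis by simp
  qed
  then have "conv_in_prob M (ATT V \<beta> q X) (V *v q)"
    unfolding conv_in_prob_def by (simp add: Ycal_n_def dist_norm)
  with Y0 case1 case2 case3 show ?thesis
    unfolding Let_def Y by blast
qed

end
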